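(* Let $\Omega\subset\mathbb{R}^d$ be a bounded open interval when $d=1$, or a bounded connected $C^{1,1}$ open set when $d\ge2$. Let $\beta\in(0,\tfrac12)$ and let $(D_t)_{t\ge0}$ be a subordinator whose Laplace exponent $\phi$ is regularly varying at $\infty$ with index $\beta$ and whose Lévy measure $\nu$ has an almost monotone density. Let $(W_t)_{t\ge0}$ be a Brownian motion in $\mathbb{R}^d$ independent of $(D_t)$. Then $$\lim_{t\downarrow0}\frac{|\Omega|-\tilde Q^{W\circ D}_\Omega(t)}{t}=\int_0^\infty\big(|\Omega|-Q^W_\Omega(u)\big)\,\nu(du).$$
   Context: Brownian motion: $(W_t)$ is normalized so that $\mathbb{E}_0[e^{-i\langle\xi,W_t\rangle}]=e^{-t|\xi|^2}$ (generator $\Delta$). Under $\mathbb{P}_x$ (the product of the law of $W$ started at $x$ and the law of the independent time change) $W_0=x$. Heat contents: $\tau^W_\Omega=\inf\{t>0: W_t\in\Omega^c\}$ and $Q^W_\Omega(u)=\int_\Omega\mathbb{P}_x(\tau^W_\Omega>u)\,dx$. The killed process is $W^\Omega_t=W_t$ for $t<\tau^W_\Omega$ and $W^\Omega_t=\partial$ (a cemetery state, not in $\Omega$) for $t\ge\tau^W_\Omega$. The spectral heat content of the subordinate killed process $(W^\Omega_{D_t})$ is $\tilde Q^{W\circ D}_\Omega(t)=\int_\Omega\mathbb{P}_x(\tau^{W^\Omega\circ D}_\Omega>t)\,dx$, where $\tau^{W^\Omega\circ D}_\Omega=\inf\{t>0: W^\Omega_{D_t}\notin\Omega\}$. $|\Omega|$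 is $d$-dimensional Lebesgue measure. Subordinator: a subordinator $(D_t)$ with Laplace exponent $\phi$ is a strictly increasing one-dimensional Lévy process with càdlàg paths, $D_0=0$, killing rate $0$, drift $0$, and infinite Lévy measure $\nu$ ($\nu((0,\infty))=\infty$, $\int_0^\infty(y\wedge1)\,\nu(dy)<\infty$), with $\mathbb{E}[e^{-sD_t}]=e^{-t\phi(s)}$, $\phi(s)=\int_0^\infty(1-e^{-sy})\,\nu(dy)$. A function $f:(0,\infty)\to(0,\infty)$ is regularly varying at $\infty$ with index $\rho$ if $f(cs)/f(s)\to c^\rho$ as $s\to\infty$ for each $c>0$. The Lévy measure has an almost monotone density if $\nu(dx)=\nu(x)\,dx$ and there is $C\ge1$ with $\nu(y)\le C\nu(x)$ for all $0<x\le y$. *)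

theory Defs
  imports "HOL-Probability.Probability"
begin

section \<open>Processes\<close>

text \<open>Processes are indexed by real times and constrained only at times \<open>t \<ge> 0\<close>.  Path
  properties are required of every sample path; initial values of Brownian motion only almost
  surely, so that one path space can carry the laws for all starting points.\<close>

definition independent_increments ::
  "'w measure \<Rightarrow> (real \<Rightarrow> 'w \<Rightarrow> 'b::euclidean_space) \<Rightarrow> bool" where
  "independent_increments M X \<longleftrightarrow>
     (\<forall>(t::nat \<Rightarrow> real) n. 0 \<le> t 0 \<and> incseq t \<longrightarrow>
        prob_space.indep_vars M (\<lambda>_. borel) (\<lambda>i \<omega>. X (t (Suc i)) \<omega> - X (t i) \<omega>) {..<n})"

definition stationary_increments ::
  "'w measure \<Rightarrow> (real \<Rightarrow> 'w \<Rightarrow> 'b::euclidean_space) \<Rightarrow> bool" where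
  "stationary_increments M X \<longleftrightarrow>
     (\<forall>s\<ge>0. \<forall>h\<ge>0. distr M borel (\<lambda>\<omega>. X (s + h) \<omega> - X s \<omega>) = distr M borel (\<lambda>\<omega>. X h \<omega> - X 0 \<omega>))"

definition cadlag :: "(real \<Rightarrow> 'b::topological_space) \<Rightarrow> bool" where
  "cadlag f \<longleftrightarrow> (\<forall>t\<ge>0. (f \<longlongrightarrow> f t) (at_right t)) \<and> (\<forall>t>0. \<exists>l. (f \<longlongrightarrow> l) (at_left t))"

text \<open>The normalization is the one with generator \<open>\<Delta>\<close> (not \<open>\<Delta>/2\<close>).\<close>

definition brownian_motion ::
  "'w measure \<Rightarrow> 'b::euclidean_space \<Rightarrow> (real \<Rightarrow> 'w \<Rightarrow> 'b) \<Rightarrow> bool" where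
  "brownian_motion M x W \<longleftrightarrow>
     prob_space M \<and>
     (\<forall>t\<ge>0. W t \<in> borel_measurable M) \<and>
     (AE \<omega> in M. W 0 \<omega> = x) \<and>
     independent_increments M W \<and>
     stationary_increments M W \<and>
     (\<forall>t\<ge>0. \<forall>\<xi>. (\<integral>\<omega>. exp (- \<i> * complex_of_real (\<xi> \<bullet> (W t \<omega> - x))) \<partial>M)
                  = complex_of_real (exp (- t * (norm \<xi>)\<^sup>2))) \<and>
     (\<forall>\<omega>\<in>space M. continuous_on {0..} (\<lambda>t. W t \<omega>))"

definition infinite_levy_measure :: "real measure \<Rightarrow> bool" where
  "infinite_levy_measure \<nu> \<longleftrightarrow>
     sets \<nu> = sets borel \<and>
     emeasure \<nu> {..0} = 0 \<and>
     emeasure \<nu> {0<..} = \<infinity> \<and>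
     (\<integral>\<^sup>+y\<in>{0<..}. ennreal (min y 1) \<partial>\<nu>) < \<infinity>"

text \<open>Zero killing rate and zero drift are expressed by the form of \<open>\<phi>\<close>.\<close>

definition subordinator ::
  "'s measure \<Rightarrow> (real \<Rightarrow> 's \<Rightarrow> real) \<Rightarrow> (real \<Rightarrow> real) \<Rightarrow> real measure \<Rightarrow> bool" where
  "subordinator M D \<phi> \<nu> \<longleftrightarrow>
     prob_space M \<and>
     (\<forall>t\<ge>0. D t \<in> borel_measurable M) \<and>
     independent_increments M D \<and>
     stationary_increments M D \<and>
     (\<forall>\<omega>\<in>space M. D 0 \<omega> = 0 \<and> strict_mono_on {0..} (\<lambda>t. D t \<omega>) \<and> cadlag (\<lambda>t. D t \<omega>)) \<and>
     infinite_levy_measure \<nu> \<and>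
     (\<forall>s>0. \<phi> s = (LINT y:{0<..}|\<nu>. 1 - exp (- s * y))) \<and>
     (\<forall>t\<ge>0. \<forall>s>0. (\<integral>\<omega>. exp (- s * D t \<omega>) \<partial>M) = exp (- t * \<phi> s))"

definition regularly_varying_at_infinity :: "(real \<Rightarrow> real) \<Rightarrow> real \<Rightarrow> bool" where
  "regularly_varying_at_infinity f \<rho> \<longleftrightarrow>
     (\<forall>s>0. f s > 0) \<and> (\<forall>c>0. ((\<lambda>s. f (c * s) / f s) \<longlongrightarrow> c powr \<rho>) at_top)"

definition almost_monotone_density :: "real measure \<Rightarrow> bool" where
  "almost_monotone_density \<nu> \<longleftrightarrow>
     (\<exists>n \<in> borel_measurable borel.
        (\<forall>x>0. 0 \<le> n x) \<and>
        \<nu> = density lborel (\<lambda>x. ennreal (n x) * indicator {0<..} x) \<and>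
        (\<exists>C\<ge>1. \<forall>x y. 0 < x \<and> x \<le> y \<longrightarrow> n y \<le> C * n x))"

section \<open>Heat contents\<close>

definition exit_time :: "'a set \<Rightarrow> (real \<Rightarrow> 'a) \<Rightarrow> ereal" where
  "exit_time A w = Inf (ereal ` {t. 0 < t \<and> w t \<notin> A})"

text \<open>The state space is extended by the cemetery state \<^const>\<open>None\<close>.\<close>

definition killed_path :: "'b set \<Rightarrow> (real \<Rightarrow> 'b) \<Rightarrow> real \<Rightarrow> 'b option" where
  "killed_path \<Omega> w t = (if ereal t < exit_time \<Omega> w then Some (w t) else None)"

definition heat_content ::
  "('b \<Rightarrow> 'w measure) \<Rightarrow> (real \<Rightarrow> 'w \<Rightarrow> 'b) \<Rightarrow> 'b::euclidean_space set \<Rightarrow> real \<Rightarrow> real" where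
  "heat_content PW W \<Omega> u =
     (LINT x:\<Omega>|lborel.
        measure (PW x) {\<omega> \<in> space (PW x). ereal u < exit_time \<Omega> (\<lambda>t. W t \<omega>)})"

text \<open>Independence of the Brownian motion and of the time change \<open>D\<close> is built into the
  product measure, which is the law \<open>P\<^sub>x\<close> of the pair.\<close>

definition subordinate_killed_heat_content ::
  "('b \<Rightarrow> 'w measure) \<Rightarrow> (real \<Rightarrow> 'w \<Rightarrow> 'b) \<Rightarrow> 's measure \<Rightarrow> (real \<Rightarrow> 's \<Rightarrow> real) \<Rightarrow>
   'b::euclidean_space set \<Rightarrow> real \<Rightarrow> real" where
  "subordinate_killed_heat_content PW W PD D \<Omega> t =
     (LINT x:\<Omega>|lborel.
        measure (PW x \<Otimes>\<^sub>M PD)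
          {(\<omega>, \<eta>) \<in> space (PW x \<Otimes>\<^sub>M PD).
             ereal t < exit_time (Some ` \<Omega>) (\<lambda>s. killed_path \<Omega> (\<lambda>r. W r \<omega>) (D s \<eta>))})"

section \<open>Domains\<close>

text \<open>Near every boundary point \<open>z\<close> the set is, uniformly in \<open>z\<close>, the part of a ball lying above
  the graph of a \<open>C\<^sup>1\<^sup>,\<^sup>1\<close> function.  In an orthonormal coordinate system centred at \<open>z\<close> whose
  last axis is the unit vector \<open>e\<close>, the remaining coordinates range over the hyperplane \<open>H\<close>
  orthogonal to \<open>e\<close>, which plays the role of \<open>\<real>\<^sup>d\<^sup>-\<^sup>1\<close>; \<open>G\<close> is the gradient of the
  boundary function \<open>\<psi>\<close> along \<open>H\<close>.  Values of \<open>\<psi>\<close> and \<open>G\<close> off \<open>H\<close> are irrelevant.\<close>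

definition C11_open_set :: "'b::euclidean_space set \<Rightarrow> bool" where
  "C11_open_set \<Omega> \<longleftrightarrow>
     open \<Omega> \<and>
     (\<exists>R>0. \<exists>\<Lambda>>0. \<forall>z\<in>frontier \<Omega>. \<exists>(e::'b) (\<psi>::'b \<Rightarrow> real) (G::'b \<Rightarrow> 'b).
        let H = {h. h \<bullet> e = 0} in
        norm e = 1 \<and> \<psi> 0 = 0 \<and> G 0 = 0 \<and>
        (\<forall>h\<in>H. G h \<in> H \<and> (\<psi> has_derivative (\<lambda>v. G h \<bullet> v)) (at h within H) \<and> norm (G h) \<le> \<Lambda>) \<and>
        \<Lambda>-lipschitz_on H G \<and>
        \<Omega> \<inter> ball z R =
          {y \<in> ball z R. (y - z) \<bullet> e > \<psi> ((y - z) - ((y - z) \<bullet> e) *\<^sub>R e)})"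

text \<open>In dimension one a \<^const>\<open>box\<close> is an open interval.\<close>

definition admissible_domain :: "'b::euclidean_space set \<Rightarrow> bool" where
  "admissible_domain \<Omega> \<longleftrightarrow>
     (if DIM('b) = 1 then \<Omega> \<noteq> {} \<and> (\<exists>a b. \<Omega> = box a b)
      else bounded \<Omega> \<and> connected \<Omega> \<and> C11_open_set \<Omega>)"

end

theory Submission
  imports Defs
begin

text \<open>
  Let \<open>\<tau>\<close> be the exit time of \<open>W\<close> from \<open>\<Omega>\<close> and \<open>g(u) = |\<Omega>| - Q(u)\<close> the heat lost up to time \<open>u\<close>.  The subordinate
  killed process is alive at time \<open>t\<close> exactly if \<open>D\<^sub>t < \<tau>\<close>, because \<open>D\<close> is increasing and right continuous.
  Independence and Fubini then give \<open>|\<Omega>| - Q\<^sup>~(t) = E g(D\<^sub>t)\<close>, and the theorem says that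
  \<open>E g(D\<^sub>t) / t\<close> tends to \<open>\<integral> g d\<nu>\<close> as \<open>t\<close> decreases to \<open>0\<close>.

  Away from \<open>0\<close> the measures \<open>P(D\<^sub>t \<in> dy) / t\<close> converge to \<open>\<nu>\<close>, but \<open>\<nu>\<close> is infinite near \<open>0\<close>, so the behaviour
  of \<open>g\<close> at \<open>0\<close> decides.  There \<open>g(u) \<le> c \<surd>u\<close>: to leave \<open>\<Omega>\<close> by time \<open>u\<close> the path has to move by its
  distance \<open>\<delta>\<close> from the complement, which has probability at most a constant times \<open>u / \<delta>\<^sup>2\<close>
  (\<open>exit_probability_le\<close>, from Ottaviani's inequality), and the set of points with \<open>\<delta> < r\<close> has measure
  at most \<open>K r\<close> (\<open>boundary_layer_measure_le\<close>, because the boundary is locally a Lipschitz graph).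

  The square root is compared with \<open>\<Psi>(y) = \<Sum>\<^sub>n 2\<^sup>-\<^sup>n\<^sup>/\<^sup>2 (1 - exp (- 2\<^sup>n y))\<close>, for which
  \<open>\<integral> \<Psi> d\<nu> = \<Sum>\<^sub>n 2\<^sup>-\<^sup>n\<^sup>/\<^sup>2 \<phi>(2\<^sup>n)\<close>; this is finite since \<open>\<phi>\<close> varies regularly with index \<open>\<beta> < 1/2\<close>.  The moments of
  \<open>e\<^sup>-\<^sup>y\<close> under the finite measures \<open>\<Psi>(y) P(D\<^sub>t \<in> dy) / t\<close> are explicit in \<open>\<phi>\<close> and converge to those under
  \<open>\<Psi> d\<nu>\<close>, so these measures converge weakly.  The function \<open>g/\<Psi>\<close> is bounded, and, \<open>g\<close> and \<open>\<Psi>\<close> being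
  monotone, it has countably many discontinuities, which \<open>\<nu>\<close> does not charge because it has a density.
  Hence its integrals converge (\<open>subordinator_small_time_limit\<close>), which is the claim.

  The heat contents integrate over the starting point \<open>x\<close>, and the laws \<open>P\<^sub>x\<close> are linked only through
  their characteristic functions.  These determine the law of an increment
  (\<open>measure_eqI_gaussian_integrals\<close>), hence survival probabilities are limits of probabilities of grid
  events that can be computed for all \<open>x\<close> on one probability space; so they are measurable in \<open>x\<close>.
\<close>

section \<open>Moments and weak convergence on the unit interval\<close>

lemma polynomial_approximation_unit_interval:
  fixes f :: "real \<Rightarrow> real"
  assumes "continuous_on {0..1} f" "0 < e"
  obtains a :: "nat \<Rightarrow> real" and n where "\<And>z. z \<in> {0..1} \<Longrightarrow> \<bar>f z - (\<Sum>i\<le>n. a i * z ^ i)\<bar> < e"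
proof -
  obtain g where g: "real_polynomial_function g" "\<And>x. x \<in> {0..1} \<Longrightarrow> \<bar>f x - g x\<bar> < e"
    using Stone_Weierstrass_real_polynomial_function[of "{0..1}" f e] assms by auto
  then obtain a n where "g = (\<lambda>x. \<Sum>i\<le>n. a i * x ^ i)"
    unfolding real_polynomial_function_iff_sum by blast
  then show ?thesis using g that by auto
qed

text \<open>On \<open>[0,1]\<close> convergence of moments is convergence of the integrals of polynomials, and by
  Weierstrass these are uniformly dense in the continuous functions.\<close>

lemma moments_conv_imp_weak_conv_unit_interval:
  fixes \<mu> :: "nat \<Rightarrow> real measure" and M :: "real measure"
  assumes d\<mu>: "\<And>n. real_distribution (\<mu> n)" and dM: "real_distribution M"
    and s\<mu>: "\<And>n. AE z in \<mu> n. z \<in> {0..1}" and sM: "AE z in M. z \<in> {0..1}"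
    and moments: "\<And>j. (\<lambda>n. \<integral>z. z ^ j \<partial>\<mu> n) \<longlonglongrightarrow> (\<integral>z. z ^ j \<partial>M)"
  shows "weak_conv_m \<mu> M"
proof (rule integral_cts_step_conv_imp_weak_conv[OF d\<mu> dM])
  fix x y :: real assume xy: "x < y"
  let ?f = "cts_step x y"
  have f_cont: "continuous_on UNIV ?f"
    using cts_step_uniformly_continuous[OF xy] by (rule uniformly_continuous_imp_continuous)
  have close: "\<bar>(\<integral>z. ?f z \<partial>N) - (\<Sum>i\<le>k. a i * (\<integral>z. z ^ i \<partial>N))\<bar> \<le> e"
    if N: "real_distribution N" "AE z in N. z \<in> {0..1}"
      and a: "\<And>z. z \<in> {0..1} \<Longrightarrow> \<bar>?f z - (\<Sum>i\<le>k. a i * z ^ i)\<bar> < e" for N k a e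
  proof -
    interpret real_distribution N by fact
    have p: "integrable N (\<lambda>z. z ^ i)" for i
      by (rule integrable_const_bound[of _ 1]) (use N(2) in \<open>auto simp: power_le_one\<close>)
    then have ps: "integrable N (\<lambda>z. \<Sum>i\<le>k. a i * z ^ i)"
      by simp
    have "(\<integral>z. ?f z \<partial>N) - (\<Sum>i\<le>k. a i * (\<integral>z. z ^ i \<partial>N)) = (\<integral>z. ?f z - (\<Sum>i\<le>k. a i * z ^ i) \<partial>N)"
      using p ps integrable_cts_step[OF xy] by (simp add: Bochner_Integration.integral_sum)
    also have "\<bar>\<dots>\<bar> \<le> (\<integral>z. \<bar>?f z - (\<Sum>i\<le>k. a i * z ^ i)\<bar> \<partial>N)"
      by simp
    also have "\<dots> \<le> (\<integral>z. e \<partial>N)"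
      using ps integrable_cts_step[OF xy] a N(2)
      by (intro integral_mono_AE) (auto intro: less_imp_le)
    also have "\<dots> = e" using prob_space by simp
    finally show ?thesis .
  qed
  show "(\<lambda>n. \<integral>z. ?f z \<partial>\<mu> n) \<longlonglongrightarrow> (\<integral>z. ?f z \<partial>M)"
  proof (rule LIMSEQ_I)
    fix r :: real assume "0 < r"
    then have r3: "0 < r / 3" by simp
    obtain a k where a: "\<And>z. z \<in> {0..1} \<Longrightarrow> \<bar>?f z - (\<Sum>i\<le>k. a i * z ^ i)\<bar> < r / 3"
      using polynomial_approximation_unit_interval[OF continuous_on_subset[OF f_cont subset_UNIV] r3]
      by blast
    have "(\<lambda>n. \<Sum>i\<le>k. a i * (\<integral>z. z ^ i \<partial>\<mu> n)) \<longlonglongrightarrow> (\<Sum>i\<le>k. a i * (\<integral>z. z ^ i \<partial>M))"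
      by (intro tendsto_intros moments)
    from LIMSEQ_D[OF this r3, unfolded real_norm_def]
    obtain n0 where n0: "\<And>n. n \<ge> n0 \<Longrightarrow>
        \<bar>(\<Sum>i\<le>k. a i * (\<integral>z. z ^ i \<partial>\<mu> n)) - (\<Sum>i\<le>k. a i * (\<integral>z. z ^ i \<partial>M))\<bar> < r / 3"
      by blast
    show "\<exists>n0. \<forall>n\<ge>n0. norm ((\<integral>z. ?f z \<partial>\<mu> n) - (\<integral>z. ?f z \<partial>M)) < r"
    proof (intro exI allI impI)
      fix n assume "n0 \<le> n"
      show "norm ((\<integral>z. ?f z \<partial>\<mu> n) - (\<integral>z. ?f z \<partial>M)) < r"
        using n0[OF \<open>n0 \<le> n\<close>] close[OF d\<mu>[of n] s\<mu> a] close[OF dM sM a]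
        unfolding real_norm_def by linarith
    qed
  qed
qed

section \<open>Small-time asymptotics of a subordinator\<close>

text \<open>The square root function is replaced by a combination of the functions \<open>1 - e\<^sup>-\<^sup>s\<^sup>y\<close> with \<open>s = 2\<^sup>n\<close>: it is
  still of order \<open>\<surd>y\<close> for small \<open>y\<close>, but its integrals against \<open>\<nu>\<close> and against the law of \<open>D\<^sub>t\<close> are explicit
  in terms of the Laplace exponent.  Cutting off at \<open>0\<close> keeps the series convergent everywhere.\<close>

definition bernstein_root :: "real \<Rightarrow> real" where
  "bernstein_root y = (\<Sum>n. (1 / sqrt 2) ^ n * (1 - exp (- (2 ^ n * max 0 y))))"

lemma summable_bernstein_root:
  "summable (\<lambda>n. (1 / sqrt 2) ^ n * (1 - exp (- (2 ^ n * max 0 y))))"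
proof (rule summable_comparison_test')
  show "summable (\<lambda>n. (1 / sqrt 2) ^ n :: real)"
    by (rule summable_geometric) simp
  show "norm ((1 / sqrt 2) ^ n * (1 - exp (- (2 ^ n * max 0 y)))) \<le> (1 / sqrt 2) ^ n" for n :: nat
    by (simp add: abs_mult mult_left_le)
qed

lemma bernstein_root_measurable [measurable]: "bernstein_root \<in> borel_measurable borel"
  unfolding bernstein_root_def by measurable

lemma bernstein_root_ge_term:
  "(1 / sqrt 2) ^ n * (1 - exp (- (2 ^ n * max 0 y))) \<le> bernstein_root y"
  unfolding bernstein_root_def
  by (rule order_trans[OF _ sum_le_suminf[OF summable_bernstein_root, of "{n}"]]) auto

lemma bernstein_root_nonneg: "0 \<le> bernstein_root y"
  unfolding bernstein_root_def by (intro suminf_nonneg summable_bernstein_root) simp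

lemma bernstein_root_pos: "0 < y \<Longrightarrow> 0 < bernstein_root y"
  using bernstein_root_ge_term[of 0 y] by (simp add: less_le_trans[rotated])

text \<open>If \<open>2\<^sup>-\<^sup>n \<le> y \<le> 2 \<sqdot> 2\<^sup>-\<^sup>n\<close>, the single summand with index \<open>n\<close> is already of order \<open>\<surd>y\<close>.\<close>

lemma sqrt_le_bernstein_root:
  assumes "0 < y" "y \<le> 1"
  shows "sqrt y \<le> sqrt 2 / (1 - exp (- 1)) * bernstein_root y"
proof -
  obtain m where m: "y > (1 / 2) ^ m"
    using real_arch_pow_inv[of y "1/2"] assms by auto
  \<comment> \<open>the dyadic scale of \<open>y\<close>\<close>
  define n where "n = (LEAST n. (1 / 2) ^ n \<le> y)"
  have n: "(1 / 2) ^ n \<le> y"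
    unfolding n_def by (rule LeastI[of _ m]) (use m in simp)
  have n': "y \<le> 2 * (1 / 2) ^ n"
  proof (cases n)
    case 0 then show ?thesis using assms by simp
  next
    case (Suc k)
    then have "\<not> (1 / 2) ^ k \<le> y"
      using not_less_Least[of k "\<lambda>n. (1 / 2) ^ n \<le> y"] by (simp add: n_def)
    then show ?thesis using Suc by simp
  qed
  have "sqrt y \<le> sqrt (2 * (1 / 2) ^ n)"
    using n' by simp
  also have "\<dots> = sqrt 2 * (1 / sqrt 2) ^ n"
    by (simp add: real_sqrt_mult real_sqrt_power real_sqrt_divide)
  finally have "sqrt y \<le> sqrt 2 * (1 / sqrt 2) ^ n" .
  moreover have "(1 / sqrt 2) ^ n * (1 - exp (- 1)) \<le> bernstein_root y"
  proof -
    have "1 \<le> 2 ^ n * max 0 y"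
      using n assms by (simp add: field_simps)
    then show ?thesis
      by (intro order_trans[OF _ bernstein_root_ge_term[of n y]] mult_left_mono) auto
  qed
  then have "(1 / sqrt 2) ^ n \<le> bernstein_root y / (1 - exp (- 1))"
    by (simp add: pos_le_divide_eq)
  ultimately show ?thesis
    using mult_left_mono[of "(1 / sqrt 2) ^ n" "bernstein_root y / (1 - exp (- 1))" "sqrt 2"] by simp
qed

lemma bernstein_root_mono: "mono bernstein_root"
proof (rule monoI)
  fix x y :: real assume "x \<le> y"
  then show "bernstein_root x \<le> bernstein_root y"
    unfolding bernstein_root_def
    by (intro suminf_le summable_bernstein_root mult_left_mono) auto
qed

lemma levy_AE_pos: "infinite_levy_measure \<nu> \<Longrightarrow> AE y in \<nu>. 0 < y"
  by (rule AE_I[where N="{..0}"]) (auto simp: infinite_levy_measure_def not_less)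

lemma levy_integrable:
  assumes "infinite_levy_measure \<nu>" "0 \<le> s"
  shows "integrable \<nu> (\<lambda>y. 1 - exp (- (s * y)))"
proof (rule integrableI_bounded)
  have [measurable_cong]: "sets \<nu> = sets borel"
    using assms by (simp add: infinite_levy_measure_def)
  show "(\<lambda>y. 1 - exp (- (s * y))) \<in> borel_measurable \<nu>" by measurable
  have le: "1 - exp (- (s * y)) \<le> max 1 s * min y 1" if "0 < y" for y
  proof (cases "y \<le> 1")
    case True
    have "1 - exp (- (s * y)) \<le> s * y"
      using exp_ge_add_one_self[of "- (s * y)"] by simp
    also have "\<dots> \<le> max 1 s * y" using that by (intro mult_right_mono) auto
    finally show ?thesis using True by simp
  next
    case False
    have "1 - exp (- (s * y)) \<le> 1" by simp
    also have "1 \<le> max 1 s" by simp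
    finally show ?thesis using False by simp
  qed
  have "(\<integral>\<^sup>+y. ennreal (norm (1 - exp (- (s * y)))) \<partial>\<nu>)
      \<le> (\<integral>\<^sup>+y. ennreal (max 1 s) * (ennreal (min y 1) * indicator {0<..} y) \<partial>\<nu>)"
  proof (rule nn_integral_mono_AE)
    show "AE y in \<nu>. ennreal (norm (1 - exp (- (s * y))))
        \<le> ennreal (max 1 s) * (ennreal (min y 1) * indicator {0<..} y)"
      using levy_AE_pos[OF assms(1)]
    proof eventually_elim
      case (elim y)
      then show ?case
        using le[OF elim] assms(2) by (simp add: ennreal_mult[symmetric])
    qed
  qed
  also have "\<dots> = ennreal (max 1 s) * (\<integral>\<^sup>+y\<in>{0<..}. ennreal (min y 1) \<partial>\<nu>)"
    by (simp add: nn_integral_cmult)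
  also have "\<dots> < \<infinity>"
    using assms(1) by (simp add: infinite_levy_measure_def ennreal_mult_less_top)
  finally show "(\<integral>\<^sup>+y. ennreal (norm (1 - exp (- (s * y)))) \<partial>\<nu>) < \<infinity>" .
qed

text \<open>The Laplace exponent is prescribed on \<open>(0,\<infinity>)\<close> only; integrating against \<open>\<nu>\<close> extends it to
  \<open>0\<close>, where the zeroth moments below need it.\<close>

definition levy_exponent :: "real measure \<Rightarrow> real \<Rightarrow> real" where
  "levy_exponent \<nu> s = (\<integral>y. 1 - exp (- (s * y)) \<partial>\<nu>)"

lemma levy_exponent_0 [simp]: "levy_exponent \<nu> 0 = 0"
  by (simp add: levy_exponent_def)

lemma subordinator_levy_exponent:
  assumes "subordinator PD D \<phi> \<nu>" "0 < s"
  shows "\<phi> s = levy_exponent \<nu> s"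
proof -
  have \<nu>: "infinite_levy_measure \<nu>" and "\<phi> s = (LINT y:{0<..}|\<nu>. 1 - exp (- s * y))"
    using assms by (auto simp: subordinator_def)
  have [measurable_cong]: "sets \<nu> = sets borel"
    using \<nu> by (simp add: infinite_levy_measure_def)
  have "(LINT y:{0<..}|\<nu>. 1 - exp (- s * y)) = (\<integral>y. 1 - exp (- (s * y)) \<partial>\<nu>)"
    unfolding set_lebesgue_integral_def
  proof (rule integral_cong_AE)
    show "AE y in \<nu>. indicat_real {0<..} y *\<^sub>R (1 - exp (- s * y)) = 1 - exp (- (s * y))"
      using levy_AE_pos[OF \<nu>] by eventually_elim simp
  qed auto
  then show ?thesis
    using \<open>\<phi> s = _\<close> by (simp add: levy_exponent_def)
qed

text \<open>Since \<open>e\<^sup>-\<^sup>j\<^sup>y \<le> 1\<close> on the support of \<open>\<nu>\<close>, the increments of the exponent from \<open>j\<close> are bounded by those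
  from \<open>0\<close>; this bound dominates all moments simultaneously.\<close>

lemma levy_exponent_increment:
  assumes "infinite_levy_measure \<nu>" "0 \<le> j" "0 \<le> s"
  shows "integrable \<nu> (\<lambda>y. exp (- (j * y)) * (1 - exp (- (s * y))))"
    and "(\<integral>y. exp (- (j * y)) * (1 - exp (- (s * y))) \<partial>\<nu>) = levy_exponent \<nu> (j + s) - levy_exponent \<nu> j"
    and "levy_exponent \<nu> j \<le> levy_exponent \<nu> (j + s)"
    and "levy_exponent \<nu> (j + s) - levy_exponent \<nu> j \<le> levy_exponent \<nu> s"
proof -
  let ?\<phi> = "levy_exponent \<nu>"
  have eq: "exp (- (j * y)) * (1 - exp (- (s * y))) = (1 - exp (- ((j + s) * y))) - (1 - exp (- (j * y)))" for y
    by (simp add: algebra_simps exp_add[symmetric])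
  have i: "integrable \<nu> (\<lambda>y. 1 - exp (- ((j + s) * y)))" "integrable \<nu> (\<lambda>y. 1 - exp (- (j * y)))"
      "integrable \<nu> (\<lambda>y. 1 - exp (- (s * y)))"
    using assms by (auto intro: levy_integrable)
  show int: "integrable \<nu> (\<lambda>y. exp (- (j * y)) * (1 - exp (- (s * y))))"
    unfolding eq using i(1,2) by (rule Bochner_Integration.integrable_diff)
  show e: "(\<integral>y. exp (- (j * y)) * (1 - exp (- (s * y))) \<partial>\<nu>) = ?\<phi> (j + s) - ?\<phi> j"
    unfolding eq levy_exponent_def using i(1,2) by (rule Bochner_Integration.integral_diff)
  have "0 \<le> (\<integral>y. exp (- (j * y)) * (1 - exp (- (s * y))) \<partial>\<nu>)"
    by (rule integral_nonneg_AE) (use levy_AE_pos[OF assms(1)] assms in \<open>auto elim!: eventually_mono\<close>)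
  then show "?\<phi> j \<le> ?\<phi> (j + s)" using e by simp
  have "(\<integral>y. exp (- (j * y)) * (1 - exp (- (s * y))) \<partial>\<nu>) \<le> ?\<phi> s"
    unfolding levy_exponent_def using int i(3)
  proof (rule integral_mono_AE)
    show "AE y in \<nu>. exp (- (j * y)) * (1 - exp (- (s * y))) \<le> 1 - exp (- (s * y))"
      using levy_AE_pos[OF assms(1)] by eventually_elim (use assms in \<open>auto intro!: mult_left_le_one_le\<close>)
  qed
  then show "?\<phi> (j + s) - ?\<phi> j \<le> ?\<phi> s" using e by simp
qed

text \<open>Along \<open>s = 2\<^sup>n\<close> regular variation makes the ratio of consecutive terms tend to \<open>2\<^sup>\<beta>\<^sup>-\<^sup>1\<^sup>/\<^sup>2\<close>, which is
  less than \<open>1\<close> precisely because \<open>\<beta> < 1/2\<close>.\<close>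

lemma summable_regularly_varying_dyadic:
  assumes rv: "regularly_varying_at_infinity \<phi> \<beta>" and \<beta>: "\<beta> < 1 / 2"
  shows "summable (\<lambda>n. (1 / sqrt 2) ^ n * \<phi> (2 ^ n))"
proof -
  have pos: "\<phi> s > 0" if "s > 0" for s
    using rv that by (simp add: regularly_varying_at_infinity_def)
  have "2 powr \<beta> < 2 powr (1 / 2)"
    using \<beta> by simp
  then have lt: "2 powr \<beta> < sqrt 2"
    by (simp add: powr_half_sqrt)
  then obtain r where r: "2 powr \<beta> < r" "r < sqrt 2"
    using dense by blast
  have "((\<lambda>s. \<phi> (2 * s) / \<phi> s) \<longlongrightarrow> 2 powr \<beta>) at_top"
    using rv by (simp add: regularly_varying_at_infinity_def)
  moreover have "filterlim (\<lambda>n. (2::real) ^ n) at_top sequentially"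
    by (rule filterlim_at_infinity_imp_filterlim_at_top[OF filterlim_realpow_sequentially_gt1]) auto
  ultimately have "(\<lambda>n. \<phi> (2 * 2 ^ n) / \<phi> (2 ^ n)) \<longlonglongrightarrow> 2 powr \<beta>"
    by (rule filterlim_compose)
  then have "\<forall>\<^sub>F n in sequentially. \<phi> (2 * 2 ^ n) / \<phi> (2 ^ n) < r"
    using r(1) by (rule order_tendstoD)
  then obtain N where N: "\<And>n. n \<ge> N \<Longrightarrow> \<phi> (2 * 2 ^ n) / \<phi> (2 ^ n) < r"
    unfolding eventually_sequentially by blast
  show ?thesis
  proof (rule summable_ratio_test[of "r / sqrt 2" N])
    show "r / sqrt 2 < 1" using r by simp
    fix n assume "N \<le> n"
    have "\<phi> (2 ^ Suc n) \<le> r * \<phi> (2 ^ n)"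
      using N[OF \<open>N \<le> n\<close>] pos[of "2 ^ n"] by (simp add: field_simps)
    then have "(1 / sqrt 2) ^ Suc n * \<phi> (2 ^ Suc n) \<le> (1 / sqrt 2) ^ Suc n * (r * \<phi> (2 ^ n))"
      by (intro mult_left_mono) auto
    then show "norm ((1 / sqrt 2) ^ Suc n * \<phi> (2 ^ Suc n)) \<le> r / sqrt 2 * norm ((1 / sqrt 2) ^ n * \<phi> (2 ^ n))"
      using pos[of "2 ^ Suc n"] pos[of "2 ^ n"] by (simp add: abs_mult field_simps)
  qed
qed

text \<open>Termwise integration of the series, valid for any weight under which the terms have summable
  integrals; it is applied to the law of \<open>D\<^sub>t\<close> and to \<open>\<nu>\<close>.\<close>

lemma integral_exp_bernstein_root:
  fixes X :: "'s \<Rightarrow> real"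
  assumes [measurable]: "X \<in> borel_measurable M" and X: "AE \<eta> in M. 0 \<le> X \<eta>"
    and int: "\<And>n::nat. integrable M (\<lambda>\<eta>. exp (- (j * X \<eta>)) * (1 - exp (- (2 ^ n * X \<eta>))))"
    and val: "\<And>n::nat. (\<integral>\<eta>. exp (- (j * X \<eta>)) * (1 - exp (- (2 ^ n * X \<eta>))) \<partial>M) = a n"
    and sum: "summable (\<lambda>n. (1 / sqrt 2) ^ n * a n)"
  shows "integrable M (\<lambda>\<eta>. bernstein_root (X \<eta>) * exp (- (j * X \<eta>)))"
    and "(\<integral>\<eta>. bernstein_root (X \<eta>) * exp (- (j * X \<eta>)) \<partial>M) = (\<Sum>n. (1 / sqrt 2) ^ n * a n)"
proof -
  let ?f = "\<lambda>n \<eta>. (1 / sqrt 2) ^ n * (exp (- (j * X \<eta>)) * (1 - exp (- (2 ^ n * X \<eta>))))"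
  have i: "integrable M (?f n)" for n
    using int[of n] by simp
  have s: "AE \<eta> in M. summable (\<lambda>n. norm (?f n \<eta>))"
    using X
  proof eventually_elim
    case (elim \<eta>)
    have "summable (\<lambda>n. exp (- (j * X \<eta>)) * ((1 / sqrt 2) ^ n * (1 - exp (- (2 ^ n * max 0 (X \<eta>))))))"
      by (intro summable_mult summable_bernstein_root)
    then show ?case
      using elim by (simp add: abs_mult mult_ac max_def)
  qed
  have "(\<integral>\<eta>. norm (?f n \<eta>) \<partial>M) = (1 / sqrt 2) ^ n * a n" for n
  proof -
    have "(\<integral>\<eta>. norm (?f n \<eta>) \<partial>M) = (\<integral>\<eta>. ?f n \<eta> \<partial>M)"
      by (rule integral_cong_AE) (use X in \<open>auto simp: abs_mult\<close>)
    then show ?thesis by (simp add: val)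
  qed
  then have s': "summable (\<lambda>n. \<integral>\<eta>. norm (?f n \<eta>) \<partial>M)"
    using sum by simp
  have eq: "AE \<eta> in M. (\<Sum>n. ?f n \<eta>) = bernstein_root (X \<eta>) * exp (- (j * X \<eta>))"
    using X
  proof eventually_elim
    case (elim \<eta>)
    have "(\<Sum>n. ?f n \<eta>) = (\<Sum>n. (1 / sqrt 2) ^ n * (1 - exp (- (2 ^ n * max 0 (X \<eta>)))) * exp (- (j * X \<eta>)))"
      using elim by (simp add: mult_ac max_def)
    also have "\<dots> = bernstein_root (X \<eta>) * exp (- (j * X \<eta>))"
      unfolding bernstein_root_def by (rule suminf_mult2[symmetric]) (rule summable_bernstein_root)
    finally show ?case .
  qed
  have "integrable M (\<lambda>\<eta>. \<Sum>n. ?f n \<eta>)"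
    by (rule integrable_suminf[OF i s s'])
  then show "integrable M (\<lambda>\<eta>. bernstein_root (X \<eta>) * exp (- (j * X \<eta>)))"
    by (rule integrable_cong_AE_imp) (use eq in auto)
  have "(\<integral>\<eta>. bernstein_root (X \<eta>) * exp (- (j * X \<eta>)) \<partial>M) = (\<integral>\<eta>. (\<Sum>n. ?f n \<eta>) \<partial>M)"
    by (rule integral_cong_AE) (use eq in auto)
  also have "\<dots> = (\<Sum>n. \<integral>\<eta>. ?f n \<eta> \<partial>M)"
    by (rule integral_suminf[OF i s s'])
  finally show "(\<integral>\<eta>. bernstein_root (X \<eta>) * exp (- (j * X \<eta>)) \<partial>M) = (\<Sum>n. (1 / sqrt 2) ^ n * a n)"
    by (simp add: val)
qed

lemma levy_bernstein_root:
  assumes sub: "subordinator PD D \<phi> \<nu>" and rv: "regularly_varying_at_infinity \<phi> \<beta>" and "\<beta> < 1 / 2" and "0 \<le> j"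
  shows "integrable \<nu> (\<lambda>y. bernstein_root y * exp (- (j * y)))"
    and "(\<integral>y. bernstein_root y * exp (- (j * y)) \<partial>\<nu>)
        = (\<Sum>n. (1 / sqrt 2) ^ n * (levy_exponent \<nu> (j + 2 ^ n) - levy_exponent \<nu> j))"
    and "summable (\<lambda>n. (1 / sqrt 2) ^ n * levy_exponent \<nu> (2 ^ n))"
proof -
  let ?\<phi> = "levy_exponent \<nu>"
  have \<nu>: "infinite_levy_measure \<nu>"
    using sub by (simp add: subordinator_def)
  then have [measurable_cong]: "sets \<nu> = sets borel"
    by (simp add: infinite_levy_measure_def)
  show s: "summable (\<lambda>n. (1 / sqrt 2) ^ n * ?\<phi> (2 ^ n))"
    using summable_regularly_varying_dyadic[OF rv \<open>\<beta> < 1 / 2\<close>] subordinator_levy_exponent[OF sub] by simp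
  have s': "summable (\<lambda>n. (1 / sqrt 2) ^ n * (?\<phi> (j + 2 ^ n) - ?\<phi> j))"
  proof (rule summable_comparison_test'[OF s])
    fix n :: nat
    show "norm ((1 / sqrt 2) ^ n * (?\<phi> (j + 2 ^ n) - ?\<phi> j))
        \<le> (1 / sqrt 2) ^ n * ?\<phi> (2 ^ n)"
      using levy_exponent_increment(3,4)[OF \<nu> \<open>0 \<le> j\<close>, of "2 ^ n"]
      by (simp add: abs_mult mult_left_mono)
  qed
  have nn: "AE y in \<nu>. 0 \<le> y"
    using levy_AE_pos[OF \<nu>] by eventually_elim simp
  show "integrable \<nu> (\<lambda>y. bernstein_root y * exp (- (j * y)))"
    "(\<integral>y. bernstein_root y * exp (- (j * y)) \<partial>\<nu>)
        = (\<Sum>n. (1 / sqrt 2) ^ n * (?\<phi> (j + 2 ^ n) - ?\<phi> j))"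
    using integral_exp_bernstein_root[of "\<lambda>y. y" \<nu> j "\<lambda>n. ?\<phi> (j + 2 ^ n) - ?\<phi> j"]
      levy_exponent_increment(1,2)[OF \<nu> \<open>0 \<le> j\<close>] s' nn
    by auto
qed

lemma subordinator_pos:
  assumes "subordinator PD D \<phi> \<nu>" "\<eta> \<in> space PD" "0 < t"
  shows "0 < D t \<eta>"
proof -
  have "D 0 \<eta> = 0" "strict_mono_on {0..} (\<lambda>t. D t \<eta>)"
    using assms by (auto simp: subordinator_def)
  then show ?thesis
    using strict_mono_onD[of "{0..}" "\<lambda>t. D t \<eta>" 0 t] assms by simp
qed

lemma subordinator_laplace:
  assumes sub: "subordinator PD D \<phi> \<nu>" and "0 < t" "0 \<le> s"
  shows "integrable PD (\<lambda>\<eta>. exp (- (s * D t \<eta>)))"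
    and "(\<integral>\<eta>. exp (- (s * D t \<eta>)) \<partial>PD) = exp (- (t * levy_exponent \<nu> s))"
proof -
  interpret prob_space PD using sub by (simp add: subordinator_def)
  have [measurable]: "D t \<in> borel_measurable PD"
    using sub assms by (simp add: subordinator_def)
  show "integrable PD (\<lambda>\<eta>. exp (- (s * D t \<eta>)))"
    by (rule integrable_const_bound[of _ 1])
       (use less_imp_le[OF subordinator_pos[OF sub]] assms in \<open>auto intro!: AE_I2\<close>)
  show "(\<integral>\<eta>. exp (- (s * D t \<eta>)) \<partial>PD) = exp (- (t * levy_exponent \<nu> s))"
  proof (cases "s = 0")
    case True then show ?thesis by (simp add: prob_space)
  next
    case False
    then have "0 < s" using assms by simp
    then show ?thesis
      using sub assms subordinator_levy_exponent[OF sub \<open>0 < s\<close>] by (simp add: subordinator_def)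
  qed
qed

lemma subordinator_bernstein_root:
  assumes sub: "subordinator PD D \<phi> \<nu>" and "0 < t" and "0 \<le> j"
  shows "integrable PD (\<lambda>\<eta>. bernstein_root (D t \<eta>) * exp (- (j * D t \<eta>)))"
    and "(\<integral>\<eta>. bernstein_root (D t \<eta>) * exp (- (j * D t \<eta>)) \<partial>PD)
       = (\<Sum>n. (1 / sqrt 2) ^ n * (exp (- (t * levy_exponent \<nu> j)) - exp (- (t * levy_exponent \<nu> (j + 2 ^ n)))))"
    and "summable (\<lambda>n. (1 / sqrt 2) ^ n * (exp (- (t * levy_exponent \<nu> j)) - exp (- (t * levy_exponent \<nu> (j + 2 ^ n)))))"
proof -
  let ?\<phi> = "levy_exponent \<nu>"
  let ?d = "\<lambda>n. (1 / sqrt 2) ^ n * (exp (- (t * ?\<phi> j)) - exp (- (t * ?\<phi> (j + 2 ^ n))))"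
  have \<nu>: "infinite_levy_measure \<nu>" and [measurable]: "D t \<in> borel_measurable PD"
    using sub assms by (auto simp: subordinator_def)
  have eq: "exp (- (j * y)) * (1 - exp (- (s * y))) = exp (- (j * y)) - exp (- ((j + s) * y))" for y s :: real
    by (simp add: algebra_simps exp_add[symmetric])
  have i: "integrable PD (\<lambda>\<eta>. exp (- (j * D t \<eta>)) * (1 - exp (- (2 ^ n * D t \<eta>))))" for n :: nat
    unfolding eq using assms by (intro Bochner_Integration.integrable_diff subordinator_laplace[OF sub]) auto
  have v: "(\<integral>\<eta>. exp (- (j * D t \<eta>)) * (1 - exp (- (2 ^ n * D t \<eta>))) \<partial>PD)
      = exp (- (t * ?\<phi> j)) - exp (- (t * ?\<phi> (j + 2 ^ n)))" for n :: nat
    unfolding eq using assms by (simp add: subordinator_laplace[OF sub] Bochner_Integration.integral_diff)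
  show s: "summable ?d"
  proof (rule summable_comparison_test')
    show "summable (\<lambda>n. (1 / sqrt 2) ^ n :: real)"
      by (rule summable_geometric) simp
    fix n :: nat
    have "0 \<le> ?\<phi> j" "?\<phi> j \<le> ?\<phi> (j + 2 ^ n)"
      using levy_exponent_increment(3)[OF \<nu> \<open>0 \<le> j\<close>, of "2 ^ n"] levy_exponent_increment(3)[OF \<nu> _ \<open>0 \<le> j\<close>, of 0] by auto
    then have "exp (- (t * ?\<phi> (j + 2 ^ n))) \<le> exp (- (t * ?\<phi> j))"
      "exp (- (t * ?\<phi> j)) \<le> 1" "0 < exp (- (t * ?\<phi> (j + 2 ^ n)))"
      using \<open>0 < t\<close> by auto
    then have le: "norm (exp (- (t * ?\<phi> j)) - exp (- (t * ?\<phi> (j + 2 ^ n)))) \<le> 1"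
      unfolding real_norm_def by linarith
    show "norm (?d n)
        \<le> (1 / sqrt 2) ^ n"
      using mult_left_mono[OF le, of "(1 / sqrt 2) ^ n"] by (simp add: abs_mult)
  qed
  show "integrable PD (\<lambda>\<eta>. bernstein_root (D t \<eta>) * exp (- (j * D t \<eta>)))"
    "(\<integral>\<eta>. bernstein_root (D t \<eta>) * exp (- (j * D t \<eta>)) \<partial>PD)
       = (\<Sum>n. ?d n)"
    using integral_exp_bernstein_root[OF _ _ i v s] subordinator_pos[OF sub _ \<open>0 < t\<close>]
    by (auto intro: less_imp_le)
qed

lemma exp_difference_quotient_le:
  fixes a b t :: real
  assumes "0 \<le> a" "a \<le> b" "0 < t"
  shows "\<bar>(exp (- (t * a)) - exp (- (t * b))) / t\<bar> \<le> b - a"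
proof -
  have "exp (- (t * a)) - exp (- (t * b)) = exp (- (t * a)) * (1 - exp (- (t * (b - a))))"
    by (simp add: algebra_simps exp_add[symmetric])
  also have "\<dots> \<le> 1 * (t * (b - a))"
    using assms exp_ge_add_one_self[of "- (t * (b - a))"] by (intro mult_mono) auto
  finally have "exp (- (t * a)) - exp (- (t * b)) \<le> t * (b - a)" by simp
  moreover have "exp (- (t * b)) \<le> exp (- (t * a))"
    using assms by simp
  ultimately show ?thesis
    using assms by (simp add: field_simps)
qed

lemma exp_difference_quotient_tendsto:
  fixes a b :: real
  shows "((\<lambda>t. (exp (- (t * a)) - exp (- (t * b))) / t) \<longlongrightarrow> b - a) (at_right 0)"
proof -
  have "((\<lambda>t. exp (- (t * a)) - exp (- (t * b))) has_field_derivative b - a) (at 0)"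
    by (auto intro!: derivative_eq_intros)
  then have "((\<lambda>t. (exp (- (t * a)) - exp (- (t * b))) / t) \<longlongrightarrow> b - a) (at 0)"
    by (simp add: DERIV_def)
  then show ?thesis
    by (rule filterlim_mono) (auto simp: at_le)
qed

text \<open>Both sides are series over \<open>n\<close>.  With \<open>a\<close> and \<open>b\<close> the exponents at \<open>j\<close> and \<open>j + 2\<^sup>n\<close>, the terms
  \<open>(e\<^sup>-\<^sup>t\<^sup>a - e\<^sup>-\<^sup>t\<^sup>b) / t\<close> tend to \<open>b - a\<close> and are bounded by it, so Tannery's theorem applies.\<close>

lemma subordinator_bernstein_root_tendsto:
  assumes sub: "subordinator PD D \<phi> \<nu>" and rv: "regularly_varying_at_infinity \<phi> \<beta>" "\<beta> < 1 / 2" and "0 \<le> j"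
  shows "((\<lambda>t. (\<integral>\<eta>. bernstein_root (D t \<eta>) * exp (- (j * D t \<eta>)) \<partial>PD) / t)
      \<longlongrightarrow> (\<integral>y. bernstein_root y * exp (- (j * y)) \<partial>\<nu>)) (at_right 0)"
proof -
  let ?\<phi> = "levy_exponent \<nu>"
  have \<nu>: "infinite_levy_measure \<nu>" using sub by (auto simp: subordinator_def)
  define a where "a k t = (1 / sqrt 2) ^ k *
    ((exp (- (t * ?\<phi> j)) - exp (- (t * ?\<phi> (j + 2 ^ k)))) / t)" for k :: nat and t
  have "((\<lambda>t. \<Sum>k. a k t) \<longlongrightarrow> (\<Sum>k. (1 / sqrt 2) ^ k * (?\<phi> (j + 2 ^ k) - ?\<phi> j))) (at_right 0)"
  proof (rule tannerys_theorem[THEN conjunct2, THEN conjunct2])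
    show "(a k \<longlongrightarrow> (1 / sqrt 2) ^ k * (?\<phi> (j + 2 ^ k) - ?\<phi> j)) (at_right 0)" for k
      unfolding a_def by (intro tendsto_intros exp_difference_quotient_tendsto)
    show "summable (\<lambda>n. (1 / sqrt 2) ^ n * ?\<phi> (2 ^ n))"
      using levy_bernstein_root(3)[OF assms] .
    have "\<forall>\<^sub>F t in at_right 0. \<forall>k. norm (a k t) \<le> (1 / sqrt 2) ^ k * ?\<phi> (2 ^ k)"
      using eventually_at_right_less[of 0]
    proof eventually_elim
      case (elim t)
      show ?case
      proof
        fix k :: nat
        have 1: "0 \<le> ?\<phi> j" "?\<phi> j \<le> ?\<phi> (j + 2 ^ k)"
          "?\<phi> (j + 2 ^ k) - ?\<phi> j \<le> ?\<phi> (2 ^ k)"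
          using levy_exponent_increment(3,4)[OF \<nu> \<open>0 \<le> j\<close>, of "2 ^ k"] levy_exponent_increment(3)[OF \<nu> _ \<open>0 \<le> j\<close>, of 0] by auto
        have 2: "\<bar>(exp (- (t * ?\<phi> j)) - exp (- (t * ?\<phi> (j + 2 ^ k)))) / t\<bar> \<le> ?\<phi> (2 ^ k)"
          using exp_difference_quotient_le[OF 1(1,2) elim] 1(3) by linarith
        then show "norm (a k t) \<le> (1 / sqrt 2) ^ k * ?\<phi> (2 ^ k)"
          unfolding a_def norm_mult real_norm_def[of "_ / t"] by (intro mult_mono) auto
      qed
    qed
    then show "\<forall>\<^sub>F (k, t) in sequentially \<times>\<^sub>F at_right 0. norm (a k t) \<le> (1 / sqrt 2) ^ k * ?\<phi> (2 ^ k)"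
      unfolding eventually_prod_filter
      by (intro exI[of _ "\<lambda>_. True"] exI[of _ "\<lambda>t. \<forall>k. norm (a k t) \<le> (1 / sqrt 2) ^ k * ?\<phi> (2 ^ k)"]) auto
  qed simp
  moreover have "\<forall>\<^sub>F t in at_right 0. (\<Sum>k. a k t) = (\<integral>\<eta>. bernstein_root (D t \<eta>) * exp (- (j * D t \<eta>)) \<partial>PD) / t"
    using eventually_at_right_less[of 0]
  proof eventually_elim
    case (elim t)
    have "(\<Sum>k. a k t) = (\<Sum>k. (1 / sqrt 2) ^ k * (exp (- (t * ?\<phi> j)) - exp (- (t * ?\<phi> (j + 2 ^ k)))) / t)"
      by (simp add: a_def)
    also have "\<dots> = (\<Sum>k. (1 / sqrt 2) ^ k * (exp (- (t * ?\<phi> j)) - exp (- (t * ?\<phi> (j + 2 ^ k))))) / t"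
      by (rule suminf_divide[OF subordinator_bernstein_root(3)[OF sub elim \<open>0 \<le> j\<close>]])
    finally show ?case
      unfolding subordinator_bernstein_root(2)[OF sub elim \<open>0 \<le> j\<close>] .
  qed
  ultimately show ?thesis
    unfolding levy_bernstein_root(2)[OF assms] by (rule Lim_transform_eventually)
qed

text \<open>Normalizing the weight \<open>w\<close> and pushing forward along \<open>f\<close> produces probability measures on the line.
  With \<open>f = e\<^sup>-\<^sup>y\<close> this compresses \<open>(0,\<infinity>)\<close> into the unit interval.\<close>

lemma tilted_distribution:
  fixes w f :: "'s \<Rightarrow> real"
  assumes w: "integrable M w" "AE x in M. 0 \<le> w x" "0 < (\<integral>x. w x \<partial>M)"
    and [measurable]: "f \<in> borel_measurable M"
  defines "N \<equiv> distr (density M (\<lambda>x. ennreal (w x / (\<integral>x. w x \<partial>M)))) borel f"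
  shows "real_distribution N"
    and "h \<in> borel_measurable borel \<Longrightarrow> (\<integral>z. h z \<partial>N) = (\<integral>x. w x * h (f x) \<partial>M) / (\<integral>x. w x \<partial>M)"
    and "(AE x in M. f x \<in> A) \<Longrightarrow> A \<in> sets borel \<Longrightarrow> AE z in N. z \<in> A"
proof -
  let ?W = "\<integral>x. w x \<partial>M"
  have [measurable]: "w \<in> borel_measurable M" using w by auto
  have wn: "AE x in M. 0 \<le> w x / ?W"
    using w(2) by eventually_elim (use w(3) in simp)
  have "(\<integral>\<^sup>+x. ennreal (w x / ?W) \<partial>M) = ennreal (\<integral>x. w x / ?W \<partial>M)"
    by (rule nn_integral_eq_integral) (use w wn in auto)
  also have "\<dots> = 1" using w(3) by simp
  finally have "prob_space (density M (\<lambda>x. ennreal (w x / ?W)))"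
    by (intro prob_spaceI) (simp add: emeasure_density)
  then have "prob_space N"
    unfolding N_def by (rule prob_space.prob_space_distr) simp
  then show "real_distribution N"
    by (simp add: real_distribution_def real_distribution_axioms_def N_def)
  show "(\<integral>z. h z \<partial>N) = (\<integral>x. w x * h (f x) \<partial>M) / ?W" if [measurable]: "h \<in> borel_measurable borel"
  proof -
    have "(\<integral>z. h z \<partial>N) = (\<integral>x. w x / ?W * h (f x) \<partial>M)"
      unfolding N_def using wn by (subst integral_distr) (auto simp: integral_density)
    also have "\<dots> = (\<integral>x. w x * h (f x) / ?W \<partial>M)" by simp
    finally show ?thesis by simp
  qed
  show "AE z in N. z \<in> A" if "AE x in M. f x \<in> A" and [measurable]: "A \<in> sets borel"
    unfolding N_def using that(1)
    by (simp add: AE_distr_iff AE_density) (auto elim: eventually_mono)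
qed

text \<open>Monotone functions have countably many discontinuities, and away from \<open>0\<close> and \<open>1\<close> the quotient is
  continuous wherever both functions are continuous at \<open>- ln z\<close>.\<close>

lemma countable_discontinuities_exp_quotient:
  fixes g w :: "real \<Rightarrow> real"
  assumes g: "mono_on {0<..} g" and w: "mono w" and pos: "\<And>y. 0 < y \<Longrightarrow> 0 < w y"
  shows "countable {z. \<not> isCont (\<lambda>z. if 0 < z \<and> z < 1 then g (- ln z) / w (- ln z) else 0) z}"
    (is "countable {z. \<not> isCont ?F z}")
proof -
  let ?B = "{y\<in>{0<..}. \<not> isCont g y} \<union> {y. \<not> isCont w y}"
  have cB: "countable ?B"
    by (intro countable_Un mono_on_ctble_discont_open[OF _ g] mono_ctble_discont[OF w]) simp
  have "{z. \<not> isCont ?F z} \<subseteq> {0, 1} \<union> (\<lambda>y. exp (- y)) ` ?B"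
  proof
    fix z assume z: "z \<in> {z. \<not> isCont ?F z}"
    show "z \<in> {0, 1} \<union> (\<lambda>y. exp (- y)) ` ?B"
    proof (rule ccontr)
      assume nz: "z \<notin> {0, 1} \<union> (\<lambda>y. exp (- y)) ` ?B"
      have "z \<notin> {0, 1}" using nz by (meson UnI1)
      then consider "z < 0" | "z > 1" | "0 < z" "z < 1" by fastforce
      then have "isCont ?F z"
      proof cases
        case 1
        have "\<forall>\<^sub>F x in nhds z. ?F x = 0"
          using eventually_nhds_in_open[of "{..<0}" z] 1 by (auto elim!: eventually_mono)
        then show ?thesis by (subst isCont_cong) auto
      next
        case 2
        have "\<forall>\<^sub>F x in nhds z. ?F x = 0"
          using eventually_nhds_in_open[of "{1<..}" z] 2 by (auto elim!: eventually_mono)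
        then show ?thesis by (subst isCont_cong) auto
      next
        case 3
        have y: "- ln z > 0" "z = exp (- (- ln z))" using 3 by auto
        then have "- ln z \<notin> ?B" using nz by blast
        then have c: "isCont g (- ln z)" "isCont w (- ln z)" using y(1) by auto
        have "isCont (\<lambda>z. - ln z) z" using 3 by (auto intro!: continuous_intros)
        then have "isCont (\<lambda>z. g (- ln z)) z" "isCont (\<lambda>z. w (- ln z)) z"
          using c by (auto intro: isCont_o2)
        moreover have "w (- ln z) \<noteq> 0" using pos[OF y(1)] by simp
        ultimately have "isCont (\<lambda>z. g (- ln z) / w (- ln z)) z" by simp
        moreover have "\<forall>\<^sub>F x in nhds z. ?F x = g (- ln x) / w (- ln x)"
          using eventually_nhds_in_open[of "{0<..<1}" z] 3 by (auto elim!: eventually_mono)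
        ultimately show ?thesis by (subst isCont_cong) auto
      qed
      then show False using z by simp
    qed
  qed
  then show ?thesis
    by (rule countable_subset) (rule countable_Un[OF _ countable_image[OF cB]], simp)
qed

text \<open>Dividing by \<open>\<Psi>\<close> trades the singular behaviour at \<open>0\<close> for a bounded integrand \<open>g/\<Psi>\<close>, and the laws tilted by \<open>\<Psi>\<close>
  converge weakly by their moments in the variable \<open>z = e\<^sup>-\<^sup>y\<close>.\<close>

lemma subordinator_small_time_limit:
  fixes g :: "real \<Rightarrow> real"
  assumes sub: "subordinator PD D \<phi> \<nu>" and rv: "regularly_varying_at_infinity \<phi> \<beta>" "\<beta> < 1 / 2"
    and diffuse: "\<And>A. countable A \<Longrightarrow> emeasure \<nu> A = 0"
    and g_mono: "mono_on {0<..} g" and g_nonneg: "\<And>u. 0 < u \<Longrightarrow> 0 \<le> g u"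
    and g_le: "\<And>u. 0 < u \<Longrightarrow> g u \<le> C * bernstein_root u"
  shows "set_integrable \<nu> {0<..} g"
    and "((\<lambda>t. (\<integral>\<eta>. g (D t \<eta>) \<partial>PD) / t) \<longlongrightarrow> (LINT u:{0<..}|\<nu>. g u)) (at_right 0)"
proof -
  let ?\<phi> = "levy_exponent \<nu>"
  have \<nu>: "infinite_levy_measure \<nu>" using sub by (simp add: subordinator_def)
  have [measurable_cong]: "sets \<nu> = sets borel" using \<nu> by (simp add: infinite_levy_measure_def)
  have Dm: "D t \<in> borel_measurable PD" if "0 < t" for t
    using sub that by (simp add: subordinator_def)
  let ?\<Psi> = bernstein_root
  let ?m = "\<lambda>t. \<integral>\<eta>. ?\<Psi> (D t \<eta>) \<partial>PD" and ?c = "\<integral>y. ?\<Psi> y \<partial>\<nu>"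
  interpret PD: prob_space PD using sub by (simp add: subordinator_def)
  define G where "G y = indicator {0<..} y *\<^sub>R g y" for y :: real
  have [measurable]: "G \<in> borel_measurable borel"
    using borel_measurable_mono_on_fnc[OF g_mono]
    by (simp add: borel_measurable_restrict_space_iff G_def[abs_def])
  have Gpos: "G y = g y" if "0 < y" for y using that by (simp add: G_def)
  \<comment> \<open>the quotient \<open>g/\<Psi>\<close> in the variable \<open>z = e\<^sup>-\<^sup>y\<close>\<close>
  define F where "F z = (if 0 < z \<and> z < 1 then g (- ln z) / ?\<Psi> (- ln z) else 0)" for z :: real
  have F_alt: "F = (\<lambda>z. if 0 < z \<and> z < 1 then G (- ln z) / ?\<Psi> (- ln z) else 0)"
    by (auto simp: F_def fun_eq_iff Gpos)
  have [measurable]: "F \<in> borel_measurable borel"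
    unfolding F_alt by measurable
  have F_exp: "?\<Psi> y * F (exp (- y)) = G y" if "0 < y" for y
    using that bernstein_root_pos[OF that] by (simp add: F_def Gpos)
  have F_bdd: "norm (F z) \<le> \<bar>C\<bar>" for z
  proof (cases "0 < z \<and> z < 1")
    case True
    then have y: "0 < - ln z" by simp
    have "0 \<le> g (- ln z)" "g (- ln z) \<le> C * ?\<Psi> (- ln z)"
      using g_nonneg[OF y] g_le[OF y] by auto
    then have "\<bar>g (- ln z) / ?\<Psi> (- ln z)\<bar> \<le> C"
      using bernstein_root_pos[OF y] by (simp add: field_simps)
    then show ?thesis using True by (simp add: F_def)
  qed (auto simp: F_def)
  have \<nu>int: "integrable \<nu> ?\<Psi>"
    using levy_bernstein_root(1)[OF sub rv, of 0] by simp
  have pos: "0 < ?\<phi> (2 ^ n)" for n :: nat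
  proof -
    have "\<forall>s>0. 0 < \<phi> s"
      using rv(1) unfolding regularly_varying_at_infinity_def by (rule conjunct1)
    then have "0 < \<phi> (2 ^ n)" by simp
    then show ?thesis
      using subordinator_levy_exponent[OF sub, of "2 ^ n"] by simp
  qed
  have "0 < (\<Sum>n. (1 / sqrt 2) ^ n * ?\<phi> (2 ^ n))"
  proof (rule suminf_pos)
    show "summable (\<lambda>n. (1 / sqrt 2) ^ n * ?\<phi> (2 ^ n))"
      using levy_bernstein_root(3)[OF sub rv, of 0] by simp
    show "0 < (1 / sqrt 2) ^ n * ?\<phi> (2 ^ n)" for n :: nat
      using pos by simp
  qed
  then have \<nu>pos: "0 < ?c"
    using levy_bernstein_root(2)[OF sub rv, of 0] by simp
  have Dint: "integrable PD (\<lambda>\<eta>. ?\<Psi> (D t \<eta>))" and Dpos: "0 < ?m t" if "0 < t" for t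
  proof -
    show "integrable PD (\<lambda>\<eta>. ?\<Psi> (D t \<eta>))"
      using subordinator_bernstein_root(1)[OF sub that, of 0] by simp
    then show "0 < ?m t"
      by (rule PD.expectation_greater) (intro AE_I2 bernstein_root_pos subordinator_pos[OF sub _ that])
  qed
  define N where "N t = distr (density PD (\<lambda>\<eta>. ennreal (?\<Psi> (D t \<eta>) / (?m t)))) borel (\<lambda>\<eta>. exp (- D t \<eta>))" for t
  define N0 where "N0 = distr (density \<nu> (\<lambda>y. ennreal (?\<Psi> y / ?c))) borel (\<lambda>y. exp (- y))"
  note N0 = tilted_distribution[OF \<nu>int _ \<nu>pos, of "\<lambda>y. exp (- y)", folded N0_def]
  have em: "(\<lambda>\<eta>. exp (- D t \<eta>)) \<in> borel_measurable PD" if "0 < t" for t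
    using Dm[OF that] by measurable
  note N = tilted_distribution[OF Dint _ Dpos em]
  have N0_int: "(\<integral>z. h z \<partial>N0) = (\<integral>y. ?\<Psi> y * h (exp (- y)) \<partial>\<nu>) / ?c"
    if "h \<in> borel_measurable borel" for h :: "real \<Rightarrow> real"
    using N0(2)[OF _ _ that] by (simp add: bernstein_root_nonneg)
  have N_int: "(\<integral>z. h z \<partial>N t) = (\<integral>\<eta>. ?\<Psi> (D t \<eta>) * h (exp (- D t \<eta>)) \<partial>PD) / (?m t)"
    if "0 < t" "h \<in> borel_measurable borel" for h :: "real \<Rightarrow> real" and t
    using N(2)[OF that(1) _ that(1) that(1) that(2)] by (simp add: bernstein_root_nonneg N_def)
  have N0_dist: "real_distribution N0" using N0(1) by (simp add: bernstein_root_nonneg)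
  have N_dist: "real_distribution (N t)" if "0 < t" for t
    using N(1)[OF that _ that that] by (simp add: bernstein_root_nonneg N_def)
  have N0_supp: "AE z in N0. z \<in> {0..1}"
  proof (rule N0(3))
    show "AE y in \<nu>. exp (- y) \<in> {0..1}"
      using levy_AE_pos[OF \<nu>] by eventually_elim simp
  qed (auto simp: bernstein_root_nonneg)
  have N_supp: "AE z in N t. z \<in> {0..1}" if "0 < t" for t
    unfolding N_def
  proof (rule N(3)[OF that _ that that])
    show "AE \<eta> in PD. exp (- D t \<eta>) \<in> {0..1}"
      using less_imp_le[OF subordinator_pos[OF sub _ that]] by (auto intro!: AE_I2)
  qed (auto simp: bernstein_root_nonneg)
  have total: "((\<lambda>t. (?m t) / t) \<longlongrightarrow> ?c) (at_right 0)"
    using subordinator_bernstein_root_tendsto[OF sub rv, of 0] by simp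
  have mom: "((\<lambda>t. \<integral>z. z ^ j \<partial>N t) \<longlongrightarrow> (\<integral>z. z ^ j \<partial>N0)) (at_right 0)" for j :: nat
  proof -
    have e: "exp (- y) ^ j = exp (- (real j * y))" for y :: real
      by (simp add: exp_of_nat_mult[symmetric])
    have "((\<lambda>t. ((\<integral>\<eta>. ?\<Psi> (D t \<eta>) * exp (- (real j * D t \<eta>)) \<partial>PD) / t) / (?m t / t))
        \<longlongrightarrow> (\<integral>y. ?\<Psi> y * exp (- (real j * y)) \<partial>\<nu>) / ?c) (at_right 0)"
      using \<nu>pos by (intro tendsto_divide total subordinator_bernstein_root_tendsto[OF sub rv]) auto
    moreover have "\<forall>\<^sub>F t in at_right 0. ((\<integral>\<eta>. ?\<Psi> (D t \<eta>) * exp (- (real j * D t \<eta>)) \<partial>PD) / t) / (?m t / t)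
        = (\<integral>z. z ^ j \<partial>N t)"
      using eventually_at_right_less[of 0] by eventually_elim (simp add: N_int e)
    ultimately have "((\<lambda>t. \<integral>z. z ^ j \<partial>N t) \<longlongrightarrow> (\<integral>y. ?\<Psi> y * exp (- (real j * y)) \<partial>\<nu>) / ?c) (at_right 0)"
      by (rule Lim_transform_eventually)
    then show ?thesis by (simp add: N0_int e)
  qed
  have null: "emeasure N0 {z. \<not> isCont F z} = 0"
  proof -
    define E where "E = {z. \<not> isCont F z}"
    have c: "countable E"
      unfolding E_def F_def[abs_def]
      by (rule countable_discontinuities_exp_quotient[OF g_mono bernstein_root_mono bernstein_root_pos])
    have E: "E \<in> sets borel"
      using c by (rule sets.countable[rotated]) simp
    have "(\<lambda>y. exp (- y)) -` E \<subseteq> (\<lambda>z. - ln z) ` E"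
    proof
      fix y :: real assume "y \<in> (\<lambda>y. exp (- y)) -` E"
      then show "y \<in> (\<lambda>z. - ln z) ` E" by (intro image_eqI[of _ _ "exp (- y)"]) auto
    qed
    then have c': "countable ((\<lambda>y::real. exp (- y)) -` E)"
      using countable_image[OF c] by (rule countable_subset)
    have "(\<lambda>y::real. exp (- y)) -` E \<in> null_sets \<nu>"
      using diffuse[OF c'] sets.countable[OF _ c', of borel] \<open>sets \<nu> = sets borel\<close>
      by (intro null_setsI) auto
    then have "AE y in \<nu>. y \<notin> (\<lambda>y::real. exp (- y)) -` E"
      by (rule AE_not_in)
    then have "AE y in \<nu>. exp (- y) \<in> - E"
      by eventually_elim simp
    then have "AE z in N0. z \<in> - E"
      using E by (intro N0(3)) (auto simp: bernstein_root_nonneg)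
    then have "AE z in N0. z \<notin> E"
      by eventually_elim simp
    moreover have "E \<in> sets N0" using E by (simp add: N0_def)
    ultimately have "E \<in> null_sets N0" by (simp add: AE_iff_null_sets)
    then show ?thesis unfolding E_def by (rule null_setsD1)
  qed
  have "((\<lambda>t. \<integral>z. F z \<partial>N t) \<longlongrightarrow> (\<integral>z. F z \<partial>N0)) (at_right 0)"
  proof (rule tendsto_at_right_sequentially[of 0 1])
    fix S :: "nat \<Rightarrow> real" assume S: "\<And>n. 0 < S n" "S \<longlonglongrightarrow> 0"
    have S_neq: "S n \<noteq> 0" for n
      using S(1)[of n] by (rule less_imp_neq[THEN not_sym])
    have lim: "filterlim S (at_right 0) sequentially"
      unfolding filterlim_at using S(2) by (simp add: S(1) S_neq)
    have "weak_conv_m (\<lambda>n. N (S n)) N0"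
      using N_dist[OF S(1)] N0_dist N_supp[OF S(1)] N0_supp filterlim_compose[OF mom lim]
      by (rule moments_conv_imp_weak_conv_unit_interval)
    then show "(\<lambda>n. \<integral>z. F z \<partial>N (S n)) \<longlonglongrightarrow> (\<integral>z. F z \<partial>N0)"
      using weak_conv_imp_bdd_ae_continuous_conv[OF N_dist[OF S(1)] N0_dist _ null F_bdd] by simp
  qed simp
  then have lim: "((\<lambda>t. (\<integral>z. F z \<partial>N t) * (?m t / t)) \<longlongrightarrow> (\<integral>z. F z \<partial>N0) * ?c) (at_right 0)"
    by (intro tendsto_mult total)
  have val: "(\<integral>z. F z \<partial>N0) * ?c = (LINT u:{0<..}|\<nu>. g u)"
  proof -
    have "(\<integral>z. F z \<partial>N0) * ?c = (\<integral>y. ?\<Psi> y * F (exp (- y)) \<partial>\<nu>)"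
      using \<nu>pos by (simp add: N0_int)
    also have "\<dots> = (\<integral>y. G y \<partial>\<nu>)"
    proof (rule integral_cong_AE)
      show "AE y in \<nu>. ?\<Psi> y * F (exp (- y)) = G y"
        using levy_AE_pos[OF \<nu>] by eventually_elim (rule F_exp)
    qed auto
    finally show ?thesis by (simp add: set_lebesgue_integral_def G_def)
  qed
  have "\<forall>\<^sub>F t in at_right 0. (\<integral>z. F z \<partial>N t) * (?m t / t) = (\<integral>\<eta>. g (D t \<eta>) \<partial>PD) / t"
    using eventually_at_right_less[of 0]
  proof eventually_elim
    case (elim t)
    have "(\<integral>\<eta>. ?\<Psi> (D t \<eta>) * F (exp (- D t \<eta>)) \<partial>PD) = (\<integral>\<eta>. g (D t \<eta>) \<partial>PD)"
      using subordinator_pos[OF sub _ elim]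
      by (intro Bochner_Integration.integral_cong) (auto simp: F_exp Gpos)
    then show ?case using Dpos[OF elim] elim by (simp add: N_int)
  qed
  then show "((\<lambda>t. (\<integral>\<eta>. g (D t \<eta>) \<partial>PD) / t) \<longlongrightarrow> (LINT u:{0<..}|\<nu>. g u)) (at_right 0)"
    by (rule Lim_transform_eventually[OF lim[unfolded val]])
  show "set_integrable \<nu> {0<..} g"
    unfolding set_integrable_def G_def[symmetric]
  proof (rule Bochner_Integration.integrable_bound)
    show "integrable \<nu> (\<lambda>y. C * ?\<Psi> y)" using \<nu>int by simp
    show "AE y in \<nu>. norm (G y) \<le> norm (C * ?\<Psi> y)"
      using levy_AE_pos[OF \<nu>]
    proof eventually_elim
      case (elim y)
      then show ?case using g_nonneg[OF elim] g_le[OF elim] by (simp add: Gpos)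
    qed
  qed auto
qed

section \<open>Characteristic functions on a Euclidean space\<close>

text \<open>If \<open>N\<close> has the Gaussian characteristic function \<open>e\<^sup>-\<^sup>s\<^sup>|\<^sup>x\<^sup>|\<^sup>2\<close>, Fubini turns a Gaussian average over \<open>M\<close>
  into an \<open>N\<close>-average of the characteristic function of \<open>M\<close>; so the latter determines the former.\<close>

lemma integral_gaussian_eq_integral_char:
  fixes M N :: "'b::euclidean_space measure"
  assumes M: "prob_space M" "sets M = sets borel" and N: "prob_space N" "sets N = sets borel"
    and char_N: "\<And>x. (\<integral>\<xi>. exp (- \<i> * complex_of_real (x \<bullet> \<xi>)) \<partial>N) = complex_of_real (exp (- s * (norm x)\<^sup>2))"
  shows "complex_of_real (\<integral>x. exp (- s * (norm (x - y))\<^sup>2) \<partial>M)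
    = (\<integral>\<xi>. exp (\<i> * complex_of_real (\<xi> \<bullet> y)) * (\<integral>x. exp (- \<i> * complex_of_real (\<xi> \<bullet> x)) \<partial>M) \<partial>N)"
proof -
  interpret M: prob_space M by fact
  interpret N: prob_space N by fact
  interpret MN: pair_prob_space M N ..
  have [measurable_cong]: "sets M = sets borel" "sets N = sets borel" by fact+
  have int: "integrable (M \<Otimes>\<^sub>M N) (\<lambda>(x, \<xi>). exp (- \<i> * complex_of_real ((x - y) \<bullet> \<xi>)))"
    by (rule MN.integrable_const_bound[of _ 1]) (auto simp: case_prod_beta)
  have split: "exp (- \<i> * complex_of_real ((x - y) \<bullet> \<xi>))
      = exp (\<i> * complex_of_real (\<xi> \<bullet> y)) * exp (- \<i> * complex_of_real (\<xi> \<bullet> x))" for x \<xi>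
    by (simp add: exp_add[symmetric] inner_diff_left inner_commute algebra_simps)
  have "complex_of_real (\<integral>x. exp (- s * (norm (x - y))\<^sup>2) \<partial>M)
      = (\<integral>x. (\<integral>\<xi>. exp (- \<i> * complex_of_real ((x - y) \<bullet> \<xi>)) \<partial>N) \<partial>M)"
    by (simp only: char_N integral_complex_of_real)
  also have "\<dots> = (\<integral>\<xi>. (\<integral>x. exp (- \<i> * complex_of_real ((x - y) \<bullet> \<xi>)) \<partial>M) \<partial>N)"
    by (rule MN.Fubini_integral[OF int, symmetric])
  also have "\<dots> = (\<integral>\<xi>. exp (\<i> * complex_of_real (\<xi> \<bullet> y)) * (\<integral>x. exp (- \<i> * complex_of_real (\<xi> \<bullet> x)) \<partial>M) \<partial>N)"
    by (simp only: split integral_mult_right_zero)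
  finally show ?thesis .
qed

lemma open_eq_countable_Union_balls:
  fixes S :: "'b::{metric_space, second_countable_topology} set"
  assumes "open S"
  obtains \<B> where "countable \<B>" "\<And>B. B \<in> \<B> \<Longrightarrow> \<exists>y r. 0 < r \<and> B = ball y r" "S = \<Union>\<B>"
proof -
  define \<F> where "\<F> = {B. \<exists>y r. 0 < r \<and> B = ball y r \<and> B \<subseteq> S}"
  have "open B" if "B \<in> \<F>" for B using that by (auto simp: \<F>_def)
  then obtain \<B> where \<B>: "\<B> \<subseteq> \<F>" "countable \<B>" "\<Union>\<B> = \<Union>\<F>"
    using Lindelof[of \<F>] by blast
  have "S \<subseteq> \<Union>\<F>"
  proof
    fix x assume "x \<in> S"
    then obtain r where r: "0 < r" "ball x r \<subseteq> S" using assms open_contains_ball by blast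
    then have "ball x r \<in> \<F>" unfolding \<F>_def by blast
    moreover have "x \<in> ball x r" using r by simp
    ultimately show "x \<in> \<Union>\<F>" by (rule UnionI)
  qed
  moreover have "\<Union>\<F> \<subseteq> S" by (rule Union_least) (simp add: \<F>_def, elim exE conjE, simp)
  ultimately have S: "S = \<Union>\<B>" unfolding \<B>(3) by (rule subset_antisym)
  have "\<exists>y r. 0 < r \<and> B = ball y r" if "B \<in> \<B>" for B
  proof -
    have "B \<in> \<F>" using \<B>(1) that by (rule subsetD)
    then show ?thesis unfolding \<F>_def by simp (elim exE conjE, intro exI conjI)
  qed
  then show ?thesis using \<B>(2) S by (intro that)
qed

text \<open>In the proof a bounded function is called good if
  multiplying it by any Gaussian gives equal averages over \<open>M\<close> and \<open>M'\<close>.  Products of Gaussians are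
  Gaussians, so good functions stay good when multiplied by a polynomial in \<open>e\<^sup>-\<^sup>|\<^sup>x\<^sup>-\<^sup>y\<^sup>|\<^sup>2\<close>, hence, by
  Weierstrass and bounded limits, by the indicator of a ball; therefore by that of any Borel set.\<close>

lemma measure_eqI_gaussian_integrals:
  fixes M M' :: "'b::euclidean_space measure"
  assumes M: "prob_space M" "sets M = sets borel" and M': "prob_space M'" "sets M' = sets borel"
    and gauss: "\<And>s y. 0 < s \<Longrightarrow> (\<integral>x. exp (- s * (norm (x - y))\<^sup>2) \<partial>M) = (\<integral>x. exp (- s * (norm (x - y))\<^sup>2) \<partial>M')"
  shows "M = M'"
proof -
  interpret M: prob_space M by fact
  interpret M': prob_space M' by fact
  have [measurable_cong]: "sets M = sets borel" "sets M' = sets borel" by fact+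
  define e :: "real \<Rightarrow> 'b \<Rightarrow> 'b \<Rightarrow> real" where "e s v x = exp (- s * (norm x)\<^sup>2 + v \<bullet> x)" for s v x
  have [measurable]: "e s v \<in> borel_measurable borel" for s v
    unfolding e_def[abs_def] by simp
  have e_mult: "e s v x * e s' v' x = e (s + s') (v + v') x" for s s' v v' x
    by (simp add: e_def exp_add[symmetric] inner_add_left algebra_simps)
  have e_shift: "exp (- s * (norm (x - y))\<^sup>2) = exp (- s * (norm y)\<^sup>2) * e s ((2 * s) *\<^sub>R y) x" for s x y
  proof -
    have "(norm (x - y))\<^sup>2 = (norm x)\<^sup>2 + (norm y)\<^sup>2 - 2 * (y \<bullet> x)"
      by (simp add: power2_norm_eq_inner inner_diff_left inner_diff_right inner_commute)
    then have "- s * (norm (x - y))\<^sup>2 = - s * (norm y)\<^sup>2 + (- s * (norm x)\<^sup>2 + ((2 * s) *\<^sub>R y) \<bullet> x)"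
      by (simp only: inner_scaleR_left) (simp add: algebra_simps)
    then show ?thesis by (simp only: e_def exp_add[symmetric])
  qed
  have e_center: "e s v x = exp ((norm v)\<^sup>2 / (4 * s)) * exp (- s * (norm (x - (1 / (2 * s)) *\<^sub>R v))\<^sup>2)"
    if "0 < s" for s v x
  proof -
    have "(norm v)\<^sup>2 / (4 * s) + - s * (norm ((1 / (2 * s)) *\<^sub>R v))\<^sup>2 = 0" "(2 * s) *\<^sub>R (1 / (2 * s)) *\<^sub>R v = v"
      using that by (auto simp: power_mult_distrib power_divide power2_eq_square)
    then show ?thesis
      unfolding e_shift mult.assoc[symmetric] exp_add[symmetric] by simp
  qed
  have e_nonneg: "0 \<le> e s v x" for s v x by (simp add: e_def)
  have e_le: "e s v x \<le> exp ((norm v)\<^sup>2 / (4 * s))" if "0 < s" for s v x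
    unfolding e_center[OF that] using that by simp
  define good where "good f \<longleftrightarrow> f \<in> borel_measurable borel \<and> (\<exists>B. \<forall>x. \<bar>f x\<bar> \<le> B) \<and>
    (\<integral>x. f x \<partial>M) = (\<integral>x. f x \<partial>M') \<and>
    (\<forall>s v. 0 < s \<longrightarrow> (\<integral>x. f x * e s v x \<partial>M) = (\<integral>x. f x * e s v x \<partial>M'))" for f :: "'b \<Rightarrow> real"
  have intM: "integrable M f" "integrable M' f"
    if "f \<in> borel_measurable borel" "\<And>x. \<bar>f x\<bar> \<le> B" for f :: "'b \<Rightarrow> real" and B
    using that by (auto intro!: M.integrable_const_bound[of _ B] M'.integrable_const_bound[of _ B])
  have fe_le: "\<bar>f x * e s v x\<bar> \<le> B * exp ((norm v)\<^sup>2 / (4 * s))"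
    if "\<And>x. \<bar>f x\<bar> \<le> B" "0 < s" for f :: "'b \<Rightarrow> real" and B s v x
  proof -
    have "0 \<le> B" using that(1)[of x] by linarith
    then have "\<bar>f x\<bar> * e s v x \<le> B * exp ((norm v)\<^sup>2 / (4 * s))"
      by (intro mult_mono that(1) e_le[OF that(2)] e_nonneg)
    then show ?thesis by (simp add: abs_mult e_nonneg)
  qed
  have good_1: "good (\<lambda>_. 1)"
    unfolding good_def
  proof (intro conjI allI impI exI[of _ 1])
    show "(\<integral>x. 1 * e s v x \<partial>M) = (\<integral>x. 1 * e s v x \<partial>M')" if "0 < s" for s v
      using gauss[OF that] by (simp add: e_center[OF that])
  qed (auto simp: M.prob_space M'.prob_space)
  have good_e: "good (\<lambda>x. f x * e s v x)" if gf: "good f" and s: "0 < s" for f s v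
  proof -
    obtain B where fm: "f \<in> borel_measurable borel" and B: "\<And>x. \<bar>f x\<bar> \<le> B"
      using gf by (auto simp: good_def)
    note [measurable] = fm
    have "(\<lambda>x. f x * e s v x) \<in> borel_measurable borel" by measurable
    moreover have "(\<integral>x. f x * e s v x * e s' v' x \<partial>M) = (\<integral>x. f x * e s v x * e s' v' x \<partial>M')"
      if "0 < s'" for s' v'
      unfolding mult.assoc e_mult using gf s that by (simp add: good_def)
    moreover have "(\<integral>x. f x * e s v x \<partial>M) = (\<integral>x. f x * e s v x \<partial>M')"
      using gf s by (simp add: good_def)
    moreover have "\<bar>f x * e s v x\<bar> \<le> B * exp ((norm v)\<^sup>2 / (4 * s))" for x
      by (rule fe_le[OF B s])
    ultimately show ?thesis
      unfolding good_def by blast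
  qed
  have good_lin: "good (\<lambda>x. a * f x + b * g x)" if gfg: "good f" "good g" for a b f g
  proof -
    obtain B B' where fg [measurable]: "f \<in> borel_measurable borel" "g \<in> borel_measurable borel"
      and B: "\<And>x. \<bar>f x\<bar> \<le> B" and B': "\<And>x. \<bar>g x\<bar> \<le> B'"
      using gfg by (auto simp: good_def)
    note i = intM[OF fg(1) B] intM[OF fg(2) B']
    have ie: "integrable M (\<lambda>x. f x * e s v x)" "integrable M' (\<lambda>x. f x * e s v x)"
      "integrable M (\<lambda>x. g x * e s v x)" "integrable M' (\<lambda>x. g x * e s v x)" if "0 < s" for s v
    proof -
      have [measurable]: "(\<lambda>x. f x * e s v x) \<in> borel_measurable borel" "(\<lambda>x. g x * e s v x) \<in> borel_measurable borel"
        by measurable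
      show "integrable M (\<lambda>x. f x * e s v x)" "integrable M' (\<lambda>x. f x * e s v x)"
        by (rule intM[OF _ fe_le[OF B that]], fact)+
      show "integrable M (\<lambda>x. g x * e s v x)" "integrable M' (\<lambda>x. g x * e s v x)"
        by (rule intM[OF _ fe_le[OF B' that]], fact)+
    qed
    have "\<bar>a * f x + b * g x\<bar> \<le> \<bar>a\<bar> * B + \<bar>b\<bar> * B'" for x
      using mult_left_mono[OF B, of "\<bar>a\<bar>" x] mult_left_mono[OF B', of "\<bar>b\<bar>" x]
      by (intro order_trans[OF abs_triangle_ineq]) (simp add: abs_mult)
    then have bdd: "\<exists>B. \<forall>x. \<bar>a * f x + b * g x\<bar> \<le> B" by (intro exI allI)
    have eqs: "(\<integral>x. f x \<partial>M) = (\<integral>x. f x \<partial>M')" "(\<integral>x. g x \<partial>M) = (\<integral>x. g x \<partial>M')"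
      "\<And>s v. 0 < s \<Longrightarrow> (\<integral>x. f x * e s v x \<partial>M) = (\<integral>x. f x * e s v x \<partial>M')"
      "\<And>s v. 0 < s \<Longrightarrow> (\<integral>x. g x * e s v x \<partial>M) = (\<integral>x. g x * e s v x \<partial>M')"
      using gfg unfolding good_def by blast+
    show ?thesis
      unfolding good_def
    proof (intro conjI allI impI bdd)
      show "(\<integral>x. a * f x + b * g x \<partial>M) = (\<integral>x. a * f x + b * g x \<partial>M')"
        using i by (simp add: eqs(1,2))
      show "(\<integral>x. (a * f x + b * g x) * e s v x \<partial>M) = (\<integral>x. (a * f x + b * g x) * e s v x \<partial>M')" if "0 < s" for s v
        using ie[OF that] by (simp add: distrib_right mult.assoc eqs(3,4)[OF that])
      show "(\<lambda>x. a * f x + b * g x) \<in> borel_measurable borel" by measurable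
    qed
  qed
  have good_sum: "good (\<lambda>x. \<Sum>i\<in>I. a i * f i x)" if "finite I" "\<And>i. i \<in> I \<Longrightarrow> good (f i)" for I :: "nat set" and a f
    using that
  proof induction
    case empty then show ?case using good_lin[OF good_1 good_1, of 0 0] by simp
  next
    case (insert i I) then show ?case using good_lin[of "f i" _ "a i" 1] by simp
  qed
  have good_lim: "good f" if "\<And>n. good (F n)" "\<And>n x. \<bar>F n x\<bar> \<le> B" "\<And>x. (\<lambda>n. F n x) \<longlonglongrightarrow> f x"
    for F :: "nat \<Rightarrow> 'b \<Rightarrow> real" and f B
  proof -
    have Fm[measurable]: "F n \<in> borel_measurable borel" for n using that(1) by (simp add: good_def)
    have fm[measurable]: "f \<in> borel_measurable borel"
      using that(3) Fm by (rule borel_measurable_LIMSEQ_real)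
    have fB: "\<bar>f x\<bar> \<le> B" for x
      by (rule LIMSEQ_le_const2[OF tendsto_rabs[OF that(3)]]) (use that(2) in blast)
    have lim: "(\<lambda>n. \<integral>x. F n x * h x \<partial>m) \<longlonglongrightarrow> (\<integral>x. f x * h x \<partial>m)"
      if "prob_space m" and [measurable_cong]: "sets m = sets borel" and [measurable]: "h \<in> borel_measurable borel"
        and C: "\<And>x. \<bar>h x\<bar> \<le> C" for m :: "'b measure" and h C
    proof (rule integral_dominated_convergence[where w="\<lambda>_. B * C"])
      interpret prob_space m by fact
      show "integrable m (\<lambda>_. B * C)" by simp
      show "AE x in m. (\<lambda>n. F n x * h x) \<longlonglongrightarrow> f x * h x"
        using \<open>\<And>x. (\<lambda>n. F n x) \<longlonglongrightarrow> f x\<close> by (intro AE_I2 tendsto_mult tendsto_const)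
      show "AE x in m. norm (F n x * h x) \<le> B * C" for n
      proof (rule AE_I2)
        fix x
        have F: "\<bar>F n x\<bar> \<le> B" by fact
        then have "0 \<le> B" by linarith
        then have "\<bar>F n x\<bar> * \<bar>h x\<bar> \<le> B * C"
          by (intro mult_mono F C) simp_all
        then show "norm (F n x * h x) \<le> B * C" by (simp add: abs_mult)
      qed
    qed measurable
    have eq: "(\<integral>x. f x * h x \<partial>M) = (\<integral>x. f x * h x \<partial>M')"
      if h: "h \<in> borel_measurable borel" "\<And>x. \<bar>h x\<bar> \<le> C" and "\<And>n. (\<integral>x. F n x * h x \<partial>M) = (\<integral>x. F n x * h x \<partial>M')" for h C
      using lim[OF M h] lim[OF M' h] that(3) by (simp add: LIMSEQ_unique)
    show ?thesis
      unfolding good_def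
    proof (intro conjI allI impI exI[of _ B])
      show "(\<integral>x. f x \<partial>M) = (\<integral>x. f x \<partial>M')"
        using eq[of "\<lambda>_. 1" 1] that(1) by (simp add: good_def)
      show "(\<integral>x. f x * e s v x \<partial>M) = (\<integral>x. f x * e s v x \<partial>M')" if "0 < s" for s v
        using eq[of "e s v" "exp ((norm v)\<^sup>2 / (4 * s))"] \<open>\<And>n. good (F n)\<close> that e_le[OF that] e_nonneg by (simp add: good_def)
    qed (use fB in auto)
  qed
  have good_poly: "good (\<lambda>x. f x * exp (- 1 * (norm (x - y))\<^sup>2) ^ i)" if "good f" for f y and i :: nat
  proof (induction i)
    case 0 then show ?case using that by simp
  next
    case (Suc i)
    have "good (\<lambda>x. exp (- 1 * (norm y)\<^sup>2) * (f x * exp (- 1 * (norm (x - y))\<^sup>2) ^ i * e 1 ((2 * 1) *\<^sub>R y) x) + 0 * 1)"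
      by (rule good_lin[OF good_e[OF Suc] good_1]) simp
    moreover have "f x * exp (- 1 * (norm (x - y))\<^sup>2) ^ Suc i
        = exp (- 1 * (norm y)\<^sup>2) * (f x * exp (- 1 * (norm (x - y))\<^sup>2) ^ i * e 1 ((2 * 1) *\<^sub>R y) x) + 0 * 1" for x
      using e_shift[of 1 x y] by (simp only: power_Suc) (simp only: mult_ac mult_zero_left add_0_right)
    ultimately show ?case by presburger
  qed
  have good_ball: "good (\<lambda>x. f x * indicator (ball y r) x)" if f: "good f" and r: "0 < r" for f y r
  proof -
    obtain B where B: "\<And>x. \<bar>f x\<bar> \<le> B" using f by (auto simp: good_def)
    then have B0: "0 \<le> B" using order_trans[OF abs_ge_zero] by blast
    define c where "c = exp (- r\<^sup>2)"
    have inverse_Suc: "0 < inverse (real (Suc n))" for n by simp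
    define h where "h n z = min 1 (real n * max 0 (z - c))" for n z
    have "\<forall>n. \<exists>a k. \<forall>z\<in>{0..1}. \<bar>h n z - (\<Sum>i\<le>k. a i * z ^ i)\<bar> < inverse (real (Suc n))"
    proof
      fix n
      have "continuous_on {0..1} (h n)" unfolding h_def by (intro continuous_intros)
      then obtain a :: "nat \<Rightarrow> real" and k where "\<And>z. z \<in> {0..1} \<Longrightarrow> \<bar>h n z - (\<Sum>i\<le>k. a i * z ^ i)\<bar> < inverse (real (Suc n))"
        using polynomial_approximation_unit_interval[OF _ inverse_Suc] by blast
      then show "\<exists>a k. \<forall>z\<in>{0..1}. \<bar>h n z - (\<Sum>i\<le>k. a i * z ^ i)\<bar> < inverse (real (Suc n))" by blast
    qed
    then obtain a k where a: "\<And>n z. z \<in> {0..1} \<Longrightarrow> \<bar>h n z - (\<Sum>i\<le>k n. a n i * z ^ i)\<bar> < inverse (real (Suc n))"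
      unfolding choice_iff by blast
    define Z where "Z x = exp (- 1 * (norm (x - y))\<^sup>2)" for x
    have Z: "Z x \<in> {0..1}" for x by (simp add: Z_def)
    define p where "p n x = (\<Sum>i\<le>k n. a n i * Z x ^ i)" for n x
    have p: "\<bar>h n (Z x) - p n x\<bar> < inverse (real (Suc n))" for n x
      unfolding p_def by (rule a[OF Z])
    show ?thesis
    proof (rule good_lim[of "\<lambda>n x. f x * p n x" "B * 2"])
      fix n
      have "(\<lambda>x. f x * p n x) = (\<lambda>x. \<Sum>i\<le>k n. a n i * (f x * Z x ^ i))"
        by (simp add: p_def sum_distrib_left mult_ac)
      then show "good (\<lambda>x. f x * p n x)"
        using good_sum[of "{..k n}" "\<lambda>i x. f x * Z x ^ i" "a n"] good_poly[OF f] by (simp add: Z_def)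
      fix x
      have "0 \<le> h n (Z x)" "h n (Z x) \<le> 1" by (auto simp: h_def)
      moreover have "inverse (real (Suc n)) \<le> 1" by (simp add: field_simps)
      ultimately have "\<bar>p n x\<bar> \<le> 2" using p[of n x] by linarith
      then show "\<bar>f x * p n x\<bar> \<le> B * 2" using B B0 by (auto simp: abs_mult intro!: mult_mono)
    next
      fix x
      have "(\<lambda>n. h n (Z x)) \<longlonglongrightarrow> indicator (ball y r) x"
      proof (cases "x \<in> ball y r")
        case True
        then have "norm (x - y) < r" by (simp add: dist_norm norm_minus_commute)
        then have "(norm (x - y))\<^sup>2 < r\<^sup>2" using r by (intro power_strict_mono) auto
        then have "c < Z x" by (simp add: c_def Z_def)
        then obtain n0 where n0: "1 < real n0 * (Z x - c)" using reals_Archimedean3[of "Z x - c"] by auto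
        have "h n (Z x) = 1" if "n0 \<le> n" for n
        proof -
          have "real n0 * (Z x - c) \<le> real n * (Z x - c)"
            using that \<open>c < Z x\<close> by (intro mult_right_mono) auto
          then have "1 \<le> real n * (Z x - c)" using n0 by linarith
          then show ?thesis using \<open>c < Z x\<close> by (simp add: h_def min_absorb1)
        qed
        then have "\<forall>\<^sub>F n in sequentially. h n (Z x) = indicator (ball y r) x"
          using True by (auto simp: eventually_sequentially)
        then show ?thesis by (rule tendsto_eventually)
      next
        case False
        then have "r \<le> norm (x - y)" by (simp add: dist_norm norm_minus_commute)
        then have "r\<^sup>2 \<le> (norm (x - y))\<^sup>2" using r by (intro power_mono) auto
        then have "Z x \<le> c" by (simp add: c_def Z_def)
        then show ?thesis using False by (simp add: h_def)
      qed
      moreover have "(\<lambda>n. h n (Z x) - p n x) \<longlonglongrightarrow> 0"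
        using p by (intro LIMSEQ_norm_0) (auto simp: inverse_eq_divide)
      ultimately have "(\<lambda>n. h n (Z x) - (h n (Z x) - p n x)) \<longlonglongrightarrow> indicator (ball y r) x - 0"
        by (rule tendsto_diff)
      then show "(\<lambda>n. f x * p n x) \<longlonglongrightarrow> f x * indicator (ball y r) x"
        by (intro tendsto_mult tendsto_const) simp
    qed
  qed
  define D where "D A \<longleftrightarrow> (\<forall>f. good f \<longrightarrow> good (\<lambda>x. f x * indicator A x))" for A
  have D_compl: "D (UNIV - A)" if "D A" for A
    unfolding D_def
  proof (intro allI impI)
    fix f assume f: "good f"
    have "(\<lambda>x. f x * indicator (UNIV - A) x) = (\<lambda>x. 1 * f x + (- 1) * (f x * indicator A x))"
      by (auto simp: fun_eq_iff indicator_def)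
    then show "good (\<lambda>x. f x * indicator (UNIV - A) x)"
      using good_lin[OF f, of "\<lambda>x. f x * indicator A x" 1 "-1"] that f by (simp add: D_def)
  qed
  have D_empty: "D {}"
    using good_lin[OF good_1 good_1, of 0 0] by (simp add: D_def)
  have D_Inter: "D (\<Inter>i. A i)" if "\<And>i. D (A i)" for A :: "nat \<Rightarrow> 'b set"
    unfolding D_def
  proof (intro allI impI)
    fix f assume f: "good f"
    have step: "good (\<lambda>x. f x * indicator (\<Inter>i<n. A i) x)" for n
    proof (induction n)
      case (Suc n)
      have "good (\<lambda>x. f x * indicator (\<Inter>i<n. A i) x * indicator (A n) x)"
        using that[of n] Suc by (simp add: D_def)
      moreover have "f x * indicator (\<Inter>i<Suc n. A i) x = f x * indicator (\<Inter>i<n. A i) x * indicator (A n) x" for x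
        by (auto simp: indicator_def lessThan_Suc)
      ultimately show ?case by presburger
    qed (use f in simp)
    obtain B where B: "\<And>x. \<bar>f x\<bar> \<le> B" using f by (auto simp: good_def)
    show "good (\<lambda>x. f x * indicator (\<Inter>i. A i) x)"
    proof (rule good_lim[OF step])
      show "\<bar>f x * indicator (\<Inter>i<n. A i) x\<bar> \<le> B" for n x
        using B[of x] by (auto simp: indicator_def)
      show "(\<lambda>n. f x * indicator (\<Inter>i<n. A i) x) \<longlonglongrightarrow> f x * indicator (\<Inter>i. A i) x" for x
      proof (cases "x \<in> (\<Inter>i. A i)")
        case False
        then obtain i where "x \<notin> A i" by blast
        then have "\<forall>\<^sub>F n in sequentially. f x * indicator (\<Inter>i<n. A i) x = f x * indicator (\<Inter>i. A i) x"
          unfolding eventually_sequentially by (intro exI[of _ "Suc i"]) (auto simp: indicator_def)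
        then show ?thesis by (rule tendsto_eventually)
      qed (auto simp: indicator_def)
    qed
  qed
  have D_Union: "D (\<Union>i. A i)" if "\<And>i. D (A i)" for A :: "nat \<Rightarrow> 'b set"
  proof -
    have "(\<Union>i. A i) = UNIV - (\<Inter>i. UNIV - A i)" by auto
    then show ?thesis using D_compl D_Inter that by metis
  qed
  have D_open: "D S" if S: "open S" for S
  proof -
    obtain \<B> where \<B>: "countable \<B>" "\<And>B. B \<in> \<B> \<Longrightarrow> \<exists>y r. 0 < r \<and> B = ball y r" "S = \<Union>\<B>"
      using open_eq_countable_Union_balls[OF S] by blast
    show ?thesis
    proof (cases "\<B> = {}")
      case False
      have "D B" if "B \<in> \<B>" for B using \<B>(2)[OF that] good_ball by (auto simp: D_def)
      moreover have "S = (\<Union>i. from_nat_into \<B> i)" using \<B> False by (simp add: range_from_nat_into)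
      ultimately show ?thesis using D_Union[of "from_nat_into \<B>"] from_nat_into[OF False] by simp
    qed (use \<B> D_empty in simp)
  qed
  have D_borel: "D A" if "A \<in> sets borel" for A
  proof -
    have "A \<in> sigma_sets UNIV {S. open S}" using that by (simp add: borel_def)
    then show ?thesis
    proof induction
      case (Basic S) then show ?case using D_open by simp
    next
      case (Compl S) then show ?case using D_compl by blast
    next
      case (Union S) then show ?case using D_Union by blast
    qed (rule D_empty)
  qed
  show ?thesis
  proof (rule measure_eqI)
    fix A assume "A \<in> sets M"
    then have A: "A \<in> sets borel" using M by simp
    then have "good (indicator A)" using D_borel[OF A] good_1 by (force simp: D_def)
    then have "measure M A = measure M' A"
      using A M(2) M'(2) by (simp add: good_def)
    then show "emeasure M A = emeasure M' A"
      by (simp add: M.emeasure_eq_measure M'.emeasure_eq_measure)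
  qed (use M M' in simp)
qed

section \<open>The boundary layer of a \<open>C\<^sup>1\<^sup>,\<^sup>1\<close> domain\<close>

text \<open>About \<open>1/h\<close> disjoint translates of the layer, stacked along \<open>e\<close>, fit into a fixed ball.\<close>

lemma measure_graph_layer_le:
  fixes e :: "'b::euclidean_space" and \<psi> :: "'b \<Rightarrow> real" and R :: real
  assumes e: "norm e = 1" and cont: "continuous_on {v. v \<bullet> e = 0} \<psi>" and h: "0 < h" "h \<le> 1"
  defines "f \<equiv> \<lambda>y. \<psi> (y - (y \<bullet> e) *\<^sub>R e)"
  defines "S \<equiv> {y \<in> ball 0 R. f y < y \<bullet> e \<and> y \<bullet> e \<le> f y + h}"
  shows "S \<in> lmeasurable" and "measure lebesgue S \<le> 2 * h * measure lebesgue (ball (0::'b) (R + 1))"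
proof -
  have ee: "e \<bullet> e = 1" using e by (simp add: norm_eq_1)
  have f_cont: "continuous_on UNIV f"
    unfolding f_def
  proof (rule continuous_on_compose2[OF cont])
    show "continuous_on UNIV (\<lambda>y. y - (y \<bullet> e) *\<^sub>R e)" by (intro continuous_intros)
  qed (auto simp: inner_diff_left ee)
  have [measurable]: "f \<in> borel_measurable borel"
    by (rule borel_measurable_continuous_onI[OF f_cont])
  have S: "S \<in> sets borel" unfolding S_def by measurable
  show Sm: "S \<in> lmeasurable"
  proof (rule bounded_set_imp_lmeasurable)
    show "bounded S" by (rule bounded_subset[of "ball 0 R"]) (auto simp: S_def)
    show "S \<in> sets lebesgue" using S by simp
  qed
  \<comment> \<open>the number of translates by multiples of \<open>h e\<close> that stay within distance \<open>1\<close>\<close>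
  define N where "N = nat \<lfloor>1 / h\<rfloor>"
  have N: "real N * h \<le> 1" "1 / 2 \<le> real N * h" "1 \<le> N"
  proof -
    have "1 \<le> 1 / h" using h by simp
    then have fl: "real N \<le> 1 / h" "1 / h < real N + 1" "1 \<le> N"
      unfolding N_def by linarith+
    then show "real N * h \<le> 1" "1 \<le> N" using h by (auto simp: field_simps)
    have "1 / h < 2 * real N" using fl(2,3) by linarith
    then show "1 / 2 \<le> real N * h" using h by (simp add: field_simps)
  qed
  define T where "T k = (+) ((real k * h) *\<^sub>R e) ` S" for k
  have Tm: "T k \<in> lmeasurable" "measure lebesgue (T k) = measure lebesgue S" for k
    unfolding T_def using Sm by (auto intro: measurable_translation simp: measure_translation)
  have f_shift: "f (c *\<^sub>R e + y) = f y" for c y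
    by (simp add: f_def inner_add_left ee algebra_simps)
  have height: "real k * h < y \<bullet> e - f y \<and> y \<bullet> e - f y \<le> (real k + 1) * h" if y: "y \<in> T k" for k y
  proof -
    obtain s where s: "s \<in> S" "y = (real k * h) *\<^sub>R e + s" using y by (auto simp: T_def)
    then have "f y = f s" "y \<bullet> e = real k * h + s \<bullet> e"
      by (simp_all only: f_shift inner_add_left inner_scaleR_left ee mult_1_right)
    then show ?thesis using s(1) by (simp add: S_def algebra_simps)
  qed
  have disj: "pairwise (\<lambda>i j. disjnt (T i) (T j)) {..<N}"
  proof (rule pairwiseI)
    fix i j :: nat assume "i \<noteq> j"
    then have "real i + 1 \<le> real j \<or> real j + 1 \<le> real i" by linarith
    then have "(real i + 1) * h \<le> real j * h \<or> (real j + 1) * h \<le> real i * h"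
      using h by (meson less_imp_le mult_right_mono)
    then show "disjnt (T i) (T j)"
      using height[of _ i] height[of _ j] by (fastforce simp: disjnt_iff)
  qed
  have sub: "(\<Union>k<N. T k) \<subseteq> ball 0 (R + 1)"
  proof
    fix y assume "y \<in> (\<Union>k<N. T k)"
    then obtain k s where k: "k < N" "s \<in> S" "y = (real k * h) *\<^sub>R e + s" by (auto simp: T_def)
    have "norm y \<le> real k * h + norm s"
      unfolding k(3) using norm_triangle_ineq[of "(real k * h) *\<^sub>R e" s] e h by simp
    also have "real k * h \<le> 1" using N(1) k(1) h by (smt (verit) mult_right_mono of_nat_less_iff)
    finally show "y \<in> ball 0 (R + 1)" using k(2) by (simp add: S_def)
  qed
  have "real N * measure lebesgue S = (\<Sum>k<N. measure lebesgue (T k))" by (simp add: Tm)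
  also have "\<dots> = measure lebesgue (\<Union>k<N. T k)"
    by (rule measure_UNION'[symmetric]) (use Tm disj in auto)
  also have "\<dots> \<le> measure lebesgue (ball (0::'b) (R + 1))"
    by (rule measure_mono_fmeasurable[OF sub]) (use Tm in auto)
  finally have "real N * measure lebesgue S \<le> measure lebesgue (ball (0::'b) (R + 1))" .
  then have "2 * h * (real N * measure lebesgue S) \<le> 2 * h * measure lebesgue (ball (0::'b) (R + 1))"
    using h by (intro mult_left_mono) auto
  moreover have "1 * measure lebesgue S \<le> (2 * (real N * h)) * measure lebesgue S"
    using N(2) by (intro mult_right_mono) auto
  ultimately show "measure lebesgue S \<le> 2 * h * measure lebesgue (ball (0::'b) (R + 1))"
    by (simp add: mult_ac)
qed

abbreviation boundary_chart :: "'b::euclidean_space set \<Rightarrow> real \<Rightarrow> real \<Rightarrow> 'b \<Rightarrow> bool" where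
  "boundary_chart \<Omega> R \<Lambda> z \<equiv> \<exists>(e::'b) (\<psi>::'b \<Rightarrow> real) (G::'b \<Rightarrow> 'b).
        let H = {h. h \<bullet> e = 0} in
        norm e = 1 \<and> \<psi> 0 = 0 \<and> G 0 = 0 \<and>
        (\<forall>h\<in>H. G h \<in> H \<and> (\<psi> has_derivative (\<lambda>v. G h \<bullet> v)) (at h within H) \<and> norm (G h) \<le> \<Lambda>) \<and>
        \<Lambda>-lipschitz_on H G \<and>
        \<Omega> \<inter> ball z R = {y \<in> ball z R. (y - z) \<bullet> e > \<psi> ((y - z) - ((y - z) \<bullet> e) *\<^sub>R e)}"

lemma C11_graph_lipschitz:
  fixes e :: "'b::euclidean_space"
  assumes "\<And>v. v \<in> {v. v \<bullet> e = 0} \<Longrightarrow> (\<psi> has_derivative (\<lambda>w. G v \<bullet> w)) (at v within {v. v \<bullet> e = 0})"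
    and "\<And>v. v \<in> {v. v \<bullet> e = 0} \<Longrightarrow> norm (G v) \<le> \<Lambda>"
    and "u \<bullet> e = 0" "v \<bullet> e = 0"
  shows "\<bar>\<psi> u - \<psi> v\<bar> \<le> \<Lambda> * norm (u - v)"
proof -
  have "norm (\<psi> u - \<psi> v) \<le> \<Lambda> * norm (u - v)"
  proof (rule differentiable_bound[of "{v. v \<bullet> e = 0}" \<psi> "\<lambda>v w. G v \<bullet> w"])
    show "convex {v. v \<bullet> e = 0}"
      using convex_hyperplane[of e 0] by (simp add: inner_commute)
    show "onorm (\<lambda>w. G x \<bullet> w) \<le> \<Lambda>" if "x \<in> {v. v \<bullet> e = 0}" for x
    proof (rule onorm_le)
      fix w
      have "norm (G x \<bullet> w) \<le> norm (G x) * norm w" by (simp add: Cauchy_Schwarz_ineq2)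
      also have "\<dots> \<le> \<Lambda> * norm w" using assms(2)[OF that] by (intro mult_right_mono) auto
      finally show "norm (G x \<bullet> w) \<le> \<Lambda> * norm w" .
    qed
  qed (use assms in auto)
  then show ?thesis by simp
qed

text \<open>The segment to a nearby point of the complement crosses the boundary.\<close>

lemma frontier_point_near:
  fixes \<Omega> :: "'b::euclidean_space set"
  assumes "x \<in> \<Omega>" "infdist x (- \<Omega>) < r" "\<Omega> \<noteq> UNIV"
  obtains p where "p \<in> frontier \<Omega>" "dist x p < r"
proof -
  have "- \<Omega> \<noteq> {}" using assms by auto
  have "\<exists>q\<in>- \<Omega>. dist x q < r"
  proof (rule ccontr)
    assume "\<not> (\<exists>q\<in>- \<Omega>. dist x q < r)"
    then have "r \<le> (INF q\<in>- \<Omega>. dist x q)"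
      using \<open>- \<Omega> \<noteq> {}\<close> by (intro cINF_greatest) (auto simp: not_less)
    then show False using assms(2) \<open>- \<Omega> \<noteq> {}\<close> by (simp add: infdist_notempty)
  qed
  then obtain q where q: "q \<in> - \<Omega>" "dist x q < r" by blast
  have "closed_segment x q \<inter> frontier \<Omega> \<noteq> {}"
    using assms(1) q(1) by (intro connected_Int_frontier) auto
  then obtain p where p: "p \<in> closed_segment x q" "p \<in> frontier \<Omega>" by blast
  then have "dist x p \<le> dist x q"
    by (metis dist_commute dist_in_closed_segment)
  then show ?thesis using that[OF p(2)] q by simp
qed


lemma infdist_borel_measurable [measurable]: "(\<lambda>x. infdist x A) \<in> borel_measurable borel"
  by (intro borel_measurable_continuous_onI continuous_intros)

text \<open>Points of \<open>\<Omega>\<close> at distance less than \<open>r\<close> from the complement lie, in one of finitely many local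
  coordinate systems, in a layer of height \<open>(1 + \<Lambda>) r\<close> above the graph of the boundary function.\<close>

lemma boundary_layer_measure_le:
  fixes \<Omega> :: "'b::euclidean_space set"
  assumes bdd: "bounded \<Omega>" and C11: "C11_open_set \<Omega>"
  obtains K where "0 \<le> K" "\<And>r. 0 < r \<Longrightarrow> measure lebesgue {x \<in> \<Omega>. infdist x (- \<Omega>) < r} \<le> K * r"
proof -
  have op: "open \<Omega>" using C11 by (simp add: C11_open_set_def)
  have nU: "\<Omega> \<noteq> UNIV" using bdd not_bounded_UNIV by metis
  have \<Omega>_meas [measurable]: "\<Omega> \<in> sets borel" using op by simp
  from C11[unfolded C11_open_set_def]
  obtain R \<Lambda> where R: "0 < R" and \<Lambda>: "0 < \<Lambda>" and
    chart: "\<forall>z\<in>frontier \<Omega>. boundary_chart \<Omega> R \<Lambda> z"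
    by (elim exE conjE) (rule that; assumption)
  let ?V = "measure lebesgue (ball (0::'b) (R + 1))"
  define L where "L r = {x \<in> \<Omega>. infdist x (- \<Omega>) < r}" for r
  have L_meas [measurable]: "L r \<in> sets borel" for r unfolding L_def by measurable
  \<comment> \<open>below \<open>r0\<close> nearby boundary points lie in the same chart and the layer has height at most \<open>1\<close>\<close>
  define r0 where "r0 = min (R / 2) (1 / (1 + \<Lambda>))"
  have r0: "0 < r0" using R \<Lambda> by (simp add: r0_def)
  have local_bound: "\<exists>S. S \<in> lmeasurable \<and> measure lebesgue S \<le> 2 * (1 + \<Lambda>) * ?V * r \<and>
      L r \<inter> {x. \<exists>p\<in>frontier \<Omega> \<inter> ball z (R / 2). dist x p < r} \<subseteq> S"
    if z: "z \<in> frontier \<Omega>" and r: "0 < r" "r \<le> r0" for z r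
  proof -
    from bspec[OF chart z, unfolded Let_def]
    obtain e \<psi> G where e: "norm e = 1"
      and G_all: "\<forall>h\<in>{h. h \<bullet> e = 0}. G h \<in> {h. h \<bullet> e = 0} \<and>
        (\<psi> has_derivative (\<lambda>v. G h \<bullet> v)) (at h within {h. h \<bullet> e = 0}) \<and> norm (G h) \<le> \<Lambda>"
      and eq: "\<Omega> \<inter> ball z R = {y \<in> ball z R. (y - z) \<bullet> e > \<psi> ((y - z) - ((y - z) \<bullet> e) *\<^sub>R e)}"
      by (elim exE conjE) (rule that; assumption)
    have G: "\<And>h. h \<in> {h. h \<bullet> e = 0} \<Longrightarrow> (\<psi> has_derivative (\<lambda>v. G h \<bullet> v)) (at h within {h. h \<bullet> e = 0})"
      "\<And>h. h \<in> {h. h \<bullet> e = 0} \<Longrightarrow> norm (G h) \<le> \<Lambda>"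
      by (drule bspec[OF G_all], elim conjE, assumption)+
    have ee: "e \<bullet> e = 1" using e by (simp add: norm_eq_1)
    define f where "f y = \<psi> (y - (y \<bullet> e) *\<^sub>R e)" for y
    define h where "h = (1 + \<Lambda>) * r"
    have h: "0 < h" "h \<le> 1"
    proof -
      show "0 < h" using \<Lambda> r by (simp add: h_def)
      have "r \<le> 1 / (1 + \<Lambda>)" using r by (simp add: r0_def)
      then show "h \<le> 1" using \<Lambda> by (simp add: h_def field_simps)
    qed
    have cont: "continuous_on {v. v \<bullet> e = 0} \<psi>"
      using G(1) by (rule has_derivative_continuous_on)
    define S where "S = {y \<in> ball 0 R. f y < y \<bullet> e \<and> y \<bullet> e \<le> f y + h}"
    have S: "S \<in> lmeasurable" "measure lebesgue S \<le> 2 * h * ?V"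
      unfolding S_def f_def using measure_graph_layer_le[OF e cont h, of R] by auto
    have proj: "(y - (y \<bullet> e) *\<^sub>R e) \<bullet> e = 0" for y by (simp add: inner_diff_left ee)
    have proj_le: "norm (d - (d \<bullet> e) *\<^sub>R e) \<le> norm d" for d
    proof (rule power2_le_imp_le)
      have "(norm (d - (d \<bullet> e) *\<^sub>R e))\<^sup>2 = (norm d)\<^sup>2 - (d \<bullet> e)\<^sup>2"
        unfolding power2_norm_eq_inner
        by (simp add: inner_diff_left inner_diff_right ee inner_commute[of e d] power2_eq_square)
      then show "(norm (d - (d \<bullet> e) *\<^sub>R e))\<^sup>2 \<le> (norm d)\<^sup>2"
        using zero_le_power2[of "d \<bullet> e"] by linarith
    qed simp
    have f_lip: "\<bar>f u - f v\<bar> \<le> \<Lambda> * norm (u - v)" for u v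
    proof -
      have "\<bar>f u - f v\<bar> \<le> \<Lambda> * norm ((u - (u \<bullet> e) *\<^sub>R e) - (v - (v \<bullet> e) *\<^sub>R e))"
        unfolding f_def by (rule C11_graph_lipschitz[OF G proj proj])
      also have "(u - (u \<bullet> e) *\<^sub>R e) - (v - (v \<bullet> e) *\<^sub>R e) = (u - v) - ((u - v) \<bullet> e) *\<^sub>R e"
        by (simp add: inner_diff_left scaleR_diff_left)
      also have "\<Lambda> * norm \<dots> \<le> \<Lambda> * norm (u - v)"
        using \<Lambda> by (intro mult_left_mono proj_le) simp
      finally show ?thesis .
    qed
    have "L r \<inter> {x. \<exists>p\<in>frontier \<Omega> \<inter> ball z (R / 2). dist x p < r} \<subseteq> (+) z ` S"
    proof
      fix x assume "x \<in> L r \<inter> {x. \<exists>p\<in>frontier \<Omega> \<inter> ball z (R / 2). dist x p < r}"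
      then obtain p where x: "x \<in> \<Omega>" and p: "p \<in> frontier \<Omega>" "dist z p < R / 2" "dist x p < r"
        by (auto simp: L_def)
      have "r \<le> R / 2" using r by (simp add: r0_def)
      then have xz: "dist z x < R"
        using dist_triangle[of z x p] p by (simp add: dist_commute)
      have pz: "dist z p < R" using p R by simp
      have low: "f (x - z) < (x - z) \<bullet> e"
      proof -
        have "x \<in> \<Omega> \<inter> ball z R" using x xz by simp
        then show ?thesis unfolding eq f_def by simp
      qed
      have "p \<notin> \<Omega>" using p(1) op by (simp add: frontier_def interior_open)
      have "(p - z) \<bullet> e \<le> f (p - z)"
      proof (rule ccontr)
        assume "\<not> (p - z) \<bullet> e \<le> f (p - z)"
        then have "p \<in> \<Omega> \<inter> ball z R" unfolding eq using pz by (simp add: f_def)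
        then show False using \<open>p \<notin> \<Omega>\<close> by simp
      qed
      moreover have "(x - z) \<bullet> e \<le> (p - z) \<bullet> e + r"
      proof -
        have "(x - p) \<bullet> e \<le> norm (x - p) * norm e" by (rule norm_cauchy_schwarz)
        then show ?thesis using p(3) e by (simp add: dist_norm inner_diff_left)
      qed
      moreover have "f (p - z) \<le> f (x - z) + \<Lambda> * r"
      proof -
        have "norm ((p - z) - (x - z)) \<le> r" using p(3) by (simp add: dist_norm norm_minus_commute)
        then have "\<Lambda> * norm ((p - z) - (x - z)) \<le> \<Lambda> * r" using \<Lambda> by (intro mult_left_mono) auto
        then show ?thesis using f_lip[of "p - z" "x - z"] by linarith
      qed
      ultimately have "(x - z) \<bullet> e \<le> f (x - z) + h" by (simp add: h_def algebra_simps)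
      then have "x - z \<in> S" using low xz by (simp add: S_def dist_norm norm_minus_commute)
      then show "x \<in> (+) z ` S" by (intro image_eqI[of _ _ "x - z"]) auto
    qed
    moreover have "(+) z ` S \<in> lmeasurable"
      by (rule measurable_translation[OF S(1)])
    moreover have "measure lebesgue ((+) z ` S) \<le> 2 * (1 + \<Lambda>) * ?V * r"
      using S(2) by (simp add: measure_translation h_def mult_ac)
    ultimately show ?thesis by (intro exI conjI)
  qed
  have cpt: "compact (frontier \<Omega>)" using bdd by (rule compact_frontier_bounded)
  have cover: "frontier \<Omega> \<subseteq> (\<Union>z\<in>frontier \<Omega>. ball z (R / 2))"
  proof
    fix z assume "z \<in> frontier \<Omega>"
    moreover have "z \<in> ball z (R / 2)" using R by simp
    ultimately show "z \<in> (\<Union>z\<in>frontier \<Omega>. ball z (R / 2))" by (rule UN_I)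
  qed
  obtain Z where Z: "Z \<subseteq> frontier \<Omega>" "finite Z" "frontier \<Omega> \<subseteq> (\<Union>z\<in>Z. ball z (R / 2))"
    by (rule compactE_image[OF cpt _ cover]) simp_all
  define K1 where "K1 = real (card Z) * (2 * (1 + \<Lambda>) * ?V)"
  have small: "measure lebesgue (L r) \<le> K1 * r" if r: "0 < r" "r \<le> r0" for r
  proof -
    have "\<forall>z\<in>Z. \<exists>S. S \<in> lmeasurable \<and> measure lebesgue S \<le> 2 * (1 + \<Lambda>) * ?V * r \<and>
        L r \<inter> {x. \<exists>p\<in>frontier \<Omega> \<inter> ball z (R / 2). dist x p < r} \<subseteq> S"
      using local_bound[OF _ r] Z(1) by blast
    then obtain S where S: "\<And>z. z \<in> Z \<Longrightarrow> S z \<in> lmeasurable" "\<And>z. z \<in> Z \<Longrightarrow> measure lebesgue (S z) \<le> 2 * (1 + \<Lambda>) * ?V * r"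
      "\<And>z. z \<in> Z \<Longrightarrow> L r \<inter> {x. \<exists>p\<in>frontier \<Omega> \<inter> ball z (R / 2). dist x p < r} \<subseteq> S z"
      unfolding bchoice_iff by blast
    have "L r \<subseteq> (\<Union>z\<in>Z. S z)"
    proof
      fix x assume x: "x \<in> L r"
      then have "x \<in> \<Omega>" "infdist x (- \<Omega>) < r" by (auto simp: L_def)
      then obtain p where p: "p \<in> frontier \<Omega>" "dist x p < r"
        using frontier_point_near[OF _ _ nU] by blast
      obtain z where z: "z \<in> Z" "p \<in> ball z (R / 2)" using Z(3) p(1) by blast
      have "x \<in> S z" using S(3)[OF z(1)] x p z(2) by blast
      then show "x \<in> (\<Union>z\<in>Z. S z)" using z(1) by blast
    qed
    moreover have "(\<Union>z\<in>Z. S z) \<in> lmeasurable" using S(1) Z(2) by (intro fmeasurable.finite_UN)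
    ultimately have "measure lebesgue (L r) \<le> measure lebesgue (\<Union>z\<in>Z. S z)"
      using L_meas by (intro measure_mono_fmeasurable) auto
    also have "\<dots> \<le> (\<Sum>z\<in>Z. measure lebesgue (S z))"
      using S(1) Z(2) by (intro measure_UNION_le) auto
    also have "\<dots> \<le> (\<Sum>z\<in>Z. 2 * (1 + \<Lambda>) * ?V * r)"
      by (intro sum_mono S(2))
    finally show ?thesis by (simp add: K1_def mult_ac)
  qed
  define K where "K = K1 + measure lebesgue \<Omega> / r0"
  have K1: "0 \<le> K1" using \<Lambda> by (simp add: K1_def)
  have "\<Omega> \<in> lmeasurable" using bdd \<Omega>_meas by (intro bounded_set_imp_lmeasurable) auto
  have large: "measure lebesgue (L r) \<le> measure lebesgue \<Omega> / r0 * r" if "r0 \<le> r" for r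
  proof -
    have "measure lebesgue (L r) \<le> measure lebesgue \<Omega>"
      using L_meas \<open>\<Omega> \<in> lmeasurable\<close> by (intro measure_mono_fmeasurable) (auto simp: L_def)
    also have "\<dots> = measure lebesgue \<Omega> / r0 * r0" using r0 by simp
    also have "\<dots> \<le> measure lebesgue \<Omega> / r0 * r" using that r0 by (intro mult_left_mono) auto
    finally show ?thesis .
  qed
  show ?thesis
  proof (rule that)
    show "0 \<le> K" using K1 r0 by (simp add: K_def)
    fix r :: real assume r: "0 < r"
    have nn: "0 \<le> K1 * r" "0 \<le> measure lebesgue \<Omega> / r0 * r" using K1 r r0 by simp_all
    have "measure lebesgue (L r) \<le> K1 * r + measure lebesgue \<Omega> / r0 * r"
      using small[OF r] large[of r] nn by (cases "r \<le> r0") linarith+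
    then show "measure lebesgue {x \<in> \<Omega>. infdist x (- \<Omega>) < r} \<le> K * r"
      by (simp add: K_def L_def distrib_right)
  qed
qed

lemma box_is_C11:
  fixes a b :: "'b::euclidean_space"
  assumes dim: "DIM('b) = 1" and ne: "box a b \<noteq> {}"
  shows "C11_open_set (box a b)"
proof -
  obtain i :: 'b where B: "Basis = {i}" using dim card_1_singletonE by blast
  have iB: "i \<in> Basis" by (simp add: B)
  have i: "norm i = 1" "i \<bullet> i = 1" using norm_Basis[OF iB] inner_same_Basis[OF iB] by auto
  have box: "box a b = {x. a \<bullet> i < x \<bullet> i \<and> x \<bullet> i < b \<bullet> i}" by (simp add: box_def B)
  have coord: "(x \<bullet> i) *\<^sub>R i = x" for x :: 'b
    using euclidean_representation[of x] by (simp add: B)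
  define R where "R = b \<bullet> i - a \<bullet> i"
  have R: "0 < R" using ne by (auto simp: box R_def)
  have close: "\<bar>y \<bullet> i - z \<bullet> i\<bar> < R" if "y \<in> ball z R" for y z
  proof -
    have "\<bar>(y - z) \<bullet> i\<bar> \<le> norm (y - z)" by (rule Basis_le_norm[OF iB])
    then show ?thesis using that by (simp add: inner_diff_left dist_norm norm_minus_commute)
  qed
  have fr: "z = a \<or> z = b" if "z \<in> frontier (box a b)" for z
  proof -
    have "z \<in> cbox a b - box a b" using that ne by (simp add: frontier_box)
    then have "z \<bullet> i = a \<bullet> i \<or> z \<bullet> i = b \<bullet> i" by (auto simp: box cbox_def B)
    then show ?thesis using coord by metis
  qed
  have zero: "(\<bullet>) (0::'b) = (\<lambda>_. 0)" by (simp add: fun_eq_iff)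
  have chart: "let H = {h. h \<bullet> e = 0} in
        norm e = 1 \<and> (\<lambda>_::'b. 0::real) 0 = 0 \<and> (\<lambda>_. 0) 0 = (0::'b) \<and>
        (\<forall>h\<in>H. (\<lambda>_. 0) h \<in> H \<and> ((\<lambda>_. 0::real) has_derivative (\<lambda>v. (\<lambda>_. 0) h \<bullet> v)) (at h within H) \<and> norm ((\<lambda>_. 0::'b) h) \<le> 1) \<and>
        1-lipschitz_on H (\<lambda>_. 0::'b) \<and>
        box a b \<inter> ball z R = {y \<in> ball z R. (y - z) \<bullet> e > (\<lambda>_. 0) ((y - z) - ((y - z) \<bullet> e) *\<^sub>R e)}"
    if z: "z = a \<and> e = i \<or> z = b \<and> e = - i" for z e :: 'b
    unfolding Let_def
  proof (intro conjI ballI)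
    show "norm e = 1" using z i by auto
    show "1-lipschitz_on {h. h \<bullet> e = 0} (\<lambda>_. 0::'b)" by (simp add: lipschitz_on_def)
    show "box a b \<inter> ball z R = {y \<in> ball z R. (y - z) \<bullet> e > (\<lambda>_. 0) ((y - z) - ((y - z) \<bullet> e) *\<^sub>R e)}" (is "_ = ?half")
    proof (intro equalityI subsetI)
      fix y assume "y \<in> box a b \<inter> ball z R"
      then show "y \<in> ?half"
        using z by (auto simp: box inner_diff_left)
    next
      fix y assume y: "y \<in> ?half"
      then have "\<bar>y \<bullet> i - z \<bullet> i\<bar> < R" using close by simp
      then show "y \<in> box a b \<inter> ball z R"
        using z y by (auto simp: box inner_diff_left R_def)
    qed
  qed (auto simp: zero)
  have charts: "\<forall>z\<in>frontier (box a b). boundary_chart (box a b) R 1 z"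
  proof
    fix z assume "z \<in> frontier (box a b)"
    then have "z = a \<or> z = b" by (rule fr)
    then obtain e where "z = a \<and> e = i \<or> z = b \<and> e = - i" by blast
    note c = chart[OF this]
    show "boundary_chart (box a b) R 1 z"
      by (rule exI[of _ e], rule exI[of _ "\<lambda>_. 0"], rule exI[of _ "\<lambda>_. 0"]) (rule c)
  qed
  show ?thesis
    unfolding C11_open_set_def
    by (rule conjI[OF open_box], rule exI[of _ R], rule conjI[OF R], rule exI[of _ 1], rule conjI[OF zero_less_one charts])
qed

section \<open>Brownian increments\<close>

text \<open>Ottaviani's inequality: at the first time the partial sums leave the ball of radius \<open>2r\<close>, the
  remaining increment is independent of the past and with probability at least \<open>1/2\<close> does not
  bring the sum back into the ball of radius \<open>r\<close>.\<close>

lemma (in prob_space) ottaviani_inequality: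
  fixes Y :: "nat \<Rightarrow> 'a \<Rightarrow> 'b::euclidean_space"
  assumes ind: "indep_vars (\<lambda>_. borel) Y {..<n}"
    and half: "\<And>k. k \<le> n \<Longrightarrow> prob {\<omega> \<in> space M. r < norm (\<Sum>i\<in>{k..<n}. Y i \<omega>)} \<le> 1 / 2"
  shows "prob {\<omega> \<in> space M. \<exists>k\<le>n. 2 * r < norm (\<Sum>i<k. Y i \<omega>)} \<le> 2 * prob {\<omega> \<in> space M. r < norm (\<Sum>i<n. Y i \<omega>)}"
proof -
  have Y: "Y i \<in> borel_measurable M" if "i < n" for i
    using ind that by (simp add: indep_vars_def)
  have S[measurable]: "(\<lambda>\<omega>. \<Sum>i<k. Y i \<omega>) \<in> borel_measurable M" if "k \<le> n" for k
    using Y that by (intro borel_measurable_sum) auto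
  have R[measurable]: "(\<lambda>\<omega>. \<Sum>i\<in>{k..<n}. Y i \<omega>) \<in> borel_measurable M" for k
    using Y by (intro borel_measurable_sum) auto
  \<comment> \<open>\<open>A k\<close>: the sums leave the ball at step \<open>k\<close>; \<open>B k\<close>: they move by at most \<open>r\<close> afterwards\<close>
  define past where "past k v \<longleftrightarrow> 2 * r < norm (\<Sum>i<k. v i) \<and> (\<forall>j\<in>{..<k}. norm (\<Sum>i<j. v i) \<le> 2 * r)" for k and v :: "nat \<Rightarrow> 'b"
  define A where "A k = {\<omega> \<in> space M. past k (\<lambda>i. Y i \<omega>)}" for k
  define B where "B k = {\<omega> \<in> space M. norm (\<Sum>i\<in>{k..<n}. Y i \<omega>) \<le> r}" for k
  let ?NA = "\<lambda>k. Pi\<^sub>M {..<k} (\<lambda>_. borel :: 'b measure)"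
  let ?NB = "\<lambda>k. Pi\<^sub>M {k..<n} (\<lambda>_. borel :: 'b measure)"
  define PA where "PA k = {v \<in> space (?NA k). past k v}" for k
  define PB where "PB k = {v \<in> space (?NB k). norm (\<Sum>i\<in>{k..<n}. v i) \<le> r}" for k
  have PA: "PA k \<in> sets (?NA k)" for k
  proof -
    have ms: "(\<lambda>v. \<Sum>i<j. v i) \<in> borel_measurable (?NA k)" if "j \<le> k" for j
      by (intro borel_measurable_sum measurable_component_singleton) (use that in auto)
    have "{v \<in> space (?NA k). \<forall>j\<in>{..<k}. norm (\<Sum>i<j. v i) \<le> 2 * r} \<in> sets (?NA k)"
    proof (rule sets.sets_Collect_finite_All)
      fix j assume "j \<in> {..<k}"
      then have "(\<lambda>v. \<Sum>i<j. v i) \<in> borel_measurable (?NA k)" by (intro ms) simp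
      then show "{v \<in> space (?NA k). norm (\<Sum>i<j. v i) \<le> 2 * r} \<in> sets (?NA k)" by measurable
    qed simp
    moreover have "{v \<in> space (?NA k). 2 * r < norm (\<Sum>i<k. v i)} \<in> sets (?NA k)"
      using ms[of k] by measurable
    moreover have "PA k = {v \<in> space (?NA k). 2 * r < norm (\<Sum>i<k. v i)}
        \<inter> {v \<in> space (?NA k). \<forall>j\<in>{..<k}. norm (\<Sum>i<j. v i) \<le> 2 * r}"
      by (auto simp: PA_def past_def)
    ultimately show ?thesis by simp
  qed
  have PB: "PB k \<in> sets (?NB k)" for k
  proof -
    have "(\<lambda>v. \<Sum>i\<in>{k..<n}. v i) \<in> borel_measurable (?NB k)"
      by (intro borel_measurable_sum measurable_component_singleton) auto
    then show ?thesis unfolding PB_def by measurable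
  qed
  let ?XA = "\<lambda>k \<omega>. restrict (\<lambda>i. Y i \<omega>) {..<k}" and ?XB = "\<lambda>k \<omega>. restrict (\<lambda>i. Y i \<omega>) {k..<n}"
  have iv: "indep_var (?NA k) (?XA k) (?NB k) (?XB k)" if "k \<le> n" for k
    by (rule indep_var_restrict[OF ind]) (use that in auto)
  have past_restrict: "past k (restrict v {..<k}) = past k v" for k v
    by (auto simp: past_def)
  have A_eq: "A k = ?XA k -` PA k \<inter> space M" and B_eq: "B k = ?XB k -` PB k \<inter> space M" for k
    by (auto simp: A_def PA_def B_def PB_def past_restrict space_PiM)
  have A_sets: "A k \<in> events" and B_sets: "B k \<in> events" if "k \<le> n" for k
    unfolding A_eq B_eq using iv[OF that]
    by (auto intro: measurable_sets[OF indep_var_rv1 PA] measurable_sets[OF indep_var_rv2 PB])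
  have indAB: "prob (A k \<inter> B k) = prob (A k) * prob (B k)" if "k \<le> n" for k
  proof -
    have "A k \<inter> B k = (\<lambda>\<omega>. (?XA k \<omega>, ?XB k \<omega>)) -` (PA k \<times> PB k) \<inter> space M"
      unfolding A_eq B_eq by auto
    then show ?thesis using indep_varD[OF iv[OF that] PA PB] by (simp only: A_eq B_eq)
  qed
  have B_half: "1 / 2 \<le> prob (B k)" if "k \<le> n" for k
  proof -
    have "B k = space M - {\<omega> \<in> space M. r < norm (\<Sum>i\<in>{k..<n}. Y i \<omega>)}" by (auto simp: B_def)
    moreover have "{\<omega> \<in> space M. r < norm (\<Sum>i\<in>{k..<n}. Y i \<omega>)} \<in> events" by measurable
    ultimately show ?thesis using half[OF that] by (simp add: prob_compl)
  qed
  have first: "{\<omega> \<in> space M. \<exists>k\<le>n. 2 * r < norm (\<Sum>i<k. Y i \<omega>)} = (\<Union>k\<le>n. A k)"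
  proof (intro equalityI subsetI)
    fix \<omega> assume "\<omega> \<in> {\<omega> \<in> space M. \<exists>k\<le>n. 2 * r < norm (\<Sum>i<k. Y i \<omega>)}"
    then obtain k where \<omega>: "\<omega> \<in> space M" and k: "k \<le> n" "2 * r < norm (\<Sum>i<k. Y i \<omega>)" by blast
    define l where "l = (LEAST l. 2 * r < norm (\<Sum>i<l. Y i \<omega>))"
    have "2 * r < norm (\<Sum>i<l. Y i \<omega>)" "l \<le> k"
      unfolding l_def using k(2) by (rule LeastI, rule Least_le)
    moreover have "norm (\<Sum>i<j. Y i \<omega>) \<le> 2 * r" if "j < l" for j
      using not_less_Least[OF that[unfolded l_def]] by simp
    ultimately show "\<omega> \<in> (\<Union>k\<le>n. A k)" using \<omega> k(1) by (auto simp: A_def past_def intro!: bexI[of _ l])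
  qed (auto simp: A_def past_def)
  have A_less: "A i \<inter> A j = {}" if "i < j" for i j
  proof (rule equals0I)
    fix \<omega> assume "\<omega> \<in> A i \<inter> A j"
    then have "2 * r < norm (\<Sum>l<i. Y l \<omega>)" "\<forall>k\<in>{..<j}. norm (\<Sum>l<k. Y l \<omega>) \<le> 2 * r"
      by (simp_all add: A_def past_def)
    then show False using that by (meson lessThan_iff not_less)
  qed
  have A_disj: "A i \<inter> A j = {}" if "i \<noteq> j" for i j
    using that A_less[of i j] A_less[of j i] by (cases i j rule: linorder_cases) (simp_all add: Int_commute)
  have disj: "disjoint_family_on A {..n}"
    using A_disj by (simp add: disjoint_family_on_def)
  have disj': "disjoint_family_on (\<lambda>k. A k \<inter> B k) {..n}"
    unfolding disjoint_family_on_def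
  proof (intro ballI impI)
    fix i j :: nat assume "i \<noteq> j"
    then have "A i \<inter> A j = {}" by (rule A_disj)
    then show "A i \<inter> B i \<inter> (A j \<inter> B j) = {}" by blast
  qed
  have sub: "(\<Union>k\<le>n. A k \<inter> B k) \<subseteq> {\<omega> \<in> space M. r < norm (\<Sum>i<n. Y i \<omega>)}"
  proof
    fix \<omega> assume "\<omega> \<in> (\<Union>k\<le>n. A k \<inter> B k)"
    then obtain k where k: "k \<le> n" and \<omega>: "\<omega> \<in> space M" "2 * r < norm (\<Sum>i<k. Y i \<omega>)" "norm (\<Sum>i\<in>{k..<n}. Y i \<omega>) \<le> r"
      by (auto simp: A_def B_def past_def)
    have "(\<Sum>i<n. Y i \<omega>) = (\<Sum>i<k. Y i \<omega>) + (\<Sum>i\<in>{k..<n}. Y i \<omega>)"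
      using sum.atLeastLessThan_concat[of 0 k n "\<lambda>i. Y i \<omega>"] k by (simp add: atLeast0LessThan)
    then have "norm (\<Sum>i<k. Y i \<omega>) - norm (\<Sum>i\<in>{k..<n}. Y i \<omega>) \<le> norm (\<Sum>i<n. Y i \<omega>)"
      using norm_diff_ineq by metis
    then show "\<omega> \<in> {\<omega> \<in> space M. r < norm (\<Sum>i<n. Y i \<omega>)}" using \<omega> by simp
  qed
  have "prob (\<Union>k\<le>n. A k) = (\<Sum>k\<le>n. prob (A k))"
    using A_sets disj by (intro finite_measure_finite_Union) auto
  also have "\<dots> \<le> (\<Sum>k\<le>n. 2 * prob (A k \<inter> B k))"
  proof (rule sum_mono)
    fix k assume "k \<in> {..n}"
    then show "prob (A k) \<le> 2 * prob (A k \<inter> B k)"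
      using indAB[of k] mult_left_mono[OF B_half[of k], of "prob (A k)"] by simp
  qed
  also have "\<dots> = 2 * (\<Sum>k\<le>n. prob (A k \<inter> B k))" by (simp add: sum_distrib_left)
  also have "(\<Sum>k\<le>n. prob (A k \<inter> B k)) = prob (\<Union>k\<le>n. A k \<inter> B k)"
    using A_sets B_sets disj' by (intro finite_measure_finite_Union[symmetric]) auto
  also have "\<dots> \<le> prob {\<omega> \<in> space M. r < norm (\<Sum>i<n. Y i \<omega>)}"
    using sub S[of n] by (intro finite_measure_mono) auto
  finally show ?thesis unfolding first by simp
qed

lemma brownian_motionD:
  assumes "brownian_motion M x W"
  shows "prob_space M" and "\<And>t. 0 \<le> t \<Longrightarrow> W t \<in> borel_measurable M" and "AE \<omega> in M. W 0 \<omega> = x"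
    and "\<And>\<omega>. \<omega> \<in> space M \<Longrightarrow> continuous_on {0..} (\<lambda>t. W t \<omega>)"
  using assms by (auto simp: brownian_motion_def)

lemma brownian_increment_char:
  assumes bm: "brownian_motion M x W" and "0 \<le> s" "0 \<le> h"
  shows "(\<integral>y. exp (- \<i> * complex_of_real (\<xi> \<bullet> y)) \<partial>distr M borel (\<lambda>\<omega>. W (s + h) \<omega> - W s \<omega>))
    = complex_of_real (exp (- h * (norm \<xi>)\<^sup>2))"
proof -
  have [measurable]: "W 0 \<in> borel_measurable M" "W h \<in> borel_measurable M"
    using brownian_motionD(2)[OF bm] assms by auto
  have "distr M borel (\<lambda>\<omega>. W (s + h) \<omega> - W s \<omega>) = distr M borel (\<lambda>\<omega>. W h \<omega> - W 0 \<omega>)"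
    using bm assms by (simp add: brownian_motion_def stationary_increments_def)
  then have "(\<integral>y. exp (- \<i> * complex_of_real (\<xi> \<bullet> y)) \<partial>distr M borel (\<lambda>\<omega>. W (s + h) \<omega> - W s \<omega>))
      = (\<integral>\<omega>. exp (- \<i> * complex_of_real (\<xi> \<bullet> (W h \<omega> - W 0 \<omega>))) \<partial>M)"
    by (simp add: integral_distr)
  also have "\<dots> = (\<integral>\<omega>. exp (- \<i> * complex_of_real (\<xi> \<bullet> (W h \<omega> - x))) \<partial>M)"
  proof (rule integral_cong_AE)
    show "AE \<omega> in M. exp (- \<i> * complex_of_real (\<xi> \<bullet> (W h \<omega> - W 0 \<omega>))) = exp (- \<i> * complex_of_real (\<xi> \<bullet> (W h \<omega> - x)))"
      using brownian_motionD(3)[OF bm] by eventually_elim simp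
  qed measurable
  also have "\<dots> = complex_of_real (exp (- h * (norm \<xi>)\<^sup>2))"
    using bm assms by (simp add: brownian_motion_def)
  finally show ?thesis .
qed

lemma brownian_increment_distribution_unique:
  fixes W :: "real \<Rightarrow> 'w \<Rightarrow> 'b::euclidean_space" and W' :: "real \<Rightarrow> 'v \<Rightarrow> 'b"
  assumes bm: "brownian_motion M x W" and bm': "brownian_motion M' x' W'" and "0 \<le> s" "0 \<le> h"
  shows "distr M borel (\<lambda>\<omega>. W (s + h) \<omega> - W s \<omega>) = distr M' borel (\<lambda>\<omega>. W' (s + h) \<omega> - W' s \<omega>)"
    (is "?N = ?N'")
proof (rule measure_eqI_gaussian_integrals)
  have incr: "prob_space (distr M borel (\<lambda>\<omega>. W (s + h) \<omega> - W s \<omega>))" if "0 \<le> s" "0 \<le> h" for s h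
    using brownian_motionD(1,2)[OF bm] that by (intro prob_space.prob_space_distr) auto
  show N: "prob_space ?N" by (rule incr) fact+
  show N': "prob_space ?N'"
    using brownian_motionD(1,2)[OF bm'] assms by (intro prob_space.prob_space_distr) auto
  fix a :: real and y :: 'b assume "0 < a"
  \<comment> \<open>the auxiliary Gaussian law is that of an increment itself\<close>
  let ?G = "distr M borel (\<lambda>\<omega>. W (0 + a) \<omega> - W 0 \<omega>)"
  have G: "prob_space ?G" by (rule incr) (use \<open>0 < a\<close> in auto)
  note char_G = brownian_increment_char[OF bm order_refl less_imp_le[OF \<open>0 < a\<close>]]
  have "complex_of_real (\<integral>z. exp (- a * (norm (z - y))\<^sup>2) \<partial>?N) = complex_of_real (\<integral>z. exp (- a * (norm (z - y))\<^sup>2) \<partial>?N')"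
    unfolding integral_gaussian_eq_integral_char[OF N sets_distr G sets_distr char_G]
      integral_gaussian_eq_integral_char[OF N' sets_distr G sets_distr char_G]
    using brownian_increment_char[OF bm \<open>0 \<le> s\<close> \<open>0 \<le> h\<close>] brownian_increment_char[OF bm' \<open>0 \<le> s\<close> \<open>0 \<le> h\<close>] by simp
  then show "(\<integral>z. exp (- a * (norm (z - y))\<^sup>2) \<partial>?N) = (\<integral>z. exp (- a * (norm (z - y))\<^sup>2) \<partial>?N')"
    by (simp only: of_real_eq_iff)
qed simp_all

text \<open>The second moment is read off from the characteristic function by Fatou's lemma, as
  \<open>2 n\<^sup>2 (1 - cos (a / n)) \<rightarrow> a\<^sup>2\<close>.\<close>

lemma two_square_one_minus_cos_tendsto: "(\<lambda>n. 2 * (real n)\<^sup>2 * (1 - cos (a / real n))) \<longlonglongrightarrow> a\<^sup>2"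
proof -
  have "((\<lambda>z. sin (a / 2 * z)) has_field_derivative a / 2) (at 0)"
    by (auto intro!: derivative_eq_intros)
  then have "((\<lambda>z. sin (a / 2 * z) / z) \<longlongrightarrow> a / 2) (at 0)"
    by (simp add: DERIV_def)
  moreover have "filterlim (\<lambda>n. 1 / real n) (at 0) sequentially"
    unfolding filterlim_at using lim_1_over_n by (auto intro!: eventually_sequentiallyI[of 1])
  ultimately have "(\<lambda>n. sin (a / 2 * (1 / real n)) / (1 / real n)) \<longlonglongrightarrow> a / 2"
    by (rule filterlim_compose)
  then have "(\<lambda>n. 4 * (sin (a / 2 * (1 / real n)) / (1 / real n))\<^sup>2) \<longlonglongrightarrow> 4 * (a / 2)\<^sup>2"
    by (rule tendsto_mult[OF tendsto_const tendsto_power])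
  moreover have "(\<lambda>n. 4 * (sin (a / 2 * (1 / real n)) / (1 / real n))\<^sup>2) = (\<lambda>n. 2 * (real n)\<^sup>2 * (1 - cos (a / real n)))"
  proof
    fix n
    define s where "s = sin (a / 2 * (1 / real n))"
    have "cos (a / real n) = 1 - 2 * s\<^sup>2"
      using cos_double_sin[of "a / 2 * (1 / real n)"] by (simp add: s_def)
    then show "4 * (sin (a / 2 * (1 / real n)) / (1 / real n))\<^sup>2 = 2 * (real n)\<^sup>2 * (1 - cos (a / real n))"
      unfolding s_def[symmetric] by (simp add: power_mult_distrib)
  qed
  ultimately have "(\<lambda>n. 2 * (real n)\<^sup>2 * (1 - cos (a / real n))) \<longlonglongrightarrow> 4 * (a / 2)\<^sup>2"
    by (simp only:)
  then show ?thesis by (simp add: power_divide)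
qed

lemma brownian_increment_tail:
  fixes W :: "real \<Rightarrow> 'w \<Rightarrow> 'b::euclidean_space"
  assumes bm: "brownian_motion M x W" and "0 \<le> s" "0 \<le> h" and "0 < r"
  shows "measure M {\<omega> \<in> space M. r < norm (W (s + h) \<omega> - W s \<omega>)} \<le> 2 * real DIM('b) * h / r\<^sup>2"
proof -
  interpret prob_space M by (rule brownian_motionD[OF bm])
  define X where "X \<omega> = W (s + h) \<omega> - W s \<omega>" for \<omega>
  have [measurable]: "X \<in> borel_measurable M"
    unfolding X_def[abs_def] using brownian_motionD(2)[OF bm] assms by auto
  let ?e = "\<lambda>\<xi> \<omega>. exp (- \<i> * complex_of_real (\<xi> \<bullet> X \<omega>))"
  have char: "(\<integral>\<omega>. ?e \<xi> \<omega> \<partial>M) = complex_of_real (exp (- h * (norm \<xi>)\<^sup>2))" for \<xi>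
    using brownian_increment_char[OF bm assms(2,3), folded X_def] by (simp add: integral_distr)
  have cos_int: "integrable M (\<lambda>\<omega>. cos (\<xi> \<bullet> X \<omega>))" for \<xi>
    by (rule integrable_const_bound[of _ 1]) auto
  have cos: "(\<integral>\<omega>. cos (\<xi> \<bullet> X \<omega>) \<partial>M) = exp (- h * (norm \<xi>)\<^sup>2)" for \<xi>
  proof -
    have "integrable M (\<lambda>\<omega>. ?e \<xi> \<omega>)"
      by (rule integrable_const_bound[of _ 1]) auto
    then have "Re (\<integral>\<omega>. ?e \<xi> \<omega> \<partial>M) = (\<integral>\<omega>. Re (?e \<xi> \<omega>) \<partial>M)"
      by (rule integral_Re[symmetric])
    then show ?thesis unfolding char by (simp add: Re_exp)
  qed
  have second: "(\<integral>\<^sup>+\<omega>. ennreal ((b \<bullet> X \<omega>)\<^sup>2) \<partial>M) \<le> ennreal (2 * h)" if b: "b \<in> Basis" for b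
  proof -
    have le: "(\<integral>\<^sup>+\<omega>. ennreal (2 * (real n)\<^sup>2 * (1 - cos (b \<bullet> X \<omega> / real n))) \<partial>M) \<le> ennreal (2 * h)" for n
    proof (cases "n = 0")
      case False
      have ci: "integrable M (\<lambda>\<omega>. cos (b \<bullet> X \<omega> / real n))"
        using cos_int[of "(1 / real n) *\<^sub>R b"] by simp
      have ce: "(\<integral>\<omega>. cos (b \<bullet> X \<omega> / real n) \<partial>M) = exp (- h / (real n)\<^sup>2)"
        using cos[of "(1 / real n) *\<^sub>R b"] b by (simp add: power_divide)
      have "(\<integral>\<^sup>+\<omega>. ennreal (2 * (real n)\<^sup>2 * (1 - cos (b \<bullet> X \<omega> / real n))) \<partial>M)
          = ennreal (\<integral>\<omega>. 2 * (real n)\<^sup>2 * (1 - cos (b \<bullet> X \<omega> / real n)) \<partial>M)"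
        using ci by (intro nn_integral_eq_integral) auto
      also have "(\<integral>\<omega>. 2 * (real n)\<^sup>2 * (1 - cos (b \<bullet> X \<omega> / real n)) \<partial>M)
          = 2 * (real n)\<^sup>2 * (1 - exp (- h / (real n)\<^sup>2))"
        using ci by (simp add: ce prob_space)
      also have "\<dots> \<le> 2 * (real n)\<^sup>2 * (h / (real n)\<^sup>2)"
        using exp_ge_add_one_self[of "- h / (real n)\<^sup>2"] by (intro mult_left_mono) auto
      also have "\<dots> = 2 * h" using False by simp
      finally show ?thesis by (simp add: ennreal_leI)
    qed (use assms in simp)
    have "(\<integral>\<^sup>+\<omega>. ennreal ((b \<bullet> X \<omega>)\<^sup>2) \<partial>M) = (\<integral>\<^sup>+\<omega>. liminf (\<lambda>n. ennreal (2 * (real n)\<^sup>2 * (1 - cos (b \<bullet> X \<omega> / real n)))) \<partial>M)"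
      by (intro nn_integral_cong lim_imp_Liminf[symmetric] tendsto_ennrealI two_square_one_minus_cos_tendsto) simp
    also have "\<dots> \<le> liminf (\<lambda>n. \<integral>\<^sup>+\<omega>. ennreal (2 * (real n)\<^sup>2 * (1 - cos (b \<bullet> X \<omega> / real n))) \<partial>M)"
      by (rule nn_integral_liminf) measurable
    also have "\<dots> \<le> liminf (\<lambda>n. ennreal (2 * h))"
      by (intro Liminf_mono always_eventually allI le)
    finally show ?thesis by (simp add: Liminf_const)
  qed
  have "ennreal (r\<^sup>2) * emeasure M {\<omega> \<in> space M. r < norm (X \<omega>)} = (\<integral>\<^sup>+\<omega>. ennreal (r\<^sup>2) * indicator {\<omega> \<in> space M. r < norm (X \<omega>)} \<omega> \<partial>M)"
    by (simp add: nn_integral_cmult_indicator)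
  also have "\<dots> \<le> (\<integral>\<^sup>+\<omega>. ennreal ((norm (X \<omega>))\<^sup>2) \<partial>M)"
    using \<open>0 < r\<close> by (intro nn_integral_mono) (auto simp: indicator_def intro!: ennreal_leI power_mono)
  also have "\<dots> = (\<integral>\<^sup>+\<omega>. (\<Sum>b\<in>Basis. ennreal ((b \<bullet> X \<omega>)\<^sup>2)) \<partial>M)"
  proof (intro nn_integral_cong)
    fix \<omega>
    have "(norm (X \<omega>))\<^sup>2 = (\<Sum>b\<in>Basis. (b \<bullet> X \<omega>)\<^sup>2)"
      unfolding power2_norm_eq_inner by (subst euclidean_inner) (simp add: power2_eq_square inner_commute)
    then show "ennreal ((norm (X \<omega>))\<^sup>2) = (\<Sum>b\<in>Basis. ennreal ((b \<bullet> X \<omega>)\<^sup>2))"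
      by (simp add: sum_ennreal)
  qed
  also have "\<dots> = (\<Sum>b\<in>Basis. \<integral>\<^sup>+\<omega>. ennreal ((b \<bullet> X \<omega>)\<^sup>2) \<partial>M)"
    by (rule nn_integral_sum) measurable
  also have "\<dots> \<le> (\<Sum>b\<in>(Basis :: 'b set). ennreal (2 * h))"
    by (intro sum_mono second)
  also have "\<dots> = ennreal (real DIM('b) * (2 * h))"
    using assms by (simp add: ennreal_mult ennreal_of_nat_eq_real_of_nat)
  finally have "ennreal (r\<^sup>2) * emeasure M {\<omega> \<in> space M. r < norm (X \<omega>)} \<le> ennreal (real DIM('b) * (2 * h))" .
  then have "r\<^sup>2 * prob {\<omega> \<in> space M. r < norm (X \<omega>)} \<le> real DIM('b) * (2 * h)"
    using assms by (simp add: emeasure_eq_measure ennreal_mult[symmetric])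
  then show ?thesis
    unfolding X_def using \<open>0 < r\<close> by (simp add: field_simps)
qed

section \<open>Exit from an open set\<close>

abbreviation grid_increments :: "(real \<Rightarrow> 'w \<Rightarrow> 'b::euclidean_space) \<Rightarrow> (nat \<Rightarrow> real) \<Rightarrow> nat \<Rightarrow> 'w \<Rightarrow> nat \<Rightarrow> 'b" where
  "grid_increments W t n \<equiv> \<lambda>\<omega>. \<lambda>i\<in>{..<n}. W (t (Suc i)) \<omega> - W (t i) \<omega>"

lemma brownian_increments_joint_distribution_unique:
  fixes W :: "real \<Rightarrow> 'w \<Rightarrow> 'b::euclidean_space" and W' :: "real \<Rightarrow> 'v \<Rightarrow> 'b" and t :: "nat \<Rightarrow> real"
  assumes bm: "brownian_motion M x W" and bm': "brownian_motion M' x' W'"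
    and t: "0 \<le> t 0" "incseq t" and n: "0 < n"
  shows "distr M (Pi\<^sub>M {..<n} (\<lambda>_. borel)) (grid_increments W t n)
       = distr M' (Pi\<^sub>M {..<n} (\<lambda>_. borel)) (grid_increments W' t n)"
proof -
  have t0: "0 \<le> t i" for i using t order_trans[OF t(1) incseqD[OF t(2), of 0 i]] by simp
  have rv: "(\<lambda>\<omega>. V (t (Suc i)) \<omega> - V (t i) \<omega>) \<in> borel_measurable N"
    if "brownian_motion N y V" for N :: "'z measure" and V :: "real \<Rightarrow> 'z \<Rightarrow> 'b" and y i
    using brownian_motionD(2)[OF that t0] by (intro borel_measurable_diff)
  have product: "distr N (Pi\<^sub>M {..<n} (\<lambda>_. borel)) (grid_increments V t n)
      = Pi\<^sub>M {..<n} (\<lambda>i. distr N borel (\<lambda>\<omega>. V (t (Suc i)) \<omega> - V (t i) \<omega>))"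
    if V: "brownian_motion N y V" for N :: "'z measure" and V :: "real \<Rightarrow> 'z \<Rightarrow> 'b" and y
  proof -
    interpret prob_space N by (rule brownian_motionD[OF V])
    have "indep_vars (\<lambda>_. borel) (\<lambda>i \<omega>. V (t (Suc i)) \<omega> - V (t i) \<omega>) {..<n}"
      using V t unfolding brownian_motion_def independent_increments_def by blast
    then show ?thesis
      using indep_vars_iff_distr_eq_PiM'[where I="{..<n}" and M'="\<lambda>_. borel" and X="\<lambda>i \<omega>. V (t (Suc i)) \<omega> - V (t i) \<omega>"] n rv[OF V]
      by auto
  qed
  have "distr M borel (\<lambda>\<omega>. W (t (Suc i)) \<omega> - W (t i) \<omega>) = distr M' borel (\<lambda>\<omega>. W' (t (Suc i)) \<omega> - W' (t i) \<omega>)" for i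
    using brownian_increment_distribution_unique[OF bm bm' t0, of "t (Suc i) - t i" i] incseq_SucD[OF t(2), of i] by simp
  then show ?thesis
    unfolding product[OF bm] product[OF bm'] by simp
qed

text \<open>Increments have the same joint law whatever the starting point.  So all starting points can be
  realized on one probability space, which makes grid probabilities measurable in the starting point.\<close>

lemma brownian_grid_shift:
  fixes W :: "real \<Rightarrow> 'w \<Rightarrow> 'b::euclidean_space" and W' :: "real \<Rightarrow> 'v \<Rightarrow> 'b" and t :: "nat \<Rightarrow> real"
  assumes bm: "brownian_motion M x W" and bm': "brownian_motion M' x' W'"
    and t: "t 0 = 0" "incseq t" and n: "0 < n" and K: "K \<in> sets borel"
  shows "measure M {\<omega> \<in> space M. \<forall>k\<in>{..n}. W (t k) \<omega> \<in> K}
       = measure M' {\<omega> \<in> space M'. \<forall>k\<in>{..n}. x + (W' (t k) \<omega> - W' 0 \<omega>) \<in> K}"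
proof -
  let ?P = "Pi\<^sub>M {..<n} (\<lambda>_. borel :: 'b measure)"
  let ?here = "{\<omega> \<in> space M. \<forall>k\<in>{..n}. W (t k) \<omega> \<in> K}"
  let ?vis = "\<lambda>N V. {\<omega> \<in> space N. \<forall>k\<in>{..n}. x + (V (t k) \<omega> - V 0 \<omega>) \<in> K}"
  have t0: "0 \<le> t i" for i using t incseqD[OF t(2), of 0 i] by simp
  define B where "B = {v \<in> space ?P. \<forall>k\<in>{..n}. x + (\<Sum>i<k. v i) \<in> K}"
  have B: "B \<in> sets ?P"
    unfolding B_def
  proof (rule sets.sets_Collect_finite_All)
    fix k assume "k \<in> {..n}"
    then have [measurable]: "(\<lambda>v. \<Sum>i<k. v i) \<in> borel_measurable ?P"
      by (intro borel_measurable_sum measurable_component_singleton) auto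
    note [measurable] = K
    show "{v \<in> space ?P. x + (\<Sum>i<k. v i) \<in> K} \<in> sets ?P" by measurable
  qed simp
  have incr: "measure N (?vis N V)
      = measure (distr N ?P (grid_increments V t n)) B"
    if V: "brownian_motion N y V" for N :: "'z measure" and V :: "real \<Rightarrow> 'z \<Rightarrow> 'b" and y
  proof -
    have m: "(grid_increments V t n) \<in> measurable N ?P"
      using brownian_motionD(2)[OF V t0] by (intro measurable_restrict borel_measurable_diff)
    have tel: "(\<Sum>i<k. (\<lambda>i\<in>{..<n}. V (t (Suc i)) \<omega> - V (t i) \<omega>) i) = V (t k) \<omega> - V 0 \<omega>" if "k \<in> {..n}" for k \<omega>
    proof -
      have "(\<Sum>i<k. (\<lambda>i\<in>{..<n}. V (t (Suc i)) \<omega> - V (t i) \<omega>) i) = (\<Sum>i<k. V (t (Suc i)) \<omega> - V (t i) \<omega>)"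
        using that by (intro sum.cong) auto
      also have "\<dots> = V (t k) \<omega> - V (t 0) \<omega>" by (rule sum_lessThan_telescope)
      finally show ?thesis by (simp only: t(1))
    qed
    have "(grid_increments V t n) -` B \<inter> space N
        = ?vis N V"
    proof (intro equalityI subsetI)
      fix \<omega> assume "\<omega> \<in> (grid_increments V t n) -` B \<inter> space N"
      then show "\<omega> \<in> ?vis N V"
        using tel unfolding B_def by simp
    next
      fix \<omega> assume "\<omega> \<in> ?vis N V"
      then show "\<omega> \<in> (grid_increments V t n) -` B \<inter> space N"
        using tel measurable_space[OF m] unfolding B_def by simp
    qed
    then show ?thesis using measure_distr[OF m, of B] B by simp
  qed
  have m: "?here \<in> sets M" "?vis M W \<in> sets M"
  proof -
    note [measurable] = K brownian_motionD(2)[OF bm t0] brownian_motionD(2)[OF bm order_refl]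
    show "?here \<in> sets M"
    proof (rule sets.sets_Collect_finite_All)
      show "{\<omega> \<in> space M. W (t k) \<omega> \<in> K} \<in> sets M" for k by measurable
    qed simp
    show "?vis M W \<in> sets M"
    proof (rule sets.sets_Collect_finite_All)
      show "{\<omega> \<in> space M. x + (W (t k) \<omega> - W 0 \<omega>) \<in> K} \<in> sets M" for k by measurable
    qed simp
  qed
  interpret prob_space M by (rule brownian_motionD[OF bm])
  have "measure M ?here = measure M (?vis M W)"
  proof (rule finite_measure_eq_AE)
    show "AE \<omega> in M. \<omega> \<in> ?here \<longleftrightarrow> \<omega> \<in> ?vis M W"
      using brownian_motionD(3)[OF bm] by eventually_elim simp
  qed (fact m)+
  also have "\<dots> = measure M' (?vis M' W')"
    unfolding incr[OF bm] incr[OF bm']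
    using brownian_increments_joint_distribution_unique[OF bm bm' _ t(2) n] t(1) by simp
  finally show ?thesis .
qed

lemma brownian_grid_measurable:
  fixes PW :: "'b::euclidean_space \<Rightarrow> 'w measure" and t :: "nat \<Rightarrow> real"
  assumes bm: "\<And>x. brownian_motion (PW x) x W"
    and t: "t 0 = 0" "incseq t" and n: "0 < n" and K: "K \<in> sets borel"
  shows "(\<lambda>x. measure (PW x) {\<omega> \<in> space (PW x). \<forall>k\<in>{..n}. W (t k) \<omega> \<in> K}) \<in> borel_measurable borel"
proof -
  interpret P0: prob_space "PW 0" by (rule brownian_motionD[OF bm])
  have t0: "0 \<le> t i" for i using t incseqD[OF t(2), of 0 i] by simp
  note [measurable] = K brownian_motionD(2)[OF bm t0] brownian_motionD(2)[OF bm order_refl]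
  let ?Q = "{z \<in> space (borel \<Otimes>\<^sub>M PW 0). \<forall>k\<in>{..n}. fst z + (W (t k) (snd z) - W 0 (snd z)) \<in> K}"
  have Q: "?Q \<in> sets (borel \<Otimes>\<^sub>M PW 0)"
  proof (rule sets.sets_Collect_finite_All)
    show "{z \<in> space (borel \<Otimes>\<^sub>M PW 0). fst z + (W (t k) (snd z) - W 0 (snd z)) \<in> K} \<in> sets (borel \<Otimes>\<^sub>M PW 0)" for k
      by measurable
  qed simp
  have "(\<lambda>x. enn2real (emeasure (PW 0) (Pair x -` ?Q))) \<in> borel_measurable borel"
    using P0.measurable_emeasure_Pair[OF Q] by measurable
  moreover have "measure (PW x) {\<omega> \<in> space (PW x). \<forall>k\<in>{..n}. W (t k) \<omega> \<in> K} = enn2real (emeasure (PW 0) (Pair x -` ?Q))" for x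
  proof -
    have "Pair x -` ?Q = {\<omega> \<in> space (PW 0). \<forall>k\<in>{..n}. x + (W (t k) \<omega> - W 0 \<omega>) \<in> K}"
      by (simp add: space_pair_measure vimage_def)
    then show ?thesis
      using brownian_grid_shift[OF bm bm[of 0] t n K, of x] by (simp only: measure_def)
  qed
  ultimately show ?thesis by (simp only:)
qed

definition dyadic_point :: "real \<Rightarrow> real \<Rightarrow> nat \<Rightarrow> nat \<Rightarrow> real" where
  "dyadic_point a b m k = a + (b - a) * (real k / 2 ^ m)"

lemma dyadic_point_mem: "a \<le> b \<Longrightarrow> k \<le> 2 ^ m \<Longrightarrow> dyadic_point a b m k \<in> {a..b}"
proof -
  assume ab: "a \<le> b" and "k \<le> 2 ^ m"
  then have "real k \<le> 2 ^ m" by (metis of_nat_le_iff of_nat_numeral of_nat_power)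
  then have "real k / 2 ^ m \<le> 1" by simp
  then have "(b - a) * (real k / 2 ^ m) \<le> (b - a) * 1" using ab by (intro mult_left_mono) auto
  then show ?thesis using ab by (simp add: dyadic_point_def)
qed

lemma dyadic_point_refine: "dyadic_point a b (Suc m) (2 * k) = dyadic_point a b m k"
  by (simp add: dyadic_point_def)

lemma dyadic_point_approximates:
  assumes "a \<le> b" "s \<in> {a..b}"
  obtains k where "\<And>m. k m \<le> 2 ^ m" "(\<lambda>m. dyadic_point a b m (k m)) \<longlonglongrightarrow> s"
proof (cases "a = b")
  case True
  then show ?thesis using assms that[of "\<lambda>_. 0"] by (simp add: dyadic_point_def)
next
  case False
  then have ab: "0 < b - a" using assms by simp
  define \<theta> where "\<theta> = (s - a) / (b - a)"
  have \<theta>: "0 \<le> \<theta>" "\<theta> \<le> 1" "s = a + (b - a) * \<theta>" using assms ab by (auto simp: \<theta>_def field_simps)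
  define k where "k m = nat \<lfloor>\<theta> * 2 ^ m\<rfloor>" for m
  have k: "real (k m) \<le> \<theta> * 2 ^ m" "\<theta> * 2 ^ m < real (k m) + 1" for m
  proof -
    have "0 \<le> \<theta> * 2 ^ m" using \<theta> by simp
    then show "real (k m) \<le> \<theta> * 2 ^ m" "\<theta> * 2 ^ m < real (k m) + 1" unfolding k_def by linarith+
  qed
  have "k m \<le> 2 ^ m" for m
  proof -
    have "\<theta> * 2 ^ m \<le> 1 * 2 ^ m" using \<theta> by (intro mult_right_mono) auto
    then have "real (k m) \<le> 2 ^ m" using k(1)[of m] by linarith
    then show ?thesis by (metis of_nat_le_iff of_nat_numeral of_nat_power)
  qed
  moreover have "(\<lambda>m. dyadic_point a b m (k m)) \<longlonglongrightarrow> s"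
  proof -
    have lim: "(\<lambda>m. real (k m) / 2 ^ m) \<longlonglongrightarrow> \<theta>"
    proof (rule tendsto_sandwich)
      show "\<forall>\<^sub>F m in sequentially. \<theta> - (1 / 2) ^ m \<le> real (k m) / 2 ^ m"
      proof (intro always_eventually allI)
        fix m
        have "\<theta> \<le> (real (k m) + 1) / 2 ^ m" using k(2)[of m] by (simp add: pos_le_divide_eq less_imp_le)
        then show "\<theta> - (1 / 2) ^ m \<le> real (k m) / 2 ^ m" by (simp add: add_divide_distrib power_one_over)
      qed
      show "\<forall>\<^sub>F m in sequentially. real (k m) / 2 ^ m \<le> \<theta>"
        using k(1) by (intro always_eventually allI) (simp add: pos_divide_le_eq)
      have "(\<lambda>m. \<theta> - (1 / 2) ^ m) \<longlonglongrightarrow> \<theta> - 0" by (intro tendsto_diff tendsto_const LIMSEQ_power_zero) simp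
      then show "(\<lambda>m. \<theta> - (1 / 2) ^ m) \<longlonglongrightarrow> \<theta>" by simp
    qed simp
    show ?thesis unfolding dyadic_point_def \<theta>(3) by (intro tendsto_add tendsto_mult tendsto_const lim)
  qed
  ultimately show ?thesis by (rule that)
qed

abbreviation inner_part :: "'b::metric_space set \<Rightarrow> nat \<Rightarrow> 'b set" where
  "inner_part \<Omega> j \<equiv> {y. inverse (real (Suc j)) \<le> infdist y (- \<Omega>)}"

text \<open>By compactness a path that stays in an open set during \<open>[a,b]\<close> keeps a positive distance from the
  complement; this distance only has to be tested on dyadic times.\<close>

lemma path_in_open_iff_dyadic:
  fixes w :: "real \<Rightarrow> 'b::euclidean_space"
  assumes ab: "a \<le> b" and w: "continuous_on {a..b} w" and \<Omega>: "open \<Omega>" "\<Omega> \<noteq> UNIV"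
  shows "(\<forall>s\<in>{a..b}. w s \<in> \<Omega>) \<longleftrightarrow>
    (\<exists>j. \<forall>m. \<forall>k\<in>{..2 ^ m}. w (dyadic_point a b m k) \<in> inner_part \<Omega> j)"
proof
  assume in_\<Omega>: "\<forall>s\<in>{a..b}. w s \<in> \<Omega>"
  have "continuous_on {a..b} (\<lambda>s. infdist (w s) (- \<Omega>))"
    by (intro continuous_intros w)
  then obtain s where s: "s \<in> {a..b}" "\<And>r. r \<in> {a..b} \<Longrightarrow> infdist (w s) (- \<Omega>) \<le> infdist (w r) (- \<Omega>)"
    using continuous_attains_inf[of "{a..b}" "\<lambda>s. infdist (w s) (- \<Omega>)"] ab by auto
  have "closed (- \<Omega>)" "- \<Omega> \<noteq> {}" "w s \<notin> - \<Omega>" using \<Omega> s(1) in_\<Omega> by auto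
  then have "0 < infdist (w s) (- \<Omega>)" by (rule infdist_pos_not_in_closed)
  then obtain j where "inverse (real (Suc j)) < infdist (w s) (- \<Omega>)" using reals_Archimedean by blast
  then have "inverse (real (Suc j)) \<le> infdist (w r) (- \<Omega>)" if "r \<in> {a..b}" for r
    using s(2)[OF that] by linarith
  then show "\<exists>j. \<forall>m. \<forall>k\<in>{..2 ^ m}. w (dyadic_point a b m k) \<in> inner_part \<Omega> j"
    using dyadic_point_mem[OF ab] by (intro exI[of _ j]) simp
next
  assume "\<exists>j. \<forall>m. \<forall>k\<in>{..2 ^ m}. w (dyadic_point a b m k) \<in> inner_part \<Omega> j"
  then obtain j where j: "\<And>m k. k \<le> 2 ^ m \<Longrightarrow> inverse (real (Suc j)) \<le> infdist (w (dyadic_point a b m k)) (- \<Omega>)"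
    by auto
  show "\<forall>s\<in>{a..b}. w s \<in> \<Omega>"
  proof
    fix s assume s: "s \<in> {a..b}"
    obtain k where k: "\<And>m. k m \<le> 2 ^ m" "(\<lambda>m. dyadic_point a b m (k m)) \<longlonglongrightarrow> s"
      using dyadic_point_approximates[OF ab s] by blast
    have "(\<lambda>m. w (dyadic_point a b m (k m))) \<longlonglongrightarrow> w s"
      by (rule continuous_on_tendsto_compose[OF w k(2) s]) (intro always_eventually allI dyadic_point_mem[OF ab k(1)])
    then have "(\<lambda>m. infdist (w (dyadic_point a b m (k m))) (- \<Omega>)) \<longlonglongrightarrow> infdist (w s) (- \<Omega>)"
      by (rule tendsto_infdist)
    then have "inverse (real (Suc j)) \<le> infdist (w s) (- \<Omega>)"
      by (rule LIMSEQ_le_const) (use j[OF k(1)] in blast)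
    then have "0 < infdist (w s) (- \<Omega>)" by (rule less_le_trans[rotated]) simp
    then show "w s \<in> \<Omega>" using infdist_zero[of "w s" "- \<Omega>"] by fastforce
  qed
qed

text \<open>A path that is still in the open set at time \<open>u\<close> stays there a little longer, which makes the
  inequality strict.\<close>

lemma less_exit_time_iff:
  fixes w :: "real \<Rightarrow> 'b::euclidean_space"
  assumes u: "0 < u" and w: "continuous_on {0..} w" and \<Omega>: "open \<Omega>"
  shows "ereal u < exit_time \<Omega> w \<longleftrightarrow> (\<forall>s. 0 < s \<and> s \<le> u \<longrightarrow> w s \<in> \<Omega>)"
proof
  assume l: "ereal u < exit_time \<Omega> w"
  show "\<forall>s. 0 < s \<and> s \<le> u \<longrightarrow> w s \<in> \<Omega>"
  proof (intro allI impI, rule ccontr)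
    fix s assume s: "0 < s \<and> s \<le> u" "w s \<notin> \<Omega>"
    then have "exit_time \<Omega> w \<le> ereal s" unfolding exit_time_def by (intro Inf_lower) simp
    also have "ereal s \<le> ereal u" using s by simp
    finally show False using l by simp
  qed
next
  assume in_\<Omega>: "\<forall>s. 0 < s \<and> s \<le> u \<longrightarrow> w s \<in> \<Omega>"
  have "isCont w u" by (rule continuous_on_interior[OF w]) (use u in simp)
  moreover have "w u \<in> \<Omega>" using in_\<Omega> u by simp
  ultimately have "\<forall>\<^sub>F s in at u. w s \<in> \<Omega>"
    using topological_tendstoD[of w "w u" "at u" \<Omega>] \<Omega> by (simp add: isCont_def)
  then obtain d where d_pos: "0 < d" and d_all: "\<forall>s\<in>UNIV. s \<noteq> u \<and> dist s u < d \<longrightarrow> w s \<in> \<Omega>"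
    unfolding eventually_at by blast
  have d: "w s \<in> \<Omega>" if "s \<noteq> u" "dist s u < d" for s
    using bspec[OF d_all UNIV_I, of s] that by blast
  have "ereal (u + d) \<le> exit_time \<Omega> w"
    unfolding exit_time_def
  proof (rule Inf_greatest)
    fix z assume "z \<in> ereal ` {t. 0 < t \<and> w t \<notin> \<Omega>}"
    then obtain s where s: "z = ereal s" "0 < s" "w s \<notin> \<Omega>" by blast
    have "u + d \<le> s"
    proof (rule ccontr)
      assume n: "\<not> u + d \<le> s"
      have "u < s" using in_\<Omega> s by (meson not_le)
      then have "w s \<in> \<Omega>" using n by (intro d) (simp_all add: dist_real_def)
      then show False using s by simp
    qed
    then show "ereal (u + d) \<le> z" using s by simp
  qed
  moreover have "ereal u < ereal (u + d)" using d_pos by simp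
  ultimately show "ereal u < exit_time \<Omega> w" by (rule less_le_trans[rotated])
qed

lemma path_in_open_event_measurable:
  assumes bm: "brownian_motion M x W" and ab: "0 \<le> a" "a \<le> b" and \<Omega>: "open \<Omega>" "\<Omega> \<noteq> UNIV"
  shows "{\<omega> \<in> space M. \<forall>s\<in>{a..b}. W s \<omega> \<in> \<Omega>} \<in> sets M"
proof -
  have W: "W (dyadic_point a b m k) \<in> borel_measurable M" if "k \<le> 2 ^ m" for m k
    using dyadic_point_mem[OF ab(2) that] ab by (intro brownian_motionD(2)[OF bm]) simp
  have "{\<omega> \<in> space M. \<forall>s\<in>{a..b}. W s \<omega> \<in> \<Omega>} = {\<omega> \<in> space M. \<exists>j::nat. \<forall>m::nat. \<forall>k\<in>{..2 ^ m}.
      W (dyadic_point a b m k) \<omega> \<in> inner_part \<Omega> j}"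
  proof (rule Collect_cong, rule conj_cong[OF refl])
    fix \<omega> assume "\<omega> \<in> space M"
    then have "continuous_on {a..b} (\<lambda>s. W s \<omega>)"
      by (rule continuous_on_subset[OF brownian_motionD(4)[OF bm]]) (use ab in auto)
    then show "(\<forall>s\<in>{a..b}. W s \<omega> \<in> \<Omega>) = (\<exists>j::nat. \<forall>m::nat. \<forall>k\<in>{..2 ^ m}.
      W (dyadic_point a b m k) \<omega> \<in> inner_part \<Omega> j)"
      by (rule path_in_open_iff_dyadic[OF ab(2) _ \<Omega>])
  qed
  also have "\<dots> \<in> sets M"
  proof (rule sets.sets_Collect_countable_Ex, rule sets.sets_Collect_countable_All, rule sets.sets_Collect_finite_All)
    fix j m k :: nat assume "k \<in> {..2 ^ m}"
    then have [measurable]: "W (dyadic_point a b m k) \<in> borel_measurable M" by (intro W) simp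
    show "{\<omega> \<in> space M. W (dyadic_point a b m k) \<omega> \<in> inner_part \<Omega> j} \<in> sets M"
      by measurable
  qed simp
  finally show ?thesis .
qed

abbreviation survival_event :: "'w measure \<Rightarrow> (real \<Rightarrow> 'w \<Rightarrow> 'b) \<Rightarrow> 'b set \<Rightarrow> real \<Rightarrow> 'w set" where
  "survival_event M W \<Omega> u \<equiv> {\<omega> \<in> space M. ereal u < exit_time \<Omega> (\<lambda>t. W t \<omega>)}"

lemma survival_event_measurable:
  fixes W :: "real \<Rightarrow> 'w \<Rightarrow> 'b::euclidean_space"
  assumes bm: "brownian_motion M x W" and u: "0 < u" and \<Omega>: "open \<Omega>" "\<Omega> \<noteq> UNIV"
  shows "survival_event M W \<Omega> u \<in> sets M"
proof -
  have eq: "(\<forall>s. 0 < s \<and> s \<le> u \<longrightarrow> w s \<in> \<Omega>) = (\<forall>i::nat. \<forall>s\<in>{u / real (Suc i)..u}. w s \<in> \<Omega>)" for w :: "real \<Rightarrow> 'b"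
  proof (intro iffI allI ballI impI)
    fix i :: nat and s assume "\<forall>s. 0 < s \<and> s \<le> u \<longrightarrow> w s \<in> \<Omega>" "s \<in> {u / real (Suc i)..u}"
    moreover have "0 < u / real (Suc i)" using u by simp
    ultimately show "w s \<in> \<Omega>" by (meson atLeastAtMost_iff less_le_trans)
  next
    fix s assume i: "\<forall>i::nat. \<forall>s\<in>{u / real (Suc i)..u}. w s \<in> \<Omega>" and s: "0 < s \<and> s \<le> u"
    obtain i where "inverse (real (Suc i)) < s / u" using reals_Archimedean[of "s / u"] s u by auto
    then have "u / real (Suc i) \<le> s" using u by (simp add: field_simps)
    then show "w s \<in> \<Omega>" using i s by auto
  qed
  have "survival_event M W \<Omega> u = {\<omega> \<in> space M. \<forall>i::nat. \<forall>s\<in>{u / real (Suc i)..u}. W s \<omega> \<in> \<Omega>}"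
    using less_exit_time_iff[OF u brownian_motionD(4)[OF bm] \<Omega>(1)] by (intro Collect_cong conj_cong refl) (simp only: eq)
  also have "\<dots> \<in> sets M"
  proof (rule sets.sets_Collect_countable_All)
    fix i :: nat
    have "0 \<le> u / real (Suc i)" "u / real (Suc i) \<le> u" using u by (auto simp: field_simps)
    then show "{\<omega> \<in> space M. \<forall>s\<in>{u / real (Suc i)..u}. W s \<omega> \<in> \<Omega>} \<in> sets M"
      by (rule path_in_open_event_measurable[OF bm _ _ \<Omega>])
  qed
  finally show ?thesis .
qed

text \<open>The exit time disregards time \<open>0\<close>, at which the path almost surely sits at \<open>x \<in> \<Omega>\<close>.\<close>

lemma survival_probability_eq:
  assumes bm: "brownian_motion M x W" and u: "0 < u" and \<Omega>: "open \<Omega>" "\<Omega> \<noteq> UNIV" and x: "x \<in> \<Omega>"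
  shows "measure M (survival_event M W \<Omega> u)
       = measure M {\<omega> \<in> space M. \<forall>s\<in>{0..u}. W s \<omega> \<in> \<Omega>}"
proof -
  interpret prob_space M by (rule brownian_motionD[OF bm])
  show ?thesis
  proof (rule finite_measure_eq_AE)
    show "AE \<omega> in M. \<omega> \<in> survival_event M W \<Omega> u \<longleftrightarrow> \<omega> \<in> {\<omega> \<in> space M. \<forall>s\<in>{0..u}. W s \<omega> \<in> \<Omega>}"
      using brownian_motionD(3)[OF bm]
    proof (rule AE_mp, intro AE_I2 impI)
      fix \<omega> assume \<omega>: "\<omega> \<in> space M" "W 0 \<omega> = x"
      have "(\<forall>s. 0 < s \<and> s \<le> u \<longrightarrow> W s \<omega> \<in> \<Omega>) \<longleftrightarrow> (\<forall>s\<in>{0..u}. W s \<omega> \<in> \<Omega>)"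
        using \<omega>(2) x by (metis atLeastAtMost_iff less_eq_real_def)
      then show "\<omega> \<in> survival_event M W \<Omega> u \<longleftrightarrow> \<omega> \<in> {\<omega> \<in> space M. \<forall>s\<in>{0..u}. W s \<omega> \<in> \<Omega>}"
        using \<omega>(1) less_exit_time_iff[OF u brownian_motionD(4)[OF bm \<omega>(1)] \<Omega>(1)] by simp
    qed
    show "survival_event M W \<Omega> u \<in> sets M"
      by (rule survival_event_measurable[OF bm u \<Omega>])
    show "{\<omega> \<in> space M. \<forall>s\<in>{0..u}. W s \<omega> \<in> \<Omega>} \<in> sets M"
      by (rule path_in_open_event_measurable[OF bm _ _ \<Omega>]) (use u in auto)
  qed
qed

lemma survival_probability_measurable:
  fixes PW :: "'b::euclidean_space \<Rightarrow> 'w measure"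
  assumes bm: "\<And>x. brownian_motion (PW x) x W" and u: "0 < u" and \<Omega>: "open \<Omega>" "\<Omega> \<noteq> UNIV"
  shows "(\<lambda>x. indicator \<Omega> x * measure (PW x) (survival_event (PW x) W \<Omega> u)) \<in> borel_measurable borel"
proof -
  define K where "K j = inner_part \<Omega> j" for j
  have K: "K j \<in> sets borel" for j unfolding K_def by measurable
  define G where "G j m x = {\<omega> \<in> space (PW x). \<forall>k\<in>{..2 ^ m}. W (dyadic_point 0 u m k) \<omega> \<in> K j}" for j m x
  have u0: "0 \<le> u" using u by simp
  have G_sets: "G j m x \<in> sets (PW x)" for j m x
    unfolding G_def
  proof (rule sets.sets_Collect_finite_All)
    fix k :: nat assume "k \<in> {..2 ^ m}"
    then have [measurable]: "W (dyadic_point 0 u m k) \<in> borel_measurable (PW x)"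
      using dyadic_point_mem[OF u0, of k m] by (intro brownian_motionD(2)[OF bm]) simp
    note [measurable] = K
    show "{\<omega> \<in> space (PW x). W (dyadic_point 0 u m k) \<omega> \<in> K j} \<in> sets (PW x)" by measurable
  qed simp
  have meas0: "(\<lambda>x. measure (PW x) (G j m x)) \<in> borel_measurable borel" for j m
    unfolding G_def
  proof (rule brownian_grid_measurable[OF bm _ _ _ K])
    show "incseq (dyadic_point 0 u m)"
      using u by (intro incseq_SucI) (simp add: dyadic_point_def field_simps)
    show "dyadic_point 0 u m 0 = 0" by (simp add: dyadic_point_def)
  qed simp
  have lim1: "(\<lambda>m. measure (PW x) (G j m x)) \<longlonglongrightarrow> measure (PW x) (\<Inter>m. G j m x)" for j x
  proof -
    interpret prob_space "PW x" by (rule brownian_motionD[OF bm])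
    show ?thesis
    proof (rule finite_Lim_measure_decseq)
      show "decseq (\<lambda>m. G j m x)"
      proof (rule decseq_SucI, rule subsetI)
        fix m \<omega> assume \<omega>: "\<omega> \<in> G j (Suc m) x"
        have "W (dyadic_point 0 u m k) \<omega> \<in> K j" if "k \<le> 2 ^ m" for k
        proof -
          have "2 * k \<in> {..2 ^ Suc m}" using that by simp
          then have "W (dyadic_point 0 u (Suc m) (2 * k)) \<omega> \<in> K j" using \<omega> unfolding G_def by blast
          then show ?thesis by (simp only: dyadic_point_refine)
        qed
        then show "\<omega> \<in> G j m x" using \<omega> by (simp add: G_def)
      qed
      show "range (\<lambda>m. G j m x) \<subseteq> events" by (rule image_subsetI) (rule G_sets)
    qed
  qed
  have meas1: "(\<lambda>x. measure (PW x) (\<Inter>m. G j m x)) \<in> borel_measurable borel" for j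
    by (rule borel_measurable_LIMSEQ_real[OF lim1 meas0])
  have lim2: "(\<lambda>j. measure (PW x) (\<Inter>m. G j m x)) \<longlonglongrightarrow> measure (PW x) (\<Union>j. \<Inter>m. G j m x)" for x
  proof -
    interpret prob_space "PW x" by (rule brownian_motionD[OF bm])
    show ?thesis
    proof (rule finite_Lim_measure_incseq)
      show "range (\<lambda>j. \<Inter>m. G j m x) \<subseteq> sets (PW x)"
      proof (rule image_subsetI)
        fix j
        have "range (\<lambda>m. G j m x) \<subseteq> sets (PW x)" by (rule image_subsetI) (rule G_sets)
        then show "(\<Inter>m. G j m x) \<in> sets (PW x)" by (rule sets.countable_INT) simp
      qed
      show "incseq (\<lambda>j. \<Inter>m. G j m x)"
      proof (rule incseq_SucI, rule INF_mono')
        fix j m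
        have "K j \<subseteq> K (Suc j)"
        proof
          fix y assume y: "y \<in> K j"
          have "inverse (real (Suc (Suc j))) \<le> inverse (real (Suc j))" by (simp add: field_simps)
          also have "\<dots> \<le> infdist y (- \<Omega>)" using y by (simp only: K_def mem_Collect_eq)
          finally show "y \<in> K (Suc j)" by (simp only: K_def mem_Collect_eq)
        qed
        then show "G j m x \<subseteq> G (Suc j) m x" by (auto simp: G_def)
      qed
    qed
  qed
  have meas2: "(\<lambda>x. measure (PW x) (\<Union>j. \<Inter>m. G j m x)) \<in> borel_measurable borel"
    by (rule borel_measurable_LIMSEQ_real[OF lim2 meas1])
  have "indicator \<Omega> x * measure (PW x) (survival_event (PW x) W \<Omega> u)
      = indicator \<Omega> x * measure (PW x) (\<Union>j. \<Inter>m. G j m x)" for x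
  proof (cases "x \<in> \<Omega>")
    case True
    have "{\<omega> \<in> space (PW x). \<forall>s\<in>{0..u}. W s \<omega> \<in> \<Omega>} = (\<Union>j. \<Inter>m. G j m x)"
    proof (intro set_eqI)
      fix \<omega>
      show "\<omega> \<in> {\<omega> \<in> space (PW x). \<forall>s\<in>{0..u}. W s \<omega> \<in> \<Omega>} \<longleftrightarrow> \<omega> \<in> (\<Union>j. \<Inter>m. G j m x)"
      proof (cases "\<omega> \<in> space (PW x)")
        case True
        then have "continuous_on {0..u} (\<lambda>s. W s \<omega>)"
          by (rule continuous_on_subset[OF brownian_motionD(4)[OF bm]]) auto
        from path_in_open_iff_dyadic[OF u0 this \<Omega>] show ?thesis
          using True by (simp add: G_def K_def)
      qed (simp add: G_def)
    qed
    then show ?thesis using survival_probability_eq[OF bm u \<Omega> True] by simp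
  qed simp
  then have "(\<lambda>x. indicator \<Omega> x * measure (PW x) (survival_event (PW x) W \<Omega> u))
      = (\<lambda>x. indicator \<Omega> x * measure (PW x) (\<Union>j. \<Inter>m. G j m x))"
    by (rule ext)
  moreover have "(\<lambda>x. indicator \<Omega> x * measure (PW x) (\<Union>j. \<Inter>m. G j m x)) \<in> borel_measurable borel"
    by (intro borel_measurable_times borel_measurable_indicator meas2) (use \<Omega> in simp)
  ultimately show ?thesis by (simp only:)
qed

text \<open>To leave \<open>\<Omega>\<close> the path has to move by at least the distance \<open>\<delta>\<close> of its starting point from the
  complement.  On dyadic grids Ottaviani's inequality bounds the probability of such a displacement by the
  tail of single increments.\<close>

lemma exit_probability_le:
  fixes W :: "real \<Rightarrow> 'w \<Rightarrow> 'b::euclidean_space"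
  assumes bm: "brownian_motion M x W" and u: "0 < u" and \<Omega>: "open \<Omega>" "\<Omega> \<noteq> UNIV" and x: "x \<in> \<Omega>"
  shows "1 - measure M (survival_event M W \<Omega> u)
    \<le> 64 * real DIM('b) * u / (infdist x (- \<Omega>))\<^sup>2"
proof -
  interpret prob_space M by (rule brownian_motionD[OF bm])
  define \<delta> where "\<delta> = infdist x (- \<Omega>)"
  have "closed (- \<Omega>)" "- \<Omega> \<noteq> {}" "x \<notin> - \<Omega>" using \<Omega> x by auto
  then have \<delta>: "0 < \<delta>" unfolding \<delta>_def by (rule infdist_pos_not_in_closed)
  \<comment> \<open>\<open>2r < \<delta>\<close>, so that leaving is detected at dyadic times; for \<open>c > 1\<close> the bound is trivial\<close>
  define r where "r = \<delta> / 4"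
  have r: "0 < r" using \<delta> by (simp add: r_def)
  define c where "c = 4 * real DIM('b) * u / r\<^sup>2"
  have c_eq: "c = 64 * real DIM('b) * u / \<delta>\<^sup>2" by (simp add: c_def r_def power_divide)
  define S where "S = {\<omega> \<in> space M. \<forall>s\<in>{0..u}. W s \<omega> \<in> \<Omega>}"
  have S: "S \<in> events" unfolding S_def by (rule path_in_open_event_measurable[OF bm _ _ \<Omega>]) (use u in auto)
  have u0: "0 \<le> u" using u by simp
  define E where "E m = {\<omega> \<in> space M. \<exists>k\<le>2 ^ m. 2 * r < norm (W (dyadic_point 0 u m k) \<omega> - W 0 \<omega>)}" for m
  have W: "W (dyadic_point 0 u m k) \<in> borel_measurable M" if "k \<le> 2 ^ m" for m k
    using dyadic_point_mem[OF u0 that] by (intro brownian_motionD(2)[OF bm]) simp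
  have E_sets: "E m \<in> events" for m
  proof -
    have "{\<omega> \<in> space M. \<exists>k\<in>{..2 ^ m}. 2 * r < norm (W (dyadic_point 0 u m k) \<omega> - W 0 \<omega>)} \<in> events"
    proof (rule sets.sets_Collect_finite_Ex)
      fix k :: nat assume "k \<in> {..2 ^ m}"
      then have [measurable]: "W (dyadic_point 0 u m k) \<in> borel_measurable M" by (intro W) simp
      note [measurable] = brownian_motionD(2)[OF bm order_refl]
      show "{\<omega> \<in> space M. 2 * r < norm (W (dyadic_point 0 u m k) \<omega> - W 0 \<omega>)} \<in> events" by measurable
    qed simp
    moreover have "(\<exists>k\<in>{..2 ^ m}. Q k) = (\<exists>k\<le>2 ^ m. Q k)" for Q :: "nat \<Rightarrow> bool" by blast
    ultimately show ?thesis by (simp only: E_def)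
  qed
  have E_le: "prob (E m) \<le> c" for m
  proof (cases "c \<le> 1")
    case False
    then show ?thesis using prob_le_1[of "E m"] by linarith
  next
    case True
    define t where "t = dyadic_point 0 u m"
    define Y where "Y i \<omega> = W (t (Suc i)) \<omega> - W (t i) \<omega>" for i \<omega>
    have inc: "incseq t" using u unfolding t_def by (intro incseq_SucI) (simp add: dyadic_point_def field_simps)
    have t0: "t 0 = 0" and tn: "t (2 ^ m) = u" by (simp_all add: t_def dyadic_point_def)
    have tk: "0 \<le> t k" for k using incseqD[OF inc, of 0 k] t0 by simp
    have ind: "indep_vars (\<lambda>_. borel) Y {..<2 ^ m}"
      using bm inc t0 unfolding brownian_motion_def independent_increments_def Y_def[abs_def] by simp
    have past: "(\<Sum>i<k. Y i \<omega>) = W (t k) \<omega> - W 0 \<omega>" for k \<omega>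
      unfolding Y_def sum_lessThan_telescope[of "\<lambda>i. W (t i) \<omega>"] t0 by simp
    have future: "(\<Sum>i\<in>{k..<2 ^ m}. Y i \<omega>) = W (t k + (u - t k)) \<omega> - W (t k) \<omega>" if "k \<le> 2 ^ m" for k \<omega>
      unfolding Y_def sum_Suc_diff'[OF that, of "\<lambda>i. W (t i) \<omega>"] tn by simp
    have tail: "prob {\<omega> \<in> space M. r < norm (\<Sum>i\<in>{k..<2 ^ m}. Y i \<omega>)} \<le> c / 2" if k: "k \<le> 2 ^ m" for k
    proof -
      have "t k \<le> u" using incseqD[OF inc k] tn by simp
      then have "prob {\<omega> \<in> space M. r < norm (\<Sum>i\<in>{k..<2 ^ m}. Y i \<omega>)} \<le> 2 * real DIM('b) * (u - t k) / r\<^sup>2"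
        unfolding future[OF k] by (intro brownian_increment_tail[OF bm tk _ r]) simp
      also have "\<dots> \<le> 2 * real DIM('b) * u / r\<^sup>2"
        using tk[of k] by (intro divide_right_mono mult_left_mono) auto
      also have "\<dots> = c / 2" by (simp add: c_def)
      finally show ?thesis .
    qed
    have "prob {\<omega> \<in> space M. \<exists>k\<le>2 ^ m. 2 * r < norm (\<Sum>i<k. Y i \<omega>)} \<le> 2 * prob {\<omega> \<in> space M. r < norm (\<Sum>i<2 ^ m. Y i \<omega>)}"
    proof (rule ottaviani_inequality[OF ind])
      fix k :: nat assume "k \<le> 2 ^ m"
      then show "prob {\<omega> \<in> space M. r < norm (\<Sum>i\<in>{k..<2 ^ m}. Y i \<omega>)} \<le> 1 / 2"
        using tail True by fastforce
    qed
    also have "\<dots> \<le> c" using tail[of 0] by (simp add: atLeast0LessThan)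
    finally show ?thesis by (simp add: E_def past t_def)
  qed
  have E_inc: "incseq E"
  proof (rule incseq_SucI, rule subsetI)
    fix m \<omega> assume "\<omega> \<in> E m"
    then obtain k where \<omega>: "\<omega> \<in> space M" and k: "k \<le> 2 ^ m" "2 * r < norm (W (dyadic_point 0 u m k) \<omega> - W 0 \<omega>)"
      unfolding E_def by blast
    have "2 * k \<le> 2 ^ Suc m" "2 * r < norm (W (dyadic_point 0 u (Suc m) (2 * k)) \<omega> - W 0 \<omega>)"
      using k by (simp_all add: dyadic_point_refine)
    then show "\<omega> \<in> E (Suc m)" unfolding E_def using \<omega> by blast
  qed
  have "(\<lambda>m. prob (E m)) \<longlonglongrightarrow> prob (\<Union>m. E m)"
    using E_sets E_inc by (intro finite_Lim_measure_incseq) auto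
  then have UE: "prob (\<Union>m. E m) \<le> c"
    by (rule LIMSEQ_le_const2) (use E_le in blast)
  have leave: "\<omega> \<in> (\<Union>m. E m)" if \<omega>: "\<omega> \<in> space M" "\<omega> \<notin> S" "W 0 \<omega> = x" for \<omega>
  proof (rule ccontr)
    assume nE: "\<omega> \<notin> (\<Union>m. E m)"
    obtain j where j: "inverse (real (Suc j)) < \<delta> / 2" using reals_Archimedean[of "\<delta> / 2"] \<delta> by auto
    have "inverse (real (Suc j)) \<le> infdist (W (dyadic_point 0 u m k) \<omega>) (- \<Omega>)" if "k \<le> 2 ^ m" for m k
    proof -
      have "norm (W (dyadic_point 0 u m k) \<omega> - x) \<le> \<delta> / 2"
        using nE \<omega>(1,3) that unfolding E_def by (simp add: not_less r_def)
      moreover have "\<delta> \<le> infdist (W (dyadic_point 0 u m k) \<omega>) (- \<Omega>) + dist x (W (dyadic_point 0 u m k) \<omega>)"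
        unfolding \<delta>_def by (rule infdist_triangle)
      ultimately show ?thesis using j by (simp add: dist_norm norm_minus_commute)
    qed
    then have "\<exists>j. \<forall>m. \<forall>k\<in>{..2 ^ m}. W (dyadic_point 0 u m k) \<omega> \<in> inner_part \<Omega> j"
      by (intro exI[of _ j] allI ballI) simp
    moreover have "continuous_on {0..u} (\<lambda>s. W s \<omega>)"
      by (rule continuous_on_subset[OF brownian_motionD(4)[OF bm \<omega>(1)]]) auto
    ultimately have "\<omega> \<in> S"
      using path_in_open_iff_dyadic[OF u0 _ \<Omega>] \<omega>(1) by (simp add: S_def)
    then show False using \<omega>(2) by simp
  qed
  have "prob (space M - S) \<le> prob (\<Union>m. E m)"
  proof (rule finite_measure_mono_AE)
    show "AE \<omega> in M. \<omega> \<in> space M - S \<longrightarrow> \<omega> \<in> (\<Union>m. E m)"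
      using brownian_motionD(3)[OF bm] by eventually_elim (use leave in blast)
    show "(\<Union>m. E m) \<in> events" using E_sets by (intro sets.countable_UN) auto
  qed
  then have "1 - prob S \<le> c" using UE S by (simp add: prob_compl)
  then show ?thesis
    unfolding survival_probability_eq[OF bm u \<Omega> x] S_def[symmetric] c_eq \<delta>_def .
qed

section \<open>Heat loss of the killed Brownian motion\<close>

text \<open>Where the distance from the complement is of order \<open>2\<^sup>j a\<close> the integrand is of order \<open>4\<^sup>-\<^sup>j\<close>, and this
  region has measure at most a constant times \<open>2\<^sup>j a\<close>; summation over \<open>j\<close> leaves a multiple of \<open>a\<close>.\<close>

lemma integral_boundary_decay_le:
  fixes \<Omega> :: "'b::euclidean_space set" and f :: "'b \<Rightarrow> real"
  assumes [measurable]: "\<Omega> \<in> sets borel" "f \<in> borel_measurable borel"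
    and layer: "\<And>r. 0 < r \<Longrightarrow> emeasure lborel {x \<in> \<Omega>. infdist x (- \<Omega>) < r} \<le> ennreal (K * r)"
    and K: "0 \<le> K" and C: "0 \<le> C" and a: "0 < a"
    and f: "\<And>x. x \<in> \<Omega> \<Longrightarrow> f x \<le> 1" "\<And>x. x \<in> \<Omega> \<Longrightarrow> f x \<le> C * a\<^sup>2 / (infdist x (- \<Omega>))\<^sup>2"
  shows "(\<integral>\<^sup>+x. ennreal (indicator \<Omega> x * f x) \<partial>lborel) \<le> ennreal (8 * (C + 1) * K * a)"
proof -
  define L where "L j = {x \<in> \<Omega>. infdist x (- \<Omega>) < 2 ^ j * a}" for j :: nat
  have [measurable]: "L j \<in> sets borel" for j unfolding L_def by measurable
  define c where "c j = 4 * (C + 1) * (1 / 4) ^ j" for j :: nat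
  have c: "0 \<le> c j" for j using C by (simp add: c_def)
  have point: "ennreal (indicator \<Omega> x * f x) \<le> (\<Sum>j. ennreal (c j) * indicator (L j) x)" for x
  proof (cases "x \<in> \<Omega>")
    case True
    define d where "d = infdist x (- \<Omega>)"
    obtain n where "d / a < 2 ^ n" using real_arch_pow[of 2 "d / a"] by auto
    then have ex: "d < 2 ^ n * a" using a by (simp add: field_simps)
    define j where "j = (LEAST j. d < 2 ^ j * a)"
    have j: "d < 2 ^ j * a" unfolding j_def by (rule LeastI[of _ n]) (rule ex)
    have fj: "f x \<le> c j"
    proof (cases j)
      case 0
      then show ?thesis using f(1)[OF True] C by (simp add: c_def)
    next
      case (Suc i)
      have "\<not> d < 2 ^ i * a" using not_less_Least[of i "\<lambda>j. d < 2 ^ j * a"] Suc by (simp add: j_def)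
      then have d: "2 ^ i * a \<le> d" by simp
      have pos: "0 < 2 ^ i * a" using a by simp
      have "f x \<le> C * a\<^sup>2 / d\<^sup>2" using f(2)[OF True] by (simp add: d_def)
      also have "\<dots> \<le> C * a\<^sup>2 / (2 ^ i * a)\<^sup>2"
      proof (rule divide_left_mono)
        show "(2 ^ i * a)\<^sup>2 \<le> d\<^sup>2" using d pos by (intro power_mono) auto
        have "0 < d" using d pos by linarith
        then show "0 < d\<^sup>2 * (2 ^ i * a)\<^sup>2" by (intro mult_pos_pos zero_less_power pos)
      qed (use C in simp)
      also have "\<dots> = C * (1 / 4) ^ i"
      proof -
        have "((2::real) ^ i)\<^sup>2 = 4 ^ i" by (induction i) (simp_all add: power2_eq_square)
        then have "(2 ^ i * a)\<^sup>2 = 4 ^ i * a\<^sup>2" by (simp only: power_mult_distrib)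
        then show ?thesis using a by (simp add: power_one_over)
      qed
      also have "\<dots> \<le> (C + 1) * (1 / 4) ^ i" by (rule mult_right_mono) simp_all
      also have "\<dots> = c j" by (simp add: c_def Suc)
      finally show ?thesis .
    qed
    have "ennreal (indicator \<Omega> x * f x) \<le> ennreal (c j) * indicator (L j) x"
      using True j fj by (simp add: L_def d_def ennreal_leI)
    also have "\<dots> \<le> (\<Sum>j. ennreal (c j) * indicator (L j) x)"
    proof -
      define g where "g j = ennreal (c j) * indicator (L j) x" for j
      have "(\<Sum>i\<in>{j}. g i) \<le> (\<Sum>j. g j)" by (rule sum_le_suminf) auto
      then show ?thesis by (simp add: g_def[symmetric])
    qed
    finally show ?thesis .
  qed simp
  have geom: "(\<lambda>j. 4 * (C + 1) * K * a * (1 / 2) ^ j) sums (4 * (C + 1) * K * a * 2)"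
    using geometric_sums[of "1 / 2 :: real"] by (intro sums_mult) simp
  have "(\<integral>\<^sup>+x. ennreal (indicator \<Omega> x * f x) \<partial>lborel) \<le> (\<integral>\<^sup>+x. (\<Sum>j. ennreal (c j) * indicator (L j) x) \<partial>lborel)"
    by (intro nn_integral_mono point)
  also have "\<dots> = (\<Sum>j. ennreal (c j) * emeasure lborel (L j))"
    by (subst nn_integral_suminf) (auto simp: nn_integral_cmult_indicator)
  also have "\<dots> \<le> (\<Sum>j. ennreal (4 * (C + 1) * K * a * (1 / 2) ^ j))"
  proof (rule suminf_le)
    fix j :: nat
    have "ennreal (c j) * emeasure lborel (L j) \<le> ennreal (c j) * ennreal (K * (2 ^ j * a))"
      unfolding L_def using a by (intro mult_left_mono layer) auto
    also have "\<dots> = ennreal (c j * (K * (2 ^ j * a)))"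
      using c K a by (intro ennreal_mult[symmetric]) auto
    also have "c j * (K * (2 ^ j * a)) = 4 * (C + 1) * K * a * (1 / 2) ^ j"
    proof -
      have "(1 / 4 :: real) ^ j * 2 ^ j = (1 / 2) ^ j" by (simp add: power_mult_distrib[symmetric])
      then show ?thesis by (simp add: c_def mult_ac)
    qed
    finally show "ennreal (c j) * emeasure lborel (L j) \<le> ennreal (4 * (C + 1) * K * a * (1 / 2) ^ j)" .
  qed auto
  also have "\<dots> = ennreal (4 * (C + 1) * K * a * 2)"
    using geom C K a by (intro suminf_ennreal_eq) auto
  finally show ?thesis by (simp add: mult_ac)
qed

section \<open>Subordination of the killed process\<close>

text \<open>As \<open>d\<close> is positive after time \<open>0\<close>, the killed path at \<open>d s\<close> is outside \<open>\<Omega>\<close> exactly if \<open>d s\<close> has reached the exit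
  time.  If it has not at time \<open>t\<close>, right continuity leaves some time to spare.\<close>

lemma subordinate_exit_iff:
  fixes w :: "real \<Rightarrow> 'b::euclidean_space" and d :: "real \<Rightarrow> real"
  assumes d: "d 0 = 0" "strict_mono_on {0..} d" "(d \<longlongrightarrow> d t) (at_right t)" and t: "0 < t"
  shows "ereal t < exit_time (Some ` \<Omega>) (\<lambda>s. killed_path \<Omega> w (d s)) \<longleftrightarrow> ereal (d t) < exit_time \<Omega> w"
proof -
  let ?\<tau> = "exit_time \<Omega> w"
  have pos: "0 < d s" if "0 < s" for s
    using strict_mono_onD[OF d(2), of 0 s] d(1) that by simp
  have mem: "w s \<in> \<Omega>" if "0 < s" "ereal s < ?\<tau>" for s
  proof (rule ccontr)
    assume "w s \<notin> \<Omega>"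
    then have "?\<tau> \<le> ereal s" unfolding exit_time_def using that(1) by (intro Inf_lower) simp
    then show False using that(2) by simp
  qed
  have killed: "killed_path \<Omega> w (d s) \<notin> Some ` \<Omega> \<longleftrightarrow> ?\<tau> \<le> ereal (d s)" if "0 < s" for s
    using mem[OF pos[OF that]] by (auto simp: killed_path_def not_less)
  have exit: "exit_time (Some ` \<Omega>) (\<lambda>s. killed_path \<Omega> w (d s)) = Inf (ereal ` {s. 0 < s \<and> ?\<tau> \<le> ereal (d s)})"
  proof -
    have "{s. 0 < s \<and> killed_path \<Omega> w (d s) \<notin> Some ` \<Omega>} = {s. 0 < s \<and> ?\<tau> \<le> ereal (d s)}"
      by (intro Collect_cong conj_cong refl killed)
    then show ?thesis by (simp only: exit_time_def[of "Some ` \<Omega>"])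
  qed
  show ?thesis
    unfolding exit
  proof
    assume l: "ereal t < Inf (ereal ` {s. 0 < s \<and> ?\<tau> \<le> ereal (d s)})"
    show "ereal (d t) < ?\<tau>"
    proof (rule ccontr)
      assume "\<not> ereal (d t) < ?\<tau>"
      then have "Inf (ereal ` {s. 0 < s \<and> ?\<tau> \<le> ereal (d s)}) \<le> ereal t"
        using t by (intro Inf_lower imageI) simp
      then show False using l by simp
    qed
  next
    assume l: "ereal (d t) < ?\<tau>"
    have "((\<lambda>s. ereal (d s)) \<longlongrightarrow> ereal (d t)) (at_right t)" by (intro tendsto_ereal d(3))
    then have "\<forall>\<^sub>F s in at_right t. ereal (d s) < ?\<tau>" using l by (rule order_tendstoD(2))
    then obtain b where b: "t < b" "\<And>s. t < s \<Longrightarrow> s < b \<Longrightarrow> ereal (d s) < ?\<tau>"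
      unfolding eventually_at_right_field by blast
    have "ereal b \<le> Inf (ereal ` {s. 0 < s \<and> ?\<tau> \<le> ereal (d s)})"
    proof (rule Inf_greatest)
      fix z assume "z \<in> ereal ` {s. 0 < s \<and> ?\<tau> \<le> ereal (d s)}"
      then obtain s where s: "z = ereal s" "0 < s" "?\<tau> \<le> ereal (d s)" by blast
      have "b \<le> s"
      proof (rule ccontr)
        assume "\<not> b \<le> s"
        have "ereal (d s) < ?\<tau>"
        proof (cases "t < s")
          case True then show ?thesis using b(2) \<open>\<not> b \<le> s\<close> by simp
        next
          case False
          then have "d s \<le> d t"
            using strict_mono_onD[OF d(2), of s t] s(2) t by (cases "s = t") auto
          then show ?thesis using l by (simp add: le_less_trans[rotated])
        qed
        then show False using s(3) by simp
      qed
      then show "ereal b \<le> z" using s(1) by simp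
    qed
    moreover have "ereal t < ereal b" using b(1) by simp
    ultimately show "ereal t < Inf (ereal ` {s. 0 < s \<and> ?\<tau> \<le> ereal (d s)})" by (rule less_le_trans[rotated])
  qed
qed

definition survival_probability ::
  "('b \<Rightarrow> 'w measure) \<Rightarrow> (real \<Rightarrow> 'w \<Rightarrow> 'b) \<Rightarrow> 'b set \<Rightarrow> 'b \<Rightarrow> real \<Rightarrow> real" where
  "survival_probability PW W \<Omega> x u = measure (PW x) (survival_event (PW x) W \<Omega> u)"

lemma ereal_less_mono: "a \<le> b \<Longrightarrow> ereal b < z \<Longrightarrow> ereal a < z"
  by (rule le_less_trans[of _ "ereal b"]) simp_all

lemma survival_probability_antimono:
  fixes PW :: "'b::euclidean_space \<Rightarrow> 'w measure"
  assumes bm: "brownian_motion (PW x) x W" and \<Omega>: "open \<Omega>" "\<Omega> \<noteq> UNIV" and "0 < u" "u \<le> v"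
  shows "survival_probability PW W \<Omega> x v \<le> survival_probability PW W \<Omega> x u"
proof -
  interpret prob_space "PW x" by (rule brownian_motionD[OF bm])
  show ?thesis
    unfolding survival_probability_def
    by (intro finite_measure_mono survival_event_measurable[OF bm \<open>0 < u\<close> \<Omega>]) (auto intro: ereal_less_mono[OF \<open>u \<le> v\<close>])
qed

text \<open>Survival probabilities are right continuous in time, hence limits of functions depending on
  time only through its dyadic upper approximation.\<close>

lemma survival_probability_jointly_measurable:
  fixes PW :: "'b::euclidean_space \<Rightarrow> 'w measure"
  assumes bm: "\<And>x. brownian_motion (PW x) x W" and \<Omega>: "open \<Omega>" "\<Omega> \<noteq> UNIV"
  shows "(\<lambda>z. indicator \<Omega> (fst z) * survival_probability PW W \<Omega> (fst z) (snd z) * indicator {0<..} (snd z)) \<in> borel_measurable (borel \<Otimes>\<^sub>M borel)"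
proof -
  let ?P = "survival_probability PW W \<Omega>"
  define p where "p n i = (real i + 1) / 2 ^ n" for n i :: nat
  define k where "k n u = nat \<lfloor>2 ^ n * u\<rfloor>" for n :: nat and u :: real
  define h where "h n z = indicator \<Omega> (fst z) * ?P (fst z) (p n (k n (snd z))) * indicator {0<..} (snd z)" for n and z :: "'b \<times> real"
  have p_pos: "0 < p n i" for n i by (simp add: p_def)
  have h_meas: "h n \<in> borel_measurable (borel \<Otimes>\<^sub>M borel)" for n
    unfolding h_def[abs_def]
  proof (rule measurable_compose_countable[where f="\<lambda>i (z :: 'b \<times> real). indicator \<Omega> (fst z) * ?P (fst z) (p n i) * indicator {0<..} (snd z)"])
    fix i
    show "(\<lambda>z :: 'b \<times> real. indicator \<Omega> (fst z) * ?P (fst z) (p n i) * indicator {0<..} (snd z)) \<in> borel_measurable (borel \<Otimes>\<^sub>M borel)"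
    proof (rule borel_measurable_times)
      show "(\<lambda>z :: 'b \<times> real. indicator \<Omega> (fst z) * ?P (fst z) (p n i)) \<in> borel_measurable (borel \<Otimes>\<^sub>M borel)"
        by (rule measurable_compose[OF measurable_fst survival_probability_measurable[OF bm p_pos \<Omega>, folded survival_probability_def]])
      show "(\<lambda>z :: 'b \<times> real. indicator {0<..} (snd z) :: real) \<in> borel_measurable (borel \<Otimes>\<^sub>M borel)"
        by (rule measurable_compose[OF measurable_snd borel_measurable_indicator]) simp
    qed
  next
    have "(\<lambda>u. k n u) \<in> measurable borel (count_space UNIV)" unfolding k_def by measurable
    then show "(\<lambda>z. k n (snd z)) \<in> measurable (borel \<Otimes>\<^sub>M borel) (count_space UNIV)" by measurable
  qed
  have "(\<lambda>n. h n z) \<longlonglongrightarrow> indicator \<Omega> (fst z) * ?P (fst z) (snd z) * indicator {0<..} (snd z)" for z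
  proof (cases "0 < snd z")
    case True
    define x where "x = fst z"
    define u where "u = snd z"
    have u: "0 < u" using True by (simp add: u_def)
    define q where "q n = p n (k n u)" for n
    have kq: "real (k n u) \<le> 2 ^ n * u" "2 ^ n * u < real (k n u) + 1" for n
    proof -
      have "0 \<le> 2 ^ n * u" using u by simp
      then show "real (k n u) \<le> 2 ^ n * u" "2 ^ n * u < real (k n u) + 1" unfolding k_def by linarith+
    qed
    have q_gt: "u < q n" for n
      using kq(2)[of n] by (simp add: q_def p_def pos_less_divide_eq mult.commute)
    have q_le: "q n \<le> u + (1 / 2) ^ n" for n
      using kq(1)[of n] by (simp add: q_def p_def add_divide_distrib power_one_over pos_divide_le_eq mult.commute)
    have q_dec: "q (Suc n) \<le> q n" for n
    proof -
      have "2 ^ Suc n * u = 2 * (2 ^ n * u)" by simp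
      then have "real (k (Suc n) u) < real (2 * k n u + 2)"
        using kq(1)[of "Suc n"] kq(2)[of n] by simp
      then have "k (Suc n) u < 2 * k n u + 2" by (simp only: of_nat_less_iff)
      then have "k (Suc n) u + 1 \<le> 2 * (k n u + 1)" by simp
      then have "real (k (Suc n) u + 1) \<le> real (2 * (k n u + 1))" by (simp only: of_nat_le_iff)
      then have "real (k (Suc n) u) + 1 \<le> 2 * (real (k n u) + 1)" by simp
      then have "(real (k (Suc n) u) + 1) / 2 ^ Suc n \<le> 2 * (real (k n u) + 1) / 2 ^ Suc n"
        by (rule divide_right_mono) simp
      also have "2 * (real (k n u) + 1) / 2 ^ Suc n = (real (k n u) + 1) / 2 ^ n"
        unfolding power_Suc by (rule mult_divide_mult_cancel_left) simp
      finally show ?thesis by (simp only: q_def p_def)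
    qed
    \<comment> \<open>\<open>q n\<close> decreases to \<open>u\<close>, so the survival events up to \<open>q n\<close> increase to the one up to \<open>u\<close>\<close>
    interpret prob_space "PW x" by (rule brownian_motionD[OF bm])
    let ?S = "survival_event (PW x) W \<Omega>"
    have "(\<lambda>n. prob (?S (q n))) \<longlonglongrightarrow> prob (\<Union>n. ?S (q n))"
    proof (rule finite_Lim_measure_incseq)
      show "range (\<lambda>n. ?S (q n)) \<subseteq> events"
        by (rule image_subsetI) (rule survival_event_measurable[OF bm less_trans[OF u q_gt] \<Omega>])
      show "incseq (\<lambda>n. ?S (q n))"
      proof (rule incseq_SucI, rule subsetI)
        fix n \<omega> assume \<omega>: "\<omega> \<in> ?S (q n)"
        show "\<omega> \<in> ?S (q (Suc n))" using \<omega> ereal_less_mono[OF q_dec] by simp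
      qed
    qed
    also have "(\<Union>n. ?S (q n)) = ?S u"
    proof (intro equalityI subsetI)
      fix \<omega> assume "\<omega> \<in> (\<Union>n. ?S (q n))"
      then obtain n where n: "\<omega> \<in> ?S (q n)" by blast
      then show "\<omega> \<in> ?S u" using ereal_less_mono[OF less_imp_le[OF q_gt[of n]]] by simp
    next
      fix \<omega> assume \<omega>: "\<omega> \<in> ?S u"
      then obtain r where r: "ereal u < ereal r" "ereal r < exit_time \<Omega> (\<lambda>t. W t \<omega>)"
        using ereal_dense2 by blast
      obtain n where "(1 / 2) ^ n < r - u" using real_arch_pow_inv[of "r - u" "1 / 2"] r(1) by auto
      then have "q n \<le> r" using q_le[of n] by simp
      then have "\<omega> \<in> ?S (q n)" using ereal_less_mono[OF _ r(2)] \<omega> by simp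
      then show "\<omega> \<in> (\<Union>n. ?S (q n))" by blast
    qed
    finally have "(\<lambda>n. ?P x (q n)) \<longlonglongrightarrow> ?P x u"
      by (simp only: survival_probability_def)
    then show ?thesis
      unfolding h_def x_def[symmetric] u_def[symmetric] q_def[symmetric] by (intro tendsto_mult tendsto_const)
  qed (simp add: h_def)
  then show ?thesis using h_meas by (rule borel_measurable_LIMSEQ_real)
qed

lemma admissible_domain_bounded_C11:
  fixes \<Omega> :: "'b::euclidean_space set"
  assumes "admissible_domain \<Omega>"
  shows "bounded \<Omega>" and "C11_open_set \<Omega>"
proof -
  have "bounded \<Omega> \<and> C11_open_set \<Omega>"
  proof (cases "DIM('b) = 1")
    case True
    have "\<Omega> \<noteq> {} \<and> (\<exists>a b. \<Omega> = box a b)"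
      using assms True by (simp add: admissible_domain_def)
    then obtain a b where "\<Omega> \<noteq> {}" "\<Omega> = box a b" by blast
    then show ?thesis using box_is_C11[OF True] bounded_box by blast
  next
    case False
    then show ?thesis using assms unfolding admissible_domain_def by (simp only: if_False)
  qed
  then show "bounded \<Omega>" "C11_open_set \<Omega>" by blast+
qed

lemma almost_monotone_density_diffuse:
  assumes "almost_monotone_density \<nu>" "countable A"
  shows "emeasure \<nu> A = 0"
proof -
  obtain n :: "real \<Rightarrow> real" where n: "n \<in> borel_measurable borel" and \<nu>: "\<nu> = density lborel (\<lambda>x. ennreal (n x) * indicator {0<..} x)"
    using assms(1) unfolding almost_monotone_density_def by blast
  have A: "A \<in> null_sets lborel" by (rule countable_imp_null_set_lborel[OF assms(2)])
  then have "emeasure \<nu> A = (\<integral>\<^sup>+x\<in>A. ennreal (n x) * indicator {0<..} x \<partial>lborel)"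
    unfolding \<nu> using n by (intro emeasure_density) auto
  also have "\<dots> = 0" by (rule nn_integral_null_set[OF A])
  finally show ?thesis .
qed

theorem theorem3p14:
  fixes \<Omega> :: "'b::euclidean_space set"
    and PW :: "'b \<Rightarrow> 'w measure" and W :: "real \<Rightarrow> 'w \<Rightarrow> 'b"
    and PD :: "'s measure" and D :: "real \<Rightarrow> 's \<Rightarrow> real"
    and \<phi> :: "real \<Rightarrow> real" and \<nu> :: "real measure" and \<beta> :: real
  assumes "admissible_domain \<Omega>"
    and "\<beta> \<in> {0<..<1/2}"
    and "subordinator PD D \<phi> \<nu>"
    and "regularly_varying_at_infinity \<phi> \<beta>"
    and "almost_monotone_density \<nu>"
    and "\<And>x. brownian_motion (PW x) x W"
  shows "set_integrable \<nu> {0<..} (\<lambda>u. measure lborel \<Omega> - heat_content PW W \<Omega> u) \<and>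
    ((\<lambda>t. (measure lborel \<Omega> - subordinate_killed_heat_content PW W PD D \<Omega> t) / t)
      \<longlongrightarrow> (LINT u:{0<..}|\<nu>. measure lborel \<Omega> - heat_content PW W \<Omega> u)) (at_right 0)"
proof -
  note bm = assms(6)
  have bdd: "bounded \<Omega>" and C11: "C11_open_set \<Omega>"
    using admissible_domain_bounded_C11[OF assms(1)] .
  have op: "open \<Omega>" using C11 by (simp add: C11_open_set_def)
  have nU: "\<Omega> \<noteq> UNIV" using bdd not_bounded_UNIV by metis
  note \<Omega> = op nU
  have \<Omega>_borel [measurable]: "\<Omega> \<in> sets borel" using op by simp
  have fin: "emeasure lborel \<Omega> < \<infinity>" by (rule emeasure_bounded_finite[OF bdd])
  define V where "V = measure lborel \<Omega>"
  have V0: "0 \<le> V" by (simp add: V_def)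
  define S where "S = survival_probability PW W \<Omega>"
  define g where "g u = V - heat_content PW W \<Omega> u" for u
  have ind_int: "integrable lborel (indicator \<Omega> :: 'b \<Rightarrow> real)"
    using fin by (intro integrable_real_indicator) auto
  have ind_val: "(\<integral>x. indicator \<Omega> x \<partial>lborel) = V" by (simp add: V_def)
  have S01: "0 \<le> S x u" "S x u \<le> 1" for x u
    unfolding S_def survival_probability_def
    using prob_space.prob_le_1[OF brownian_motionD(1)[OF bm]] by simp_all
  have S_meas [measurable]: "(\<lambda>x. indicator \<Omega> x * S x u) \<in> borel_measurable borel" if "0 < u" for u
    using survival_probability_measurable[OF bm that \<Omega>] by (simp add: S_def survival_probability_def)
  have S_int: "integrable lborel (\<lambda>x. indicator \<Omega> x * S x u)" if "0 < u" for u
  proof (rule Bochner_Integration.integrable_bound[OF ind_int])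
    show "AE x in lborel. norm (indicator \<Omega> x * S x u) \<le> norm (indicator \<Omega> x :: real)"
      using S01 by (auto simp: indicator_def)
  qed (use S_meas[OF that] in simp)
  have heat: "heat_content PW W \<Omega> u = (\<integral>x. indicator \<Omega> x * S x u \<partial>lborel)" for u
    by (simp add: heat_content_def set_lebesgue_integral_def S_def survival_probability_def)
  have g_eq: "g u = (\<integral>x. indicator \<Omega> x * (1 - S x u) \<partial>lborel)" if "0 < u" for u
  proof -
    have "(\<integral>x. indicator \<Omega> x * (1 - S x u) \<partial>lborel) = (\<integral>x. indicator \<Omega> x - indicator \<Omega> x * S x u \<partial>lborel)"
      by (simp add: right_diff_distrib)
    also have "\<dots> = V - (\<integral>x. indicator \<Omega> x * S x u \<partial>lborel)"
      using ind_int S_int[OF that] ind_val by simp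
    finally show ?thesis by (simp add: g_def heat)
  qed
  have loss_int: "integrable lborel (\<lambda>x. indicator \<Omega> x * (1 - S x u))" if "0 < u" for u
    using ind_int S_int[OF that] by (simp add: right_diff_distrib)
  have g_nonneg: "0 \<le> g u" if "0 < u" for u
    unfolding g_eq[OF that] using S01 by (intro Bochner_Integration.integral_nonneg) (simp add: indicator_def)
  have g_le_V: "g u \<le> V" for u
    unfolding g_def heat using S01 by (simp add: Bochner_Integration.integral_nonneg)
  have g_mono: "mono_on {0<..} g"
  proof (rule mono_onI)
    fix u v :: real assume uv: "u \<in> {0<..}" "v \<in> {0<..}" "u \<le> v"
    have "S x v \<le> S x u" for x
      unfolding S_def using uv by (intro survival_probability_antimono[OF bm \<Omega>]) auto
    then show "g u \<le> g v"
      using uv g_eq[of u] g_eq[of v] loss_int[of u] loss_int[of v]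
      by (simp add: integral_mono mult_left_mono)
  qed
  obtain K where K: "0 \<le> K" and layer: "\<And>r. 0 < r \<Longrightarrow> measure lebesgue {x \<in> \<Omega>. infdist x (- \<Omega>) < r} \<le> K * r"
    using boundary_layer_measure_le[OF bdd C11] by blast
  define C where "C = 64 * real DIM('b)"
  have C: "0 \<le> C" by (simp add: C_def)
  have g_le_sqrt: "g u \<le> 8 * (C + 1) * K * sqrt u" if u: "0 < u" for u
  proof -
    have layer': "emeasure lborel {x \<in> \<Omega>. infdist x (- \<Omega>) < r} \<le> ennreal (K * r)" if "0 < r" for r
    proof -
      let ?L = "{x \<in> \<Omega>. infdist x (- \<Omega>) < r}"
      have L: "?L \<in> sets lborel" by measurable
      have "bounded ?L" by (rule bounded_subset[OF bdd]) auto
      then have "emeasure lborel ?L < \<infinity>" by (rule emeasure_bounded_finite)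
      then have "emeasure lborel ?L = ennreal (measure lborel ?L)" by (intro emeasure_eq_ennreal_measure) auto
      also have "measure lborel ?L = measure lebesgue ?L" by (rule measure_completion[OF L, symmetric])
      finally show ?thesis using layer[OF that] by (simp add: ennreal_leI)
    qed
    let ?f = "\<lambda>x. indicator \<Omega> x * (1 - S x u)"
    have fm: "?f \<in> borel_measurable borel"
      using loss_int[OF u] by (simp add: borel_measurable_integrable)
    have "ennreal (g u) = (\<integral>\<^sup>+x. ennreal (?f x) \<partial>lborel)"
      unfolding g_eq[OF u] using S01 by (intro nn_integral_eq_integral[symmetric] loss_int[OF u]) (simp add: indicator_def)
    also have "\<dots> = (\<integral>\<^sup>+x. ennreal (indicator \<Omega> x * ?f x) \<partial>lborel)"
      by (intro nn_integral_cong) (simp add: indicator_def)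
    also have "\<dots> \<le> ennreal (8 * (C + 1) * K * sqrt u)"
    proof (rule integral_boundary_decay_le[OF \<Omega>_borel fm layer' K C])
      show "0 < sqrt u" using u by simp
      fix x assume x: "x \<in> \<Omega>"
      show "?f x \<le> 1" using S01 x by simp
      show "?f x \<le> C * (sqrt u)\<^sup>2 / (infdist x (- \<Omega>))\<^sup>2"
        using exit_probability_le[OF bm u \<Omega> x] x u by (simp add: S_def survival_probability_def C_def)
    qed
    finally show ?thesis
      using K C u by (subst (asm) ennreal_le_iff) auto
  qed
  \<comment> \<open>the square root bound serves for \<open>u \<le> 1\<close>, the bound by \<open>V\<close> for \<open>u > 1\<close>\<close>
  define A where "A = 8 * (C + 1) * K * (sqrt 2 / (1 - exp (- 1))) + V / (1 - exp (- 1))"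
  have e1: "0 < 1 - exp (- 1 :: real)" by simp
  have g_le: "g u \<le> A * bernstein_root u" if u: "0 < u" for u
  proof -
    have nn: "0 \<le> 8 * (C + 1) * K" using C K by simp
    have B0: "0 \<le> bernstein_root u" by (rule bernstein_root_nonneg)
    have Q: "0 \<le> sqrt 2 / (1 - exp (- 1))" "0 \<le> V / (1 - exp (- 1))"
      using e1 V0 by (intro divide_nonneg_pos; simp)+
    have P1: "0 \<le> 8 * (C + 1) * K * (sqrt 2 / (1 - exp (- 1))) * bernstein_root u"
      and P2: "0 \<le> V / (1 - exp (- 1)) * bernstein_root u"
      by (rule mult_nonneg_nonneg[OF mult_nonneg_nonneg[OF nn Q(1)] B0], rule mult_nonneg_nonneg[OF Q(2) B0])
    show ?thesis
    proof (cases "u \<le> 1")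
      case True
      have "g u \<le> 8 * (C + 1) * K * sqrt u" by (rule g_le_sqrt[OF u])
      also have "\<dots> \<le> 8 * (C + 1) * K * (sqrt 2 / (1 - exp (- 1)) * bernstein_root u)"
        by (rule mult_left_mono[OF sqrt_le_bernstein_root[OF u True] nn])
      finally show ?thesis using P2 by (simp add: A_def distrib_right mult.assoc)
    next
      case False
      have "1 - exp (- 1) \<le> 1 - exp (- u)" using False by simp
      also have "\<dots> \<le> bernstein_root u" using bernstein_root_ge_term[of 0 u] u by simp
      finally have "V / (1 - exp (- 1)) * (1 - exp (- 1)) \<le> V / (1 - exp (- 1)) * bernstein_root u"
        by (rule mult_left_mono[OF _ Q(2)])
      then have "V \<le> V / (1 - exp (- 1)) * bernstein_root u" using e1 by simp
      then show ?thesis using g_le_V[of u] P1 by (simp add: A_def distrib_right)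
    qed
  qed
  have "\<beta> < 1 / 2" using assms(2) by simp
  note limit = subordinator_small_time_limit[OF assms(3,4) this almost_monotone_density_diffuse[OF assms(5)] g_mono g_nonneg g_le]
  interpret PD: prob_space PD using assms(3) by (simp add: subordinator_def)
  interpret LP: pair_sigma_finite lborel PD ..
  \<comment> \<open>Fubini, in the variables starting point and subordinator path: \<open>Q\<^sup>~(t) = E Q(D\<^sub>t)\<close>\<close>
  have identity: "V - subordinate_killed_heat_content PW W PD D \<Omega> t = (\<integral>\<eta>. g (D t \<eta>) \<partial>PD)" if t: "0 < t" for t
  proof -
    have Dm [measurable]: "D t \<in> borel_measurable PD" using assms(3) t by (simp add: subordinator_def)
    have Dpos: "0 < D t \<eta>" if "\<eta> \<in> space PD" for \<eta> by (rule subordinator_pos[OF assms(3) that t])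
    define F where "F z = indicator \<Omega> (fst z) * S (fst z) (snd z) * indicator {0<..} (snd z)" for z :: "'b \<times> real"
    have F: "F \<in> borel_measurable (borel \<Otimes>\<^sub>M borel)"
      unfolding F_def[abs_def] S_def by (rule survival_probability_jointly_measurable[OF bm \<Omega>])
    define G where "G x \<eta> = F (x, D t \<eta>)" for x \<eta>
    have G_meas: "(\<lambda>(x, \<eta>). G x \<eta>) \<in> borel_measurable (lborel \<Otimes>\<^sub>M PD)"
      unfolding G_def using F by measurable
    have G_eq: "G x \<eta> = indicator \<Omega> x * S x (D t \<eta>)" if "\<eta> \<in> space PD" for x \<eta>
      using Dpos[OF that] by (simp add: G_def F_def)
    have G_bound: "\<bar>G x \<eta>\<bar> \<le> indicator \<Omega> x" for x \<eta>
      using S01 by (simp add: G_def F_def indicator_def)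
    have G_int: "integrable (lborel \<Otimes>\<^sub>M PD) (\<lambda>(x, \<eta>). G x \<eta>)"
    proof (rule Bochner_Integration.integrable_bound)
      have "emeasure (lborel \<Otimes>\<^sub>M PD) (\<Omega> \<times> space PD) = emeasure lborel \<Omega> * emeasure PD (space PD)"
        by (rule PD.emeasure_pair_measure_Times) auto
      then show "integrable (lborel \<Otimes>\<^sub>M PD) (indicator (\<Omega> \<times> space PD) :: _ \<Rightarrow> real)"
        using fin by (intro integrable_real_indicator) (auto simp: PD.emeasure_space_1)
      show "AE z in lborel \<Otimes>\<^sub>M PD. norm (case z of (x, \<eta>) \<Rightarrow> G x \<eta>) \<le> norm (indicator (\<Omega> \<times> space PD) z :: real)"
      proof (rule AE_I2)
        fix z :: "'b \<times> 's" assume "z \<in> space (lborel \<Otimes>\<^sub>M PD)"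
        then show "norm (case z of (x, \<eta>) \<Rightarrow> G x \<eta>) \<le> norm (indicator (\<Omega> \<times> space PD) z :: real)"
          using G_bound[of "fst z" "snd z"] by (cases z) (simp add: space_pair_measure indicator_def split: if_splits)
      qed
    qed (rule G_meas)
    let ?E = "\<lambda>x. {(\<omega>, \<eta>) \<in> space (PW x \<Otimes>\<^sub>M PD). ereal t < exit_time (Some ` \<Omega>) (\<lambda>s. killed_path \<Omega> (\<lambda>r. W r \<omega>) (D s \<eta>))}"
    have inner: "indicator \<Omega> x * measure (PW x \<Otimes>\<^sub>M PD) (?E x)
        = (\<integral>\<eta>. G x \<eta> \<partial>PD)" for x
    proof (cases "x \<in> \<Omega>")
      case False
      then show ?thesis using G_eq by (simp add: Bochner_Integration.integral_cong[of PD PD "G x" "\<lambda>_. 0"])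
    next
      case True
      interpret Px: prob_space "PW x" by (rule brownian_motionD[OF bm])
      interpret P: pair_prob_space "PW x" PD ..
      let ?T = "survival_event (PW x) W \<Omega>"
      let ?E' = "{z \<in> space (PW x \<Otimes>\<^sub>M PD). ereal (D t (snd z)) < exit_time \<Omega> (\<lambda>r. W r (fst z))}"
      let ?U = "(\<Union>q\<in>{q::rat. 0 < q}. ?T (of_rat q) \<times> {\<eta> \<in> space PD. D t \<eta> < of_rat q})"
      have event: "?E x = ?E'"
      proof (rule set_eqI)
        fix z :: "'w \<times> 's"
        obtain \<omega> \<eta> where z: "z = (\<omega>, \<eta>)" by (cases z)
        show "z \<in> ?E x \<longleftrightarrow> z \<in> ?E'"
        proof (cases "\<eta> \<in> space PD")
          case True
          then have d: "D 0 \<eta> = 0" "strict_mono_on {0..} (\<lambda>s. D s \<eta>)" "cadlag (\<lambda>s. D s \<eta>)"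
            using assms(3) by (auto simp: subordinator_def)
          have "((\<lambda>s. D s \<eta>) \<longlongrightarrow> D t \<eta>) (at_right t)" using d(3) t by (simp add: cadlag_def)
          from subordinate_exit_iff[OF d(1,2) this t, of \<Omega> "\<lambda>r. W r \<omega>"]
          show ?thesis by (simp add: z)
        qed (simp add: z space_pair_measure)
      qed
      \<comment> \<open>a rational between \<open>D\<^sub>t\<close> and the exit time separates the two coordinates\<close>
      have "?E'
          = ?U"
      proof (intro equalityI subsetI)
        fix z assume z: "z \<in> ?E'"
        then have sp: "fst z \<in> space (PW x)" "snd z \<in> space PD" by (auto simp: space_pair_measure)
        obtain r where r: "ereal (D t (snd z)) < ereal r" "ereal r < exit_time \<Omega> (\<lambda>r. W r (fst z))"
          using z ereal_dense2 by blast
        obtain q where q: "D t (snd z) < of_rat q" "of_rat q < r" using of_rat_dense r(1) by auto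
        have "0 < (of_rat q :: real)" using Dpos[OF sp(2)] q(1) by linarith
        then have "0 < q" by simp
        moreover have "z \<in> ?T (of_rat q) \<times> {\<eta> \<in> space PD. D t \<eta> < of_rat q}"
          using sp q ereal_less_mono[OF less_imp_le[OF q(2)] r(2)] by (cases z) simp
        ultimately show "z \<in> ?U" by blast
      next
        fix z assume "z \<in> ?U"
        then obtain q where q: "z \<in> ?T (of_rat q) \<times> {\<eta> \<in> space PD. D t \<eta> < of_rat q}" by blast
        then show "z \<in> ?E'"
          using ereal_less_mono[of "D t (snd z)" "of_rat q"] by (cases z) (simp add: space_pair_measure)
      qed
      also have "\<dots> \<in> sets (PW x \<Otimes>\<^sub>M PD)"
      proof (rule sets.countable_UN'')
        fix q :: rat assume "q \<in> {q. 0 < q}"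
        then have "?T (of_rat q) \<in> sets (PW x)" by (intro survival_event_measurable[OF bm _ \<Omega>]) simp
        then show "?T (of_rat q) \<times> {\<eta> \<in> space PD. D t \<eta> < of_rat q} \<in> sets (PW x \<Otimes>\<^sub>M PD)"
          by (rule pair_measureI) measurable
      qed simp
      finally have E_meas: "?E x \<in> sets (PW x \<Otimes>\<^sub>M PD)" unfolding event .
      have slice: "emeasure (PW x) ((\<lambda>\<omega>. (\<omega>, \<eta>)) -` ?E x) = ennreal (G x \<eta>)" if \<eta>: "\<eta> \<in> space PD" for \<eta>
      proof -
        have "(\<lambda>\<omega>. (\<omega>, \<eta>)) -` ?E x = ?T (D t \<eta>)"
          unfolding event using \<eta> by (simp add: space_pair_measure vimage_def)
        then show ?thesis
          using True by (simp add: G_eq[OF \<eta>] Px.emeasure_eq_measure S_def survival_probability_def)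
      qed
      have Gx: "G x \<in> borel_measurable PD"
        using measurable_compose[OF measurable_Pair1'[of x lborel PD] G_meas] by simp
      have Gx_int: "integrable PD (G x)"
        by (rule PD.integrable_const_bound[of _ 1]) (use Gx G_bound[of x] True in auto)
      have "ennreal (measure (PW x \<Otimes>\<^sub>M PD) (?E x)) = emeasure (PW x \<Otimes>\<^sub>M PD) (?E x)"
        by (simp add: P.emeasure_eq_measure)
      also have "\<dots> = (\<integral>\<^sup>+\<eta>. emeasure (PW x) ((\<lambda>\<omega>. (\<omega>, \<eta>)) -` ?E x) \<partial>PD)"
        by (rule P.emeasure_pair_measure_alt2[OF E_meas])
      also have "\<dots> = (\<integral>\<^sup>+\<eta>. ennreal (G x \<eta>) \<partial>PD)"
        by (intro nn_integral_cong slice)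
      also have "\<dots> = ennreal (\<integral>\<eta>. G x \<eta> \<partial>PD)"
        by (intro nn_integral_eq_integral Gx_int AE_I2) (simp add: G_eq S01)
      finally have "measure (PW x \<Otimes>\<^sub>M PD) (?E x) = (\<integral>\<eta>. G x \<eta> \<partial>PD)"
        by (subst (asm) ennreal_inj) (auto intro!: integral_nonneg_AE AE_I2 simp: G_eq S01)
      then show ?thesis using True by simp
    qed
    have "subordinate_killed_heat_content PW W PD D \<Omega> t = (\<integral>x. (\<integral>\<eta>. G x \<eta> \<partial>PD) \<partial>lborel)"
      unfolding subordinate_killed_heat_content_def set_lebesgue_integral_def real_scaleR_def inner ..
    also have "\<dots> = (\<integral>\<eta>. (\<integral>x. G x \<eta> \<partial>lborel) \<partial>PD)"
      by (rule LP.Fubini_integral[OF G_int, symmetric])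
    also have "\<dots> = (\<integral>\<eta>. heat_content PW W \<Omega> (D t \<eta>) \<partial>PD)"
      by (intro Bochner_Integration.integral_cong refl) (simp add: G_eq heat)
    finally have Q: "subordinate_killed_heat_content PW W PD D \<Omega> t = (\<integral>\<eta>. heat_content PW W \<Omega> (D t \<eta>) \<partial>PD)" .
    have "integrable PD (\<lambda>\<eta>. \<integral>x. G x \<eta> \<partial>lborel)"
      by (rule LP.integrable_snd[OF G_int])
    moreover have "integrable PD (\<lambda>\<eta>. \<integral>x. G x \<eta> \<partial>lborel) = integrable PD (\<lambda>\<eta>. heat_content PW W \<Omega> (D t \<eta>))"
      by (intro Bochner_Integration.integrable_cong refl) (simp add: G_eq heat)
    ultimately have "integrable PD (\<lambda>\<eta>. heat_content PW W \<Omega> (D t \<eta>))" by simp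
    then show ?thesis unfolding Q g_def by (simp add: PD.prob_space)
  qed
  have "\<forall>\<^sub>F t in at_right 0. (\<integral>\<eta>. g (D t \<eta>) \<partial>PD) / t = (V - subordinate_killed_heat_content PW W PD D \<Omega> t) / t"
    using eventually_at_right_less[of 0] by eventually_elim (simp only: identity)
  from Lim_transform_eventually[OF limit(2) this]
  show ?thesis using limit(1) unfolding g_def V_def by blast
qed

end
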